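(* Let $\mathcal{A}=\bigcup_{i=1}^d V(\alpha_i)\subseteq\mathbb{P}^2$ be an arrangement of distinct lines. Let $\pi\colon X\to\mathbb{P}^2$ be the blowup at the points of $L_2(\mathcal{A})$ and let $\phi_{\mathcal{A}}\colon X\to\mathbb{P}(H^0(D_{\mathcal{A}})^\vee)$ be the map defined by the complete linear system of $D_{\mathcal{A}}$. Then the map $\phi_{\mathcal{A}}$ (1) is an isomorphism on $\pi^{-1}(\mathbb{P}^2\setminus\mathcal{A})$; (2) contracts the lines of $\mathcal{A}$ to points; (3) takes $E_p$ to a rational normal curve of degree $\mu(p)$, for $p\in L_2(\mathcal{A})$.
   Context: All varieties are over $\mathbb{C}$. $\alpha_1,\dots,\alpha_d\in\mathbb{C}[x,y,z]$ are pairwise non-proportional nonzero linear forms. $L_2(\mathcal{A})$ is the set of points of $\mathbb{P}^2$ lying on at least two of the lines; for $p\in L_2(\mathcal{A})$, $\mu(p)$ is one less than the number of lines of $\mathcal{A}$ through $p$. On $X$, $E_0$ is the class of the pullback of a line in $\mathbb{P}^2$ and $E_p$ is the exceptional curve over $p$; $D_{\mathcal{A}}=(d-1)E_0-\sum_{p\in L_2(\mathcal{A})}\mu(p)E_p$. With $\alpha=\prod_{i=1}^d\alpha_i$ and $l_i=\alpha/\alpha_i$, the space $H^0(D_{\mathcal{A}})$ is identified with $\mathrm{Span}_{\mathbb{C}}\{l_1,\dots,l_d\}$, so that $\phi_{\mathcal{A}}$ is given away from the exceptional curves by $[l_1:\dots:l_d]$.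
   Formalization: Item (1) is asserted only when the lines of the arrangement do not all pass through one common point (for concurrent lines the map factors through projection from that point, so (1) fails); d ≥ 1 is assumed so that the map is defined. *)

theory Defs
  imports "HOL-Analysis.Analysis"
begin

section \<open>Spaces with functions\<close>

text \<open>Varieties are handled classically: a set of points with its Zariski topology and the
  sheaf of complex-valued regular functions.  A value of \<open>reg X U\<close> outside \<open>U\<close> is irrelevant.\<close>

record 'a fspace =
  zar :: "'a topology"
  reg :: "'a set \<Rightarrow> ('a \<Rightarrow> complex) set"

abbreviation points :: "'a fspace \<Rightarrow> 'a set" where
  "points X \<equiv> topspace (zar X)"

definition morphism :: "'a fspace \<Rightarrow> 'b fspace \<Rightarrow> ('a \<Rightarrow> 'b) \<Rightarrow> bool" where
  "morphism X Y f \<longleftrightarrow>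
     continuous_map (zar X) (zar Y) f \<and>
     (\<forall>V. openin (zar Y) V \<longrightarrow>
        (\<forall>g\<in>reg Y V. g \<circ> f \<in> reg X {x \<in> points X. f x \<in> V}))"

text \<open>When \<open>Y\<close> is the image of \<open>f\<close> in a projective space with the structure induced from it,
  this says that \<open>f\<close> is an isomorphism onto its image.\<close>

definition isomorphism :: "'a fspace \<Rightarrow> 'b fspace \<Rightarrow> ('a \<Rightarrow> 'b) \<Rightarrow> bool" where
  "isomorphism X Y f \<longleftrightarrow>
     bij_betw f (points X) (points Y) \<and> morphism X Y f \<and>
     morphism Y X (inv_into (points X) f)"

text \<open>\<open>R x\<close> is the set of homogeneous coordinate vectors of the point \<open>x\<close>, and \<open>H e\<close> is the set
  of homogeneous polynomial functions of (multi)degree \<open>e\<close>.  A subset \<open>S\<close> receives the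
  induced structure: regular functions are locally quotients of two homogeneous polynomials
  of the same degree.\<close>

definition embedded ::
  "('a \<Rightarrow> 'v set) \<Rightarrow> ('e \<Rightarrow> ('v \<Rightarrow> complex) set) \<Rightarrow> 'a set \<Rightarrow> 'a fspace" where
  "embedded R H S =
    \<lparr> zar = topology_generated_by {{x \<in> S. \<exists>v\<in>R x. F v \<noteq> 0} | F. \<exists>e. F \<in> H e},
      reg = (\<lambda>U. {f. \<forall>x\<in>U. \<exists>e. \<exists>F\<in>H e. \<exists>G\<in>H e.
               (\<forall>v\<in>R x. G v \<noteq> 0) \<and>
               (\<forall>y\<in>U. \<forall>v\<in>R y. G v \<noteq> 0 \<longrightarrow> f y = F v / G v)}) \<rparr>"


section \<open>Projective and multiprojective spaces\<close>

inductive_set poly_funs :: "(('k \<Rightarrow> complex) \<Rightarrow> complex) set" where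
  const: "(\<lambda>_. c) \<in> poly_funs"
| coord: "(\<lambda>v. v k) \<in> poly_funs"
| add: "F \<in> poly_funs \<Longrightarrow> G \<in> poly_funs \<Longrightarrow> (\<lambda>v. F v + G v) \<in> poly_funs"
| mult: "F \<in> poly_funs \<Longrightarrow> G \<in> poly_funs \<Longrightarrow> (\<lambda>v. F v * G v) \<in> poly_funs"

type_synonym 'i ppt = "('i \<Rightarrow> complex) set"

text \<open>Points of the projective space of a vector space \<open>W\<close> are the one-dimensional subspaces
  of \<open>W\<close>.\<close>

definition cspan1 :: "('i \<Rightarrow> complex) \<Rightarrow> 'i ppt" where
  "cspan1 v = {\<lambda>i. c * v i | c. True}"

definition proj :: "('i \<Rightarrow> complex) set \<Rightarrow> 'i ppt set" where
  "proj W = cspan1 ` (W - {\<lambda>_. 0})"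

definition forms :: "nat \<Rightarrow> (('i \<Rightarrow> complex) \<Rightarrow> complex) set" where
  "forms e = {F \<in> poly_funs. \<forall>c v. F (\<lambda>i. c * v i) = c ^ e * F v}"

definition proj_space :: "'i ppt set \<Rightarrow> 'i ppt fspace" where
  "proj_space = embedded (\<lambda>L. L - {\<lambda>_. 0}) forms"

text \<open>Products of projective spaces over a finite index set \<open>J\<close>; \<open>v (j, i)\<close> is the \<open>i\<close>-th
  homogeneous coordinate on the \<open>j\<close>-th factor.  Since the scalars \<open>c j\<close> with \<open>j \<notin> J\<close> are
  unconstrained, a multihomogeneous function does not depend on the coordinates outside
  of \<open>J\<close>.\<close>

definition multiforms :: "'j set \<Rightarrow> ('j \<Rightarrow> nat) \<Rightarrow> (('j \<times> 'i \<Rightarrow> complex) \<Rightarrow> complex) set" where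
  "multiforms J e =
    {F \<in> poly_funs. \<forall>c v. F (\<lambda>(j, i). c j * v (j, i)) = (\<Prod>j\<in>J. c j ^ e j) * F v}"

definition multiproj_space :: "'j set \<Rightarrow> ('j \<Rightarrow> 'i ppt) set \<Rightarrow> ('j \<Rightarrow> 'i ppt) fspace" where
  "multiproj_space J =
    embedded (\<lambda>x. {v. \<forall>j\<in>J. (\<lambda>i. v (j, i)) \<in> x j - {\<lambda>_. 0}}) (multiforms J)"

text \<open>A rational normal curve of degree \<open>m\<close> in \<open>proj W\<close>: the image of
  \<open>[a : b] \<mapsto> [a^m : a^(m-1) b : \<dots> : b^m]\<close> in an \<open>m\<close>-dimensional linear subspace of
  \<open>proj W\<close>, with respect to some homogeneous coordinates of that subspace.\<close>

definition rational_normal_curve :: "('i \<Rightarrow> complex) set \<Rightarrow> nat \<Rightarrow> 'i ppt set \<Rightarrow> bool" where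
  "rational_normal_curve W m \<Gamma> \<longleftrightarrow>
    (\<exists>w. (\<forall>j\<le>m. w j \<in> W) \<and>
         (\<forall>c. (\<forall>i. (\<Sum>j\<le>m. c j * w j i) = 0) \<longrightarrow> (\<forall>j\<le>m. c j = 0)) \<and>
         \<Gamma> = {cspan1 (\<lambda>i. \<Sum>j\<le>m. a ^ (m - j) * b ^ j * w j i) | a b. (a, b) \<noteq> (0, 0)})"


section \<open>Blowups of the plane\<close>

text \<open>A linear form on \<open>\<complex>\<^sup>3\<close> is given by its coefficient vector, so lines of the plane are
  points of the dual plane, which is again \<open>P2\<close>.\<close>

definition P2 :: "3 ppt set" where
  "P2 = proj UNIV"

definition lin :: "(3 \<Rightarrow> complex) \<Rightarrow> (3 \<Rightarrow> complex) \<Rightarrow> complex" where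
  "lin a v = (\<Sum>i\<in>UNIV. a i * v i)"

definition zero_line :: "(3 \<Rightarrow> complex) \<Rightarrow> 3 ppt set" where
  "zero_line a = {x \<in> P2. \<forall>v\<in>x. lin a v = 0}"

text \<open>The blowup of the plane at a finite set \<open>C\<close> of points, as a closed subvariety of
  \<open>P2 \<times> (\<Prod>p\<in>C. dual P2)\<close>.  A point consists of a point \<open>x None\<close> of the plane together with,
  for every \<open>p \<in> C\<close>, a line \<open>x (Some p)\<close> through both \<open>p\<close> and \<open>x None\<close>; this line is
  determined by \<open>x None\<close> unless \<open>x None = p\<close>, in which case it runs through the whole pencil
  of lines through \<open>p\<close>.  For a single point this is the usual model
  \<open>{(x, l) \<in> P2 \<times> P1. x \<in> l}\<close>, and for several points the fibre product over \<open>P2\<close>.\<close>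

type_synonym bpt = "3 ppt option \<Rightarrow> 3 ppt"

definition blowup_pts :: "3 ppt set \<Rightarrow> bpt set" where
  "blowup_pts C = {x \<in> PiE (insert None (Some ` C)) (\<lambda>_. P2).
     \<forall>p\<in>C. \<forall>a \<in> x (Some p). \<forall>v \<in> p \<union> x None. lin a v = 0}"

definition blowup_sub :: "3 ppt set \<Rightarrow> bpt set \<Rightarrow> bpt fspace" where
  "blowup_sub C = multiproj_space (insert None (Some ` C))"

definition blowup :: "3 ppt set \<Rightarrow> bpt fspace" where
  "blowup C = blowup_sub C (blowup_pts C)"

definition bproj :: "bpt \<Rightarrow> 3 ppt" where
  "bproj x = x None"

definition exceptional :: "3 ppt set \<Rightarrow> 3 ppt \<Rightarrow> bpt set" where
  "exceptional C p = {x \<in> points (blowup C). bproj x = p}"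

definition strict_transform :: "3 ppt set \<Rightarrow> 3 ppt set \<Rightarrow> bpt set" where
  "strict_transform C L =
     zar (blowup C) closure_of {x \<in> points (blowup C). bproj x \<in> L - C}"


section \<open>Complete linear systems on a blowup\<close>

text \<open>On \<open>U\<close>, the ideal sheaf of \<open>E\<close> is generated by \<open>t\<close>.\<close>

definition local_equation ::
  "'a fspace \<Rightarrow> 'a set \<Rightarrow> 'a set \<Rightarrow> ('a \<Rightarrow> complex) \<Rightarrow> bool" where
  "local_equation X E U t \<longleftrightarrow>
     t \<in> reg X U \<and>
     (\<forall>V\<subseteq>U. openin (zar X) V \<longrightarrow>
       (\<forall>f\<in>reg X V. (\<forall>y\<in>E \<inter> V. f y = 0) \<longleftrightarrow> (\<exists>g\<in>reg X V. \<forall>y\<in>V. f y = t y * g y)))"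

text \<open>The divisor class \<open>k E\<^sub>0 - (\<Sum>p\<in>C. m p E\<^sub>p)\<close> is given by \<open>C\<close>, \<open>k\<close> and \<open>m\<close>.  Its line
  bundle is the pullback of \<open>O(k)\<close> from the plane, tensored with the \<open>m p\<close>-th powers of the
  ideal sheaves of the curves \<open>E\<^sub>p\<close>.  The fibre of \<open>O(k)\<close> at a one-dimensional subspace
  \<open>L \<subseteq> \<complex>\<^sup>3\<close> consists of the functions on \<open>L\<close> that are homogeneous of degree \<open>k\<close>; hence a section
  \<open>s\<close> has values \<open>s y v\<close> with \<open>v \<in> bproj y\<close>, and \<open>h^k * (\<Prod>p\<in>C. t p ^ m p)\<close> is a local frame
  if \<open>h\<close> is a linear form without zeros on \<open>U\<close> and the \<open>t p\<close> are local equations of the \<open>E\<^sub>p\<close>.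
  In \<open>local_value C k m U s f\<close>, the function \<open>f\<close> is the coefficient of \<open>s\<close> with respect to
  such a frame.\<close>

type_synonym sec = "bpt \<Rightarrow> (3 \<Rightarrow> complex) \<Rightarrow> complex"

definition local_value ::
  "3 ppt set \<Rightarrow> nat \<Rightarrow> (3 ppt \<Rightarrow> nat) \<Rightarrow> bpt set \<Rightarrow> sec \<Rightarrow> (bpt \<Rightarrow> complex) \<Rightarrow> bool" where
  "local_value C k m U s f \<longleftrightarrow>
     openin (zar (blowup C)) U \<and> f \<in> reg (blowup C) U \<and>
     (\<exists>h t. (\<forall>y\<in>U. bproj y \<notin> zero_line h) \<and>
            (\<forall>p\<in>C. local_equation (blowup C) (exceptional C p) U (t p)) \<and>
            (\<forall>y\<in>U. \<forall>v\<in>bproj y. s y v = f y * (lin h v ^ k * (\<Prod>p\<in>C. t p y ^ m p))))"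

definition H0 :: "3 ppt set \<Rightarrow> nat \<Rightarrow> (3 ppt \<Rightarrow> nat) \<Rightarrow> sec set" where
  "H0 C k m =
     {s. (\<forall>x\<in>points (blowup C). \<exists>U f. x \<in> U \<and> local_value C k m U s f) \<and>
         (\<forall>x v. x \<notin> points (blowup C) \<or> v \<notin> bproj x \<longrightarrow> s x v = 0)}"

definition vanishes_at :: "3 ppt set \<Rightarrow> nat \<Rightarrow> (3 ppt \<Rightarrow> nat) \<Rightarrow> sec \<Rightarrow> bpt \<Rightarrow> bool" where
  "vanishes_at C k m s x \<longleftrightarrow> (\<exists>U f. x \<in> U \<and> local_value C k m U s f \<and> f x = 0)"

text \<open>Linear functionals on \<open>H0 C k m\<close>, extended by \<open>0\<close> to the whole type.\<close>

definition H0_dual :: "3 ppt set \<Rightarrow> nat \<Rightarrow> (3 ppt \<Rightarrow> nat) \<Rightarrow> (sec \<Rightarrow> complex) set" where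
  "H0_dual C k m =
     {w. (\<forall>s\<in>H0 C k m. \<forall>t\<in>H0 C k m. \<forall>c. w (\<lambda>x v. c * s x v + t x v) = c * w s + w t) \<and>
         (\<forall>s. s \<notin> H0 C k m \<longrightarrow> w s = 0)}"

text \<open>The map of the complete linear system sends \<open>x\<close> to the line of functionals that
  factor through evaluation of sections at \<open>x\<close>, that is, to the annihilator of the
  hyperplane of sections vanishing at \<open>x\<close>.  At a base point the result is the zero space,
  which is not a point of \<open>proj (H0_dual C k m)\<close>.\<close>

definition linear_system_map ::
  "3 ppt set \<Rightarrow> nat \<Rightarrow> (3 ppt \<Rightarrow> nat) \<Rightarrow> bpt \<Rightarrow> sec ppt" where
  "linear_system_map C k m x =
     {w \<in> H0_dual C k m. \<forall>s\<in>H0 C k m. vanishes_at C k m s x \<longrightarrow> w s = 0}"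


section \<open>Line arrangements\<close>

definition line_arrangement :: "nat \<Rightarrow> (nat \<Rightarrow> 3 \<Rightarrow> complex) \<Rightarrow> bool" where
  "line_arrangement d \<alpha> \<longleftrightarrow>
     d \<ge> 1 \<and> (\<forall>i\<in>{1..d}. \<alpha> i \<noteq> (\<lambda>_. 0)) \<and>
     (\<forall>i\<in>{1..d}. \<forall>j\<in>{1..d}. i \<noteq> j \<longrightarrow> \<not> (\<exists>c. \<alpha> i = (\<lambda>k. c * \<alpha> j k)))"

definition arr_union :: "nat \<Rightarrow> (nat \<Rightarrow> 3 \<Rightarrow> complex) \<Rightarrow> 3 ppt set" where
  "arr_union d \<alpha> = (\<Union>i\<in>{1..d}. zero_line (\<alpha> i))"

definition lines_through :: "nat \<Rightarrow> (nat \<Rightarrow> 3 \<Rightarrow> complex) \<Rightarrow> 3 ppt \<Rightarrow> nat set" where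
  "lines_through d \<alpha> p = {i \<in> {1..d}. p \<in> zero_line (\<alpha> i)}"

definition L2 :: "nat \<Rightarrow> (nat \<Rightarrow> 3 \<Rightarrow> complex) \<Rightarrow> 3 ppt set" where
  "L2 d \<alpha> = {p \<in> P2. card (lines_through d \<alpha> p) \<ge> 2}"

definition mu :: "nat \<Rightarrow> (nat \<Rightarrow> 3 \<Rightarrow> complex) \<Rightarrow> 3 ppt \<Rightarrow> nat" where
  "mu d \<alpha> p = card (lines_through d \<alpha> p) - 1"

definition arr_dual :: "nat \<Rightarrow> (nat \<Rightarrow> 3 \<Rightarrow> complex) \<Rightarrow> (sec \<Rightarrow> complex) set" where
  "arr_dual d \<alpha> = H0_dual (L2 d \<alpha>) (d - 1) (mu d \<alpha>)"

definition arr_map :: "nat \<Rightarrow> (nat \<Rightarrow> 3 \<Rightarrow> complex) \<Rightarrow> bpt \<Rightarrow> sec ppt" where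
  "arr_map d \<alpha> = linear_system_map (L2 d \<alpha>) (d - 1) (mu d \<alpha>)"

text \<open>If all lines pass through one point \<open>p\<close>, every section is a product of \<open>d - 1\<close> linear forms
  vanishing at \<open>p\<close>, and the map factors through the projection from \<open>p\<close>: it is not injective
  on the complement of the lines.\<close>

definition concurrent :: "nat \<Rightarrow> (nat \<Rightarrow> 3 \<Rightarrow> complex) \<Rightarrow> bool" where
  "concurrent d \<alpha> \<longleftrightarrow> (\<exists>p\<in>P2. \<forall>i\<in>{1..d}. p \<in> zero_line (\<alpha> i))"

definition compl_preimage :: "nat \<Rightarrow> (nat \<Rightarrow> 3 \<Rightarrow> complex) \<Rightarrow> bpt set" where
  "compl_preimage d \<alpha> =
     {x \<in> points (blowup (L2 d \<alpha>)). bproj x \<in> P2 - arr_union d \<alpha>}"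

end

theory Submission
  imports Defs "HOL-Computational_Algebra.Fundamental_Theorem_Algebra"
begin

text \<open>
  Let \<open>l\<^sub>i\<close> be the product of all the forms \<open>\<alpha> j\<close> except \<open>\<alpha> i\<close>.  The \<open>l\<^sub>i\<close> are
  global sections, and the proof compares an arbitrary section with them on the curves in question.

  Near a point \<open>x\<close> of the blowup every section is a regular coefficient times a frame of the
  line bundle, and two frames differ by a unit (\<open>frame_compare\<close>).  Taking coefficients
  at \<open>x\<close> is a linear functional, the evaluation at \<open>x\<close>, and where some section does not vanish,
  the linear system maps \<open>x\<close> to the line spanned by it (\<open>linear_system_map_eq\<close>).  At a point over
  \<open>p \<in> L\<^sub>2\<close> there are coordinates \<open>u\<close> and \<open>w\<close>: the point lies on the line through \<open>p\<close> of slope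
  \<open>w\<close>, at the position \<open>u\<close>, and \<open>u\<close> is an equation of the exceptional curve
  (\<open>local_equation_ucoord\<close>).  A line of the arrangement through \<open>p\<close> contributes to \<open>l\<^sub>i\<close>
  one factor \<open>u\<close> times a linear function of \<open>w\<close> with its zero at the slope of the line.  Hence \<open>l\<^sub>i\<close> is a section of the
  bundle (\<open>lsec_H0\<close>), and if the line \<open>i\<close> runs through \<open>p\<close>, it vanishes at a point over \<open>p\<close> only
  if the strict transform of another line contains it (\<open>lsec_nonvanishing_exceptional\<close>).  Two strict
  transforms never meet, so there are no base points and the map is a morphism.

  Off the lines the map is \<open>v \<mapsto> [1/\<alpha>\<^sub>1(v) : \<dots> : 1/\<alpha>\<^sub>d(v)]\<close>.  If the lines are not concurrent,
  three of the forms are coordinates of the plane, and inverting the corresponding values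
  recovers \<open>v\<close> by polynomial formulas (\<open>inverse_vec\<close>).

  On the strict transform of the line \<open>i\<close>, the section \<open>l\<^sub>i\<close> has no zeros.  The quotient of any
  section by \<open>l\<^sub>i\<close> is thus a regular function on a projective line, that is, a constant
  (\<open>section_proportional_on_line\<close>).  So all points of the line off \<open>L\<^sub>2\<close> impose the same condition
  on sections and have the same image; the other points of the curve follow, because the fibres of
  the map are closed (\<open>closed_fibre\<close>).

  On the exceptional curve over \<open>p\<close>, the coefficient of a section is a polynomial in \<open>w\<close>.  In the
  chart at the other end of the pencil the frame changes by the factor \<open>(-w)^\<mu>\<close>, so
  its degree is at most \<open>\<mu>(p)\<close> (\<open>epoly_transition\<close>).  Its coefficients are functionals that put the
  image of the curve into the form of a rational normal curve.  They are independent
  because the \<open>\<mu>(p) + 1\<close> sections \<open>l\<^sub>i\<close> of the lines through \<open>p\<close> restrict to a Lagrange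
  interpolation basis for the slopes of these lines (\<open>epoly_lsec_spans\<close>).
\<close>

section \<open>Regular functions on embedded spaces\<close>

text \<open>The sheaf of regular functions of \<open>embedded R H S\<close>.  It is the same for all \<open>S\<close>, so that
  functions restrict to subsets without any change.\<close>

definition rfun :: "('a \<Rightarrow> 'v set) \<Rightarrow> ('e \<Rightarrow> ('v \<Rightarrow> complex) set) \<Rightarrow> 'a set \<Rightarrow> ('a \<Rightarrow> complex) set" where
  "rfun R H U = {f. \<forall>x\<in>U. \<exists>e. \<exists>F\<in>H e. \<exists>G\<in>H e.
     (\<forall>v\<in>R x. G v \<noteq> 0) \<and> (\<forall>y\<in>U. \<forall>v\<in>R y. G v \<noteq> 0 \<longrightarrow> f y = F v / G v)}"

lemma reg_embedded: "reg (embedded R H S) = rfun R H"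
  by (simp add: embedded_def rfun_def fun_eq_iff)

lemma rfun_mono: "f \<in> rfun R H U \<Longrightarrow> V \<subseteq> U \<Longrightarrow> f \<in> rfun R H V"
  unfolding rfun_def by (intro CollectI ballI) (drule CollectD, drule bspec, erule subsetD, assumption, blast)

lemma rfun_cong: "f \<in> rfun R H U \<Longrightarrow> (\<And>y. y \<in> U \<Longrightarrow> f y = g y) \<Longrightarrow> g \<in> rfun R H U"
  unfolding rfun_def by simp

lemma rfunI:
  assumes "\<And>x. x \<in> U \<Longrightarrow> \<exists>e F G. F \<in> H e \<and> G \<in> H e \<and> (\<forall>v\<in>R x. G v \<noteq> 0) \<and>
    (\<forall>y\<in>U. \<forall>v\<in>R y. G v \<noteq> 0 \<longrightarrow> f y = F v / G v)"
  shows "f \<in> rfun R H U"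
  unfolding rfun_def
proof (intro CollectI ballI)
  fix x assume "x \<in> U"
  then obtain e F G where "F \<in> H e" "G \<in> H e" "\<forall>v\<in>R x. G v \<noteq> 0"
      "\<forall>y\<in>U. \<forall>v\<in>R y. G v \<noteq> 0 \<longrightarrow> f y = F v / G v"
    using assms by blast
  then show "\<exists>e. \<exists>F\<in>H e. \<exists>G\<in>H e. (\<forall>v\<in>R x. G v \<noteq> 0) \<and>
      (\<forall>y\<in>U. \<forall>v\<in>R y. G v \<noteq> 0 \<longrightarrow> f y = F v / G v)"
    by (intro exI[of _ e] bexI[of _ F] bexI[of _ G] conjI)
qed

lemma quotient_witness:
  assumes "F \<in> H e" "G \<in> H e" "\<And>v. v \<in> R x \<Longrightarrow> G v \<noteq> 0"
    "\<And>y v. y \<in> U \<Longrightarrow> v \<in> R y \<Longrightarrow> G v \<noteq> 0 \<Longrightarrow> f y = F v / G v"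
  shows "\<exists>e F G. F \<in> H e \<and> G \<in> H e \<and> (\<forall>v\<in>R x. G v \<noteq> 0) \<and>
    (\<forall>y\<in>U. \<forall>v\<in>R y. G v \<noteq> 0 \<longrightarrow> f y = F v / G v)"
  using assms by (intro exI[of _ e]) (rule exI[of _ F], rule exI[of _ G], blast)

lemma rfunE:
  assumes "f \<in> rfun R H U" "x \<in> U"
  obtains e F G where "F \<in> H e" "G \<in> H e" "\<And>v. v \<in> R x \<Longrightarrow> G v \<noteq> 0"
    "\<And>y v. y \<in> U \<Longrightarrow> v \<in> R y \<Longrightarrow> G v \<noteq> 0 \<Longrightarrow> f y = F v / G v"
proof -
  have "\<forall>x\<in>U. \<exists>e. \<exists>F\<in>H e. \<exists>G\<in>H e. (\<forall>v\<in>R x. G v \<noteq> 0) \<and>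
      (\<forall>y\<in>U. \<forall>v\<in>R y. G v \<noteq> 0 \<longrightarrow> f y = F v / G v)"
    using assms(1) unfolding rfun_def by (rule CollectD)
  from bspec[OF this assms(2)] obtain e F G where "F \<in> H e" "G \<in> H e" "\<forall>v\<in>R x. G v \<noteq> 0"
      "\<forall>y\<in>U. \<forall>v\<in>R y. G v \<noteq> 0 \<longrightarrow> f y = F v / G v"
    by (elim exE bexE conjE)
  then show ?thesis
    by (intro that[of F e G]) simp_all
qed

definition basic_open :: "('a \<Rightarrow> 'v set) \<Rightarrow> 'a set \<Rightarrow> ('v \<Rightarrow> complex) \<Rightarrow> 'a set" where
  "basic_open R S F = {x \<in> S. \<exists>v\<in>R x. F v \<noteq> 0}"

lemma zar_embedded:
  "zar (embedded R H S) = topology_generated_by {basic_open R S F | F. \<exists>e. F \<in> H e}"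
  by (simp add: embedded_def basic_open_def)

lemma openin_basic_open: "F \<in> H e \<Longrightarrow> openin (zar (embedded R H S)) (basic_open R S F)"
  unfolding zar_embedded by (rule topology_generated_by_Basis) blast

text \<open>The common part of projective and multiprojective spaces.  \<open>H_scale\<close> says that changing the
  homogeneous coordinates of a point multiplies all forms of one degree by the same unit, which
  makes the vanishing of a form and the quotient of two forms well defined.\<close>

locale graded_forms =
  fixes R :: "'a \<Rightarrow> 'v set" and H :: "'e \<Rightarrow> ('v \<Rightarrow> complex) set"
    and pl :: "'e \<Rightarrow> 'e \<Rightarrow> 'e" and S0 :: "'a set"
  assumes R_ne: "x \<in> S0 \<Longrightarrow> R x \<noteq> {}"
    and H_add: "F \<in> H e \<Longrightarrow> G \<in> H e \<Longrightarrow> (\<lambda>v. F v + G v) \<in> H e"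
    and H_mult: "F \<in> H e \<Longrightarrow> G \<in> H e' \<Longrightarrow> (\<lambda>v. F v * G v) \<in> H (pl e e')"
    and H_const: "\<exists>e. \<forall>c. (\<lambda>_. c) \<in> H e"
    and H_scale: "x \<in> S0 \<Longrightarrow> v \<in> R x \<Longrightarrow> v' \<in> R x \<Longrightarrow> \<exists>c. c \<noteq> 0 \<and> (\<forall>F\<in>H e. F v' = c * F v)"
begin

lemmas local_witness = quotient_witness[where R = R and H = H]

lemma nonzero_iff: "x \<in> S0 \<Longrightarrow> v \<in> R x \<Longrightarrow> v' \<in> R x \<Longrightarrow> F \<in> H e \<Longrightarrow> F v = 0 \<longleftrightarrow> F v' = 0"
  using H_scale[of x v v' e] by auto

lemma quotient_eq:
  assumes "x \<in> S0" "v \<in> R x" "v' \<in> R x" "F \<in> H e" "G \<in> H e"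
  shows "F v / G v = F v' / G v'"
proof -
  obtain c where "c \<noteq> 0" "\<forall>F\<in>H e. F v' = c * F v"
    using H_scale[OF assms(1-3), of e] by blast
  then have "F v' = c * F v" "G v' = c * G v"
    using assms(4,5) by blast+
  then show ?thesis
    using \<open>c \<noteq> 0\<close> by simp
qed

lemma points_embedded [simp]:
  assumes "S \<subseteq> S0"
  shows "points (embedded R H S) = S"
proof -
  obtain e where "(\<lambda>_. 1) \<in> H e"
    using H_const by blast
  then have "basic_open R S (\<lambda>_. 1) \<in> {basic_open R S F | F. \<exists>e. F \<in> H e}"
    by blast
  moreover have "basic_open R S (\<lambda>_. 1) = S"
    using R_ne assms by (auto simp: basic_open_def)
  moreover have "basic_open R S F \<subseteq> S" for F
    by (auto simp: basic_open_def)
  ultimately show ?thesis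
    unfolding zar_embedded topology_generated_by_topspace by blast
qed

lemma open_basic: "F \<in> H e \<Longrightarrow> openin (zar (embedded R H S)) (basic_open R S F)"
  by (rule openin_basic_open)

lemma basic_openI:
  assumes "S \<subseteq> S0" "x \<in> S" "\<And>v. v \<in> R x \<Longrightarrow> F v \<noteq> 0"
  shows "x \<in> basic_open R S F"
proof -
  obtain v where "v \<in> R x" using R_ne[of x] assms(1,2) by blast
  then show ?thesis
    using assms(2,3) unfolding basic_open_def by blast
qed

lemma basic_openD:
  assumes "S \<subseteq> S0" "x \<in> basic_open R S F" "F \<in> H e" "v \<in> R x"
  shows "F v \<noteq> 0"
proof -
  obtain v' where "x \<in> S" "v' \<in> R x" "F v' \<noteq> 0"
    using assms(2) unfolding basic_open_def by blast
  then show ?thesis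
    using nonzero_iff[OF _ assms(4) _ assms(3), of v'] assms(1) by blast
qed

lemma open_subset: "S \<subseteq> S0 \<Longrightarrow> openin (zar (embedded R H S)) U \<Longrightarrow> U \<subseteq> S"
  using openin_subset[of "zar (embedded R H S)" U] by simp

text \<open>The sets where a form does not vanish are a basis, since a product of forms is a form.\<close>

lemma basic_nbhd:
  assumes S: "S \<subseteq> S0" and U: "openin (zar (embedded R H S)) U" and x: "x \<in> U"
  shows "\<exists>e. \<exists>K\<in>H e. x \<in> basic_open R S K \<and> basic_open R S K \<subseteq> U"
proof -
  have "generate_topology_on {basic_open R S F | F. \<exists>e. F \<in> H e} U"
    using U unfolding zar_embedded openin_topology_generated_by_iff .
  then show ?thesis using x
  proof (induction)
    case (Int a b)
    obtain e K e' K' where K: "K \<in> H e" "x \<in> basic_open R S K" "basic_open R S K \<subseteq> a"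
      and K': "K' \<in> H e'" "x \<in> basic_open R S K'" "basic_open R S K' \<subseteq> b"
      using Int.IH(1)[OF IntD1[OF Int.prems]] Int.IH(2)[OF IntD2[OF Int.prems]] by blast
    have "x \<in> S"
      using K(2) by (simp add: basic_open_def)
    then have "x \<in> basic_open R S (\<lambda>v. K v * K' v)"
      using basic_openD[OF S K(2,1)] basic_openD[OF S K'(2,1)] by (intro basic_openI[OF S]) auto
    moreover have "basic_open R S (\<lambda>v. K v * K' v) \<subseteq> basic_open R S K \<inter> basic_open R S K'"
      by (auto simp: basic_open_def)
    ultimately show ?case
      using K(3) K'(3) by (intro exI[of _ "pl e e'"] bexI[OF _ H_mult[OF K(1) K'(1)]]) blast
  next
    case (UN \<K>)
    then obtain k where k: "k \<in> \<K>" "x \<in> k" by blast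
    obtain e K where "K \<in> H e" "x \<in> basic_open R S K" "basic_open R S K \<subseteq> k"
      using UN.IH[OF k] by blast
    then show ?case
      using k(1) by (intro exI[of _ e] bexI[of _ K]) auto
  next
    case (Basis s)
    then obtain F e where "F \<in> H e" "s = basic_open R S F" by blast
    with Basis.prems show ?case
      by (intro exI[of _ e] bexI[of _ F]) auto
  qed auto
qed

lemma open_restrict:
  assumes "S \<subseteq> S0" "S' \<subseteq> S" "openin (zar (embedded R H S)) U"
  shows "openin (zar (embedded R H S')) (U \<inter> S')"
proof (subst openin_subopen, intro ballI)
  fix x assume x: "x \<in> U \<inter> S'"
  then obtain e K where K: "K \<in> H e" "x \<in> basic_open R S K" "basic_open R S K \<subseteq> U"
    using basic_nbhd[OF assms(1,3)] by blast
  then have "x \<in> basic_open R S' K" "basic_open R S' K \<subseteq> U \<inter> S'"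
    using x assms(2) by (auto simp: basic_open_def)
  then show "\<exists>T. openin (zar (embedded R H S')) T \<and> x \<in> T \<and> T \<subseteq> U \<inter> S'"
    using open_basic[OF K(1)] by (intro exI[of _ "basic_open R S' K"] conjI)
qed

text \<open>In the definition of a regular function the quotient has to be valid on the whole of the
  open set; a local quotient becomes one after multiplying numerator and denominator by a form
  that vanishes outside the neighbourhood.\<close>

lemma rfun_local:
  assumes S: "S \<subseteq> S0" and U: "U \<subseteq> S"
    and loc: "\<And>x. x \<in> U \<Longrightarrow> \<exists>N. openin (zar (embedded R H S)) N \<and> x \<in> N \<and> f \<in> rfun R H N"
  shows "f \<in> rfun R H U"
proof (rule rfunI)
  fix x assume x: "x \<in> U"
  obtain N where N: "openin (zar (embedded R H S)) N" "x \<in> N" "f \<in> rfun R H N"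
    using loc[OF x] by blast
  obtain e' K where K: "K \<in> H e'" "x \<in> basic_open R S K" "basic_open R S K \<subseteq> N"
    using basic_nbhd[OF S N(1,2)] by blast
  obtain e F G where FG: "F \<in> H e" "G \<in> H e" "\<And>v. v \<in> R x \<Longrightarrow> G v \<noteq> 0"
      "\<And>y v. y \<in> N \<Longrightarrow> v \<in> R y \<Longrightarrow> G v \<noteq> 0 \<Longrightarrow> f y = F v / G v"
    by (rule rfunE[OF N(3,2)]) blast
  have 1: "G v * K v \<noteq> 0" if "v \<in> R x" for v
    using that FG(3) basic_openD[OF S K(2,1)] by simp
  have 2: "f y = F v * K v / (G v * K v)" if "y \<in> U" "v \<in> R y" "G v * K v \<noteq> 0" for y v
  proof -
    have "y \<in> basic_open R S K"
      using that U unfolding basic_open_def by auto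
    then have "y \<in> N"
      using K(3) by blast
    then show ?thesis
      using that FG(4) by auto
  qed
  show "\<exists>e F G. F \<in> H e \<and> G \<in> H e \<and> (\<forall>v\<in>R x. G v \<noteq> 0) \<and>
          (\<forall>y\<in>U. \<forall>v\<in>R y. G v \<noteq> 0 \<longrightarrow> f y = F v / G v)"
    by (rule local_witness[OF H_mult[OF FG(1) K(1)] H_mult[OF FG(2) K(1)]]) (rule 1, assumption, rule 2, assumption+)
qed

lemma rfun_const: "(\<lambda>_. c) \<in> rfun R H U"
proof (rule rfunI)
  fix x
  obtain e where "\<forall>c. (\<lambda>_. c) \<in> H e"
    using H_const by blast
  then show "\<exists>e F G. F \<in> H e \<and> G \<in> H e \<and> (\<forall>v\<in>R x. G v \<noteq> 0) \<and>
      (\<forall>y\<in>U. \<forall>v\<in>R y. G v \<noteq> 0 \<longrightarrow> c = F v / G v)"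
    by (intro local_witness[where F = "\<lambda>_. c" and e = e and G = "\<lambda>_. 1"]) simp_all
qed

lemma rfun_mult:
  assumes "f \<in> rfun R H U" "g \<in> rfun R H U"
  shows "(\<lambda>x. f x * g x) \<in> rfun R H U"
proof (rule rfunI)
  fix x assume x: "x \<in> U"
  obtain e F G where FG: "F \<in> H e" "G \<in> H e" "\<And>v. v \<in> R x \<Longrightarrow> G v \<noteq> 0"
      "\<And>y v. y \<in> U \<Longrightarrow> v \<in> R y \<Longrightarrow> G v \<noteq> 0 \<Longrightarrow> f y = F v / G v"
    by (rule rfunE[OF assms(1) x]) blast
  obtain e' F' G' where FG': "F' \<in> H e'" "G' \<in> H e'" "\<And>v. v \<in> R x \<Longrightarrow> G' v \<noteq> 0"
      "\<And>y v. y \<in> U \<Longrightarrow> v \<in> R y \<Longrightarrow> G' v \<noteq> 0 \<Longrightarrow> g y = F' v / G' v"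
    by (rule rfunE[OF assms(2) x]) blast
  have A: "f y * g y = (F v * F' v) / (G v * G' v)" if "y \<in> U" "v \<in> R y" "G v * G' v \<noteq> 0" for y v
    using FG(4)[OF that(1,2)] FG'(4)[OF that(1,2)] that(3) by (simp add: add_frac_eq mult.commute[of "F' v"])
  have B: "G v * G' v \<noteq> 0" if "v \<in> R x" for v
    using FG(3) FG'(3) that by simp
  show "\<exists>e F G. F \<in> H e \<and> G \<in> H e \<and> (\<forall>v\<in>R x. G v \<noteq> 0) \<and>
          (\<forall>y\<in>U. \<forall>v\<in>R y. G v \<noteq> 0 \<longrightarrow> f y * g y = F v / G v)"
    by (rule local_witness[OF H_mult[OF FG(1) FG'(1)] H_mult[OF FG(2) FG'(2)]]) (rule B, assumption, rule A, assumption+)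
qed

lemma rfun_add:
  assumes "f \<in> rfun R H U" "g \<in> rfun R H U"
  shows "(\<lambda>x. f x + g x) \<in> rfun R H U"
proof (rule rfunI)
  fix x assume x: "x \<in> U"
  obtain e F G where FG: "F \<in> H e" "G \<in> H e" "\<And>v. v \<in> R x \<Longrightarrow> G v \<noteq> 0"
      "\<And>y v. y \<in> U \<Longrightarrow> v \<in> R y \<Longrightarrow> G v \<noteq> 0 \<Longrightarrow> f y = F v / G v"
    by (rule rfunE[OF assms(1) x]) blast
  obtain e' F' G' where FG': "F' \<in> H e'" "G' \<in> H e'" "\<And>v. v \<in> R x \<Longrightarrow> G' v \<noteq> 0"
      "\<And>y v. y \<in> U \<Longrightarrow> v \<in> R y \<Longrightarrow> G' v \<noteq> 0 \<Longrightarrow> g y = F' v / G' v"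
    by (rule rfunE[OF assms(2) x]) blast
  have A: "f y + g y = (F v * G' v + G v * F' v) / (G v * G' v)" if "y \<in> U" "v \<in> R y" "G v * G' v \<noteq> 0" for y v
    using FG(4)[OF that(1,2)] FG'(4)[OF that(1,2)] that(3) by (simp add: add_frac_eq mult.commute[of "F' v"])
  have B: "G v * G' v \<noteq> 0" if "v \<in> R x" for v
    using FG(3) FG'(3) that by simp
  show "\<exists>e F G. F \<in> H e \<and> G \<in> H e \<and> (\<forall>v\<in>R x. G v \<noteq> 0) \<and>
          (\<forall>y\<in>U. \<forall>v\<in>R y. G v \<noteq> 0 \<longrightarrow> f y + g y = F v / G v)"
    by (rule local_witness[OF H_add[OF H_mult[OF FG(1) FG'(2)] H_mult[OF FG(2) FG'(1)]] H_mult[OF FG(2) FG'(2)]]) (rule B, assumption, rule A, assumption+)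
qed

text \<open>The quotient \<open>G / F\<close> may have a larger domain than \<open>F / G\<close>; \<open>G G / (F G)\<close> has not.\<close>

lemma rfun_inverse:
  assumes "f \<in> rfun R H U" "\<And>x. x \<in> U \<Longrightarrow> f x \<noteq> 0"
  shows "(\<lambda>x. inverse (f x)) \<in> rfun R H U"
proof (rule rfunI)
  fix x assume x: "x \<in> U"
  obtain e F G where FG: "F \<in> H e" "G \<in> H e" "\<And>v. v \<in> R x \<Longrightarrow> G v \<noteq> 0"
      "\<And>y v. y \<in> U \<Longrightarrow> v \<in> R y \<Longrightarrow> G v \<noteq> 0 \<Longrightarrow> f y = F v / G v"
    by (rule rfunE[OF assms(1) x]) blast
  have A: "inverse (f y) = G v * G v / (F v * G v)" if "y \<in> U" "v \<in> R y" "F v * G v \<noteq> 0" for y v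
    using FG(4)[OF that(1,2)] that(3) by simp
  have B: "F v * G v \<noteq> 0" if v: "v \<in> R x" for v
    using FG(3)[OF v] FG(4)[OF x v] assms(2)[OF x] by auto
  show "\<exists>e F G. F \<in> H e \<and> G \<in> H e \<and> (\<forall>v\<in>R x. G v \<noteq> 0) \<and>
          (\<forall>y\<in>U. \<forall>v\<in>R y. G v \<noteq> 0 \<longrightarrow> inverse (f y) = F v / G v)"
    by (rule local_witness[OF H_mult[OF FG(2) FG(2)] H_mult[OF FG(1) FG(2)]]) (rule B, assumption, rule A, assumption+)
qed

lemma rfun_divide:
  assumes "f \<in> rfun R H U" "g \<in> rfun R H U" "\<And>x. x \<in> U \<Longrightarrow> g x \<noteq> 0"
  shows "(\<lambda>x. f x / g x) \<in> rfun R H U"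
  using rfun_mult[OF assms(1) rfun_inverse[OF assms(2-3)]] by (simp add: divide_inverse)

lemma rfun_diff:
  assumes "f \<in> rfun R H U" "g \<in> rfun R H U"
  shows "(\<lambda>x. f x - g x) \<in> rfun R H U"
  using rfun_add[OF assms(1) rfun_mult[OF rfun_const[of "-1"] assms(2)]] by simp

lemma rfun_prod:
  "(\<And>a. a \<in> A \<Longrightarrow> f a \<in> rfun R H U) \<Longrightarrow> (\<lambda>x. \<Prod>a\<in>A. f a x) \<in> rfun R H U"
  by (induction A rule: infinite_finite_induct) (auto intro: rfun_const rfun_mult)

lemma rfun_power: "f \<in> rfun R H U \<Longrightarrow> (\<lambda>x. f x ^ n) \<in> rfun R H U"
  by (induction n) (auto intro: rfun_const rfun_mult)

lemma rfun_poly_funs: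
  assumes "P \<in> poly_funs" "\<And>k. (\<lambda>x. \<xi> x k) \<in> rfun R H U"
  shows "(\<lambda>x. P (\<xi> x)) \<in> rfun R H U"
  using assms(1) by induction (auto intro: rfun_const rfun_add rfun_mult assms(2))

definition rp :: "'a \<Rightarrow> 'v" where
  "rp x = (SOME v. v \<in> R x)"

lemma rp_in: "x \<in> S0 \<Longrightarrow> rp x \<in> R x"
  unfolding rp_def using R_ne some_in_eq by blast

lemma rfun_quotient:
  assumes F: "F \<in> H e" and G: "G \<in> H e" and U: "U \<subseteq> S0" and nz: "\<And>x. x \<in> U \<Longrightarrow> G (rp x) \<noteq> 0"
  shows "(\<lambda>x. F (rp x) / G (rp x)) \<in> rfun R H U"
proof (rule rfunI)
  fix x assume x: "x \<in> U"
  have B: "G v \<noteq> 0" if "v \<in> R x" for v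
    using nonzero_iff[OF _ _ that G, of "rp x"] rp_in U x nz by blast
  have A: "F (rp y) / G (rp y) = F v / G v" if "y \<in> U" "v \<in> R y" for y v
    using quotient_eq[OF _ _ that(2) F G, of "rp y"] rp_in that U by blast
  show "\<exists>e Fa Ga. Fa \<in> H e \<and> Ga \<in> H e \<and> (\<forall>v\<in>R x. Ga v \<noteq> 0) \<and>
          (\<forall>y\<in>U. \<forall>v\<in>R y. Ga v \<noteq> 0 \<longrightarrow> F (rp y) / G (rp y) = Fa v / Ga v)"
    by (rule local_witness[OF F G]) (rule B, assumption, rule A, assumption+)
qed

lemma open_nonzero:
  assumes S: "S \<subseteq> S0" and U: "openin (zar (embedded R H S)) U" and f: "f \<in> rfun R H U"
  shows "openin (zar (embedded R H S)) {y \<in> U. f y \<noteq> 0}"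
proof (subst openin_subopen, intro ballI)
  fix x assume x: "x \<in> {y \<in> U. f y \<noteq> 0}"
  have US: "U \<subseteq> S"
    using open_subset[OF S U] .
  have xU: "x \<in> U" using x by blast
  obtain e F G where FG: "F \<in> H e" "G \<in> H e" "\<And>v. v \<in> R x \<Longrightarrow> G v \<noteq> 0"
      "\<And>y v. y \<in> U \<Longrightarrow> v \<in> R y \<Longrightarrow> G v \<noteq> 0 \<Longrightarrow> f y = F v / G v"
    by (rule rfunE[OF f xU]) blast
  let ?B = "basic_open R S (\<lambda>v. F v * G v)"
  have "F v * G v \<noteq> 0" if v: "v \<in> R x" for v
    using x FG(3)[OF v] FG(4)[OF xU v] by auto
  then have 1: "x \<in> ?B"
    using xU US by (intro basic_openI[OF S]) auto
  have 2: "?B \<inter> U \<subseteq> {y \<in> U. f y \<noteq> 0}"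
  proof
    fix y assume y: "y \<in> ?B \<inter> U"
    then obtain v where "v \<in> R y" "F v * G v \<noteq> 0"
      unfolding basic_open_def by blast
    then show "y \<in> {y \<in> U. f y \<noteq> 0}"
      using y FG(4)[of y v] by auto
  qed
  have 3: "openin (zar (embedded R H S)) (?B \<inter> U)"
    by (rule openin_Int[OF open_basic[OF H_mult[OF FG(1,2)]] U])
  show "\<exists>T. openin (zar (embedded R H S)) T \<and> x \<in> T \<and> T \<subseteq> {y \<in> U. f y \<noteq> 0}"
    by (rule exI[of _ "?B \<inter> U"], intro conjI IntI 1 2 3 xU)
qed

text \<open>Sheaf gluing: local solutions of a pointwise condition that determines its solutions
  fit together.\<close>

lemma rfun_glue:
  assumes S: "S \<subseteq> S0" and U: "U \<subseteq> S"
    and ex: "\<And>x. x \<in> U \<Longrightarrow> \<exists>N a. openin (zar (embedded R H S)) N \<and> x \<in> N \<and> N \<subseteq> U \<and>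
      a \<in> rfun R H N \<and> (\<forall>y\<in>N. Q y (a y))"
    and uniq: "\<And>N a b y. openin (zar (embedded R H S)) N \<Longrightarrow> N \<subseteq> U \<Longrightarrow>
      a \<in> rfun R H N \<Longrightarrow> b \<in> rfun R H N \<Longrightarrow> (\<And>z. z \<in> N \<Longrightarrow> Q z (a z) \<and> Q z (b z)) \<Longrightarrow>
      y \<in> N \<Longrightarrow> a y = b y"
  shows "\<exists>a\<in>rfun R H U. \<forall>y\<in>U. Q y (a y)"
proof -
  obtain N a where Na: "\<And>x. x \<in> U \<Longrightarrow> openin (zar (embedded R H S)) (N x) \<and> x \<in> N x \<and> N x \<subseteq> U \<and>
      a x \<in> rfun R H (N x) \<and> (\<forall>y\<in>N x. Q y (a x y))"
    using ex by metis
  have N: "openin (zar (embedded R H S)) (N x)" "x \<in> N x" "N x \<subseteq> U" "a x \<in> rfun R H (N x)"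
    "y \<in> N x \<Longrightarrow> Q y (a x y)" if "x \<in> U" for x y
    using Na[OF that] by simp_all
  have eq: "a x y = a y y" if x: "x \<in> U" and y: "y \<in> N x" for x y
  proof -
    have yU: "y \<in> U" using N(3)[OF x] y by blast
    have 1: "openin (zar (embedded R H S)) (N x \<inter> N y)"
      by (rule openin_Int[OF N(1)[OF x] N(1)[OF yU]])
    have 2: "N x \<inter> N y \<subseteq> U"
      using N(3)[OF x] by blast
    have 3: "a x \<in> rfun R H (N x \<inter> N y)"
      by (rule rfun_mono[OF N(4)[OF x]]) simp
    have 4: "a y \<in> rfun R H (N x \<inter> N y)"
      by (rule rfun_mono[OF N(4)[OF yU]]) simp
    show ?thesis
      by (rule uniq[OF 1 2 3 4]) (use N(2,5) x y yU in auto)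
  qed
  have "(\<lambda>y. a y y) \<in> rfun R H U"
  proof (rule rfun_local[OF S U])
    fix x assume x: "x \<in> U"
    have "(\<lambda>y. a y y) \<in> rfun R H (N x)"
      by (rule rfun_cong[OF N(4)[OF x]]) (rule eq[OF x])
    then show "\<exists>M. openin (zar (embedded R H S)) M \<and> x \<in> M \<and> (\<lambda>y. a y y) \<in> rfun R H M"
      using N(1,2)[OF x] by (intro exI[of _ "N x"] conjI)
  qed
  moreover have "\<forall>y\<in>U. Q y (a y y)"
    using N(2,5) by simp
  ultimately show ?thesis
    by (intro bexI[of _ "\<lambda>y. a y y"])
qed

end

text \<open>Forms on the target are polynomials in the coordinates.  Hence a map that lifts locally to
  coordinate vectors with regular entries pulls back forms to regular functions.\<close>

lemma morphism_by_local_lift: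
  fixes R :: "'a \<Rightarrow> 'v set" and R' :: "'b \<Rightarrow> ('k \<Rightarrow> complex) set"
  assumes X: "graded_forms R H pl S0" and Y: "graded_forms R' H' pl' T0"
    and S: "S \<subseteq> S0" and T: "T \<subseteq> T0"
    and H': "\<And>e. H' e \<subseteq> poly_funs"
    and f: "f ` S \<subseteq> T"
    and lift: "\<And>x. x \<in> S \<Longrightarrow> \<exists>U \<rho>. openin (zar (embedded R H S)) U \<and> x \<in> U \<and>
      (\<forall>y\<in>U. \<rho> y \<in> R' (f y)) \<and> (\<forall>k. (\<lambda>y. \<rho> y k) \<in> rfun R H U)"
  shows "morphism (embedded R H S) (embedded R' H' T) f"
proof -
  interpret X: graded_forms R H pl S0 by (fact X)
  interpret Y: graded_forms R' H' pl' T0 by (fact Y)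
  let ?X = "embedded R H S" and ?Y = "embedded R' H' T"
  have pX: "points ?X = S" and pY: "points ?Y = T"
    using S T by simp_all
  have basic: "openin (zar ?X) {x \<in> S. f x \<in> basic_open R' T F}" if F: "F \<in> H' e" for F e
  proof (subst openin_subopen, intro ballI)
    fix x assume x: "x \<in> {x \<in> S. f x \<in> basic_open R' T F}"
    obtain U \<rho> where U: "openin (zar ?X) U" "x \<in> U" "\<forall>y\<in>U. \<rho> y \<in> R' (f y)"
        "\<forall>k. (\<lambda>y. \<rho> y k) \<in> rfun R H U"
      using lift[of x] x by blast
    have US: "U \<subseteq> S"
      using X.open_subset[OF S U(1)] .
    have "(\<lambda>y. F (\<rho> y)) \<in> rfun R H U"
      using X.rfun_poly_funs[of F \<rho> U] F H' U(4) by blast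
    then have "openin (zar ?X) {y \<in> U. F (\<rho> y) \<noteq> 0}"
      by (rule X.open_nonzero[OF S U(1)])
    moreover have "F (\<rho> x) \<noteq> 0"
      using x U(2,3) Y.basic_openD[OF T _ F, of "f x" "\<rho> x"] by blast
    moreover have "{y \<in> U. F (\<rho> y) \<noteq> 0} \<subseteq> {x \<in> S. f x \<in> basic_open R' T F}"
      using U(3) US f by (auto simp: basic_open_def)
    ultimately show "\<exists>N. openin (zar ?X) N \<and> x \<in> N \<and> N \<subseteq> {x \<in> S. f x \<in> basic_open R' T F}"
      using U(2) by (intro exI[of _ "{y \<in> U. F (\<rho> y) \<noteq> 0}"] conjI) simp_all
  qed
  have cont: "continuous_map (zar ?X) (zar ?Y) f"
    unfolding zar_embedded[of R' H' T]
  proof (rule continuous_on_generated_topo)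
    fix U assume "U \<in> {basic_open R' T F |F. \<exists>e. F \<in> H' e}"
    then obtain F e where F: "F \<in> H' e" "U = basic_open R' T F" by blast
    have "f -` U \<inter> points ?X = {x \<in> S. f x \<in> basic_open R' T F}"
      using F pX by auto
    then show "openin (zar ?X) (f -` U \<inter> points ?X)"
      using basic[OF F(1)] by simp
  next
    show "f ` points ?X \<subseteq> \<Union>{basic_open R' T F |F. \<exists>e. F \<in> H' e}"
      using f pX pY unfolding zar_embedded[of R' H' T] topology_generated_by_topspace by simp
  qed
  moreover have "g \<circ> f \<in> reg ?X {x \<in> points ?X. f x \<in> V}"
    if V: "openin (zar ?Y) V" and g: "g \<in> reg ?Y V" for V g
    unfolding reg_embedded
  proof (rule X.rfun_local[OF S])
    show "{x \<in> points ?X. f x \<in> V} \<subseteq> S" using pX by auto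
    fix x assume x: "x \<in> {x \<in> points ?X. f x \<in> V}"
    then have xS: "x \<in> S" using pX by simp
    obtain U \<rho> where U: "openin (zar ?X) U" "x \<in> U" "\<forall>y\<in>U. \<rho> y \<in> R' (f y)"
        "\<forall>k. (\<lambda>y. \<rho> y k) \<in> rfun R H U"
      using lift[OF xS] by blast
    have fx: "f x \<in> V" using x by simp
    obtain e F G where FG: "F \<in> H' e" "G \<in> H' e" "\<And>v. v \<in> R' (f x) \<Longrightarrow> G v \<noteq> 0"
      "\<And>y v. y \<in> V \<Longrightarrow> v \<in> R' y \<Longrightarrow> G v \<noteq> 0 \<Longrightarrow> g y = F v / G v"
      by (rule rfunE[OF g[unfolded reg_embedded] fx]) blast
    have r: "(\<lambda>y. F (\<rho> y)) \<in> rfun R H U" "(\<lambda>y. G (\<rho> y)) \<in> rfun R H U"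
      using X.rfun_poly_funs[of F \<rho> U] X.rfun_poly_funs[of G \<rho> U] FG(1,2) H' U(4) by blast+
    let ?N = "{y \<in> U. G (\<rho> y) \<noteq> 0} \<inter> {x \<in> points ?X. f x \<in> V}"
    have N: "openin (zar ?X) ?N"
      using X.open_nonzero[OF S U(1) r(2)] openin_continuous_map_preimage[OF cont V] by (rule openin_Int)
    have "(\<lambda>y. F (\<rho> y) / G (\<rho> y)) \<in> rfun R H ?N"
    proof (rule X.rfun_divide)
      show "(\<lambda>y. F (\<rho> y)) \<in> rfun R H ?N" "(\<lambda>y. G (\<rho> y)) \<in> rfun R H ?N"
        by (rule rfun_mono[OF r(1)] rfun_mono[OF r(2)]; blast)+
    qed auto
    then have "g \<circ> f \<in> rfun R H ?N"
      using FG(4) U(3) by (elim rfun_cong) auto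
    moreover have "x \<in> ?N"
      using x U FG(3) by auto
    ultimately show "\<exists>N. openin (zar ?X) N \<and> x \<in> N \<and> g \<circ> f \<in> rfun R H N"
      using N by (intro exI[of _ ?N] conjI)
  qed
  ultimately show ?thesis
    unfolding morphism_def by (intro conjI allI impI ballI)
qed

section \<open>Polynomial functions\<close>

lemma poly_funs_uminus: "F \<in> poly_funs \<Longrightarrow> (\<lambda>v. - F v) \<in> poly_funs"
  using poly_funs.mult[OF poly_funs.const[of "-1"]] by simp

lemma poly_funs_diff: "F \<in> poly_funs \<Longrightarrow> G \<in> poly_funs \<Longrightarrow> (\<lambda>v. F v - G v) \<in> poly_funs"
  using poly_funs.add[OF _ poly_funs_uminus] by fastforce

lemma poly_funs_subst:
  assumes "F \<in> poly_funs" "\<And>k. (\<lambda>z. \<psi> z k) \<in> poly_funs"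
  shows "(\<lambda>z. F (\<psi> z)) \<in> poly_funs"
  using assms(1) by induction (auto intro: poly_funs.intros assms(2))

lemma poly_funs_path:
  assumes "F \<in> poly_funs" "\<And>k. \<exists>p. \<forall>t. \<Lambda> t k = poly p t"
  shows "\<exists>p. \<forall>t. F (\<Lambda> t) = poly p t"
  using assms(1)
proof induction
  case (const c)
  show ?case by (rule exI[of _ "[:c:]"]) simp
next
  case (coord k)
  show ?case by (rule assms(2))
next
  case (add F G)
  then obtain p q where "\<forall>t. F (\<Lambda> t) = poly p t" "\<forall>t. G (\<Lambda> t) = poly q t" by blast
  then show ?case by (intro exI[of _ "p + q"]) simp
next
  case (mult F G)
  then obtain p q where "\<forall>t. F (\<Lambda> t) = poly p t" "\<forall>t. G (\<Lambda> t) = poly q t" by blast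
  then show ?case by (intro exI[of _ "p * q"]) simp
qed

text \<open>The terms of a polynomial that involve the variable \<open>z k\<close> are divisible by it.\<close>

lemma poly_funs_divide:
  assumes "P \<in> poly_funs"
  shows "\<exists>Q\<in>poly_funs. \<forall>z. P z = P (z(k := 0)) + z k * Q z"
  using assms
proof induction
  case (const c)
  show ?case by (rule bexI[OF _ poly_funs.const[of 0]]) simp
next
  case (coord k')
  show ?case
  proof (cases "k' = k")
    case True
    then show ?thesis by (intro bexI[OF _ poly_funs.const[of 1]]) simp
  next
    case False
    then show ?thesis by (intro bexI[OF _ poly_funs.const[of 0]]) simp
  qed
next
  case (add F G)
  then obtain Q1 Q2 where Q: "Q1 \<in> poly_funs" "\<And>z. F z = F (z(k := 0)) + z k * Q1 z"
    "Q2 \<in> poly_funs" "\<And>z. G z = G (z(k := 0)) + z k * Q2 z" by blast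
  have "F z + G z = F (z(k := 0)) + G (z(k := 0)) + z k * (Q1 z + Q2 z)" for z
    by (subst Q(2), subst Q(4)) (simp add: algebra_simps)
  then show ?case
    by (intro bexI[OF _ poly_funs.add[OF Q(1,3)]]) blast
next
  case (mult F G)
  then obtain Q1 Q2 where Q: "Q1 \<in> poly_funs" "\<And>z. F z = F (z(k := 0)) + z k * Q1 z"
    "Q2 \<in> poly_funs" "\<And>z. G z = G (z(k := 0)) + z k * Q2 z" by blast
  have "F z * G z = F (z(k := 0)) * G (z(k := 0)) +
      z k * (Q1 z * G z + (F z * Q2 z - z k * (Q1 z * Q2 z)))" for z
  proof -
    have 1: "F (z(k := 0)) = F z - z k * Q1 z" "G (z(k := 0)) = G z - z k * Q2 z"
      using Q(2)[of z] Q(4)[of z] by (simp_all add: algebra_simps)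
    show ?thesis
      unfolding 1 by (simp add: algebra_simps)
  qed
  moreover have "(\<lambda>z. Q1 z * G z + (F z * Q2 z - z k * (Q1 z * Q2 z))) \<in> poly_funs"
    by (intro poly_funs.intros(3,4) poly_funs_diff Q mult.hyps poly_funs.coord)
  ultimately show ?case
    by (intro bexI[of _ "\<lambda>z. Q1 z * G z + (F z * Q2 z - z k * (Q1 z * Q2 z))"]) blast+
qed

lemma poly_eq_cofinite:
  fixes p q :: "complex poly"
  assumes "finite B" "\<And>t. t \<notin> B \<Longrightarrow> poly p t = poly q t"
  shows "p = q"
proof (rule ccontr)
  assume "p \<noteq> q"
  then have "finite {t. poly (p - q) t = 0}"
    by (intro poly_roots_finite) simp
  moreover have "UNIV \<subseteq> B \<union> {t. poly (p - q) t = 0}"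
    using assms(2) by auto
  ultimately have "finite (UNIV :: complex set)"
    using assms(1) by (meson finite_UnI finite_subset)
  then show False
    using infinite_UNIV_char_0 by blast
qed

text \<open>A function on the affine line that is everywhere locally a quotient of polynomials is a
  polynomial: in a representation \<open>F / G\<close> with \<open>G\<close> of minimal degree, a root of \<open>G\<close> would
  also be a root of \<open>F\<close>, since the function has a representation without pole there.
  The function may be undefined on a finite set \<open>B\<close>.\<close>

lemma locally_rational_imp_polynomial:
  fixes r :: "complex \<Rightarrow> complex"
  assumes B: "finite B"
    and loc: "\<And>t0. \<exists>F G B'. finite B' \<and> t0 \<notin> B' \<and> poly G t0 \<noteq> 0 \<and>
      (\<forall>t. t \<notin> B \<longrightarrow> t \<notin> B' \<longrightarrow> r t * poly G t = poly F t)"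
  shows "\<exists>P. \<forall>t. t \<notin> B \<longrightarrow> r t = poly P t"
proof -
  have "\<exists>P B'. finite B' \<and> (\<forall>t. t \<notin> B' \<longrightarrow> r t = poly P t)"
    if "finite B'" "G \<noteq> 0" "\<forall>t. t \<notin> B' \<longrightarrow> r t * poly G t = poly F t" for F G B'
    using that
  proof (induction "degree G" arbitrary: F G B' rule: less_induct)
    case less
    show ?case
    proof (cases "degree G = 0")
      case True
      then obtain c where c: "G = [:c:]" by (rule degree_eq_zeroE)
      have "r t = poly (smult (inverse c) F) t" if "t \<notin> B'" for t
        using less.prems(2,3) that c by (auto simp: field_simps)
      then show ?thesis using less.prems(1) by blast
    next
      case False
      then obtain t1 where t1: "poly G t1 = 0"
        using fundamental_theorem_of_algebra[of G] constant_degree[of G] by auto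
      obtain F' G' B'' where l: "finite B''" "t1 \<notin> B''" "poly G' t1 \<noteq> 0"
        "\<forall>t. t \<notin> B \<longrightarrow> t \<notin> B'' \<longrightarrow> r t * poly G' t = poly F' t"
        using loc[of t1] by blast
      have "F * G' = F' * G"
      proof (rule poly_eq_cofinite)
        show "finite (B \<union> B' \<union> B'')" using B l less.prems by blast
        fix t assume "t \<notin> B \<union> B' \<union> B''"
        then have "r t * poly G t = poly F t" "r t * poly G' t = poly F' t"
          using l(4) less.prems(3) by blast+
        from this[symmetric] show "poly (F * G') t = poly (F' * G) t" by simp
      qed
      \<comment> \<open>The root \<open>t1\<close> of the denominator is no pole, so that it can be cancelled.\<close>
      then have "poly F t1 * poly G' t1 = poly F' t1 * poly G t1"
        by (metis poly_mult)
      then have "poly F t1 = 0" using t1 l(3) by simp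
      then obtain F1 where F1: "F = [:-t1, 1:] * F1"
        using poly_eq_0_iff_dvd dvd_def by metis
      obtain G1 where G1: "G = [:-t1, 1:] * G1"
        using t1 poly_eq_0_iff_dvd dvd_def by metis
      have G1nz: "G1 \<noteq> 0" using G1 less.prems(2) by auto
      have "degree G = 1 + degree G1"
        unfolding G1 by (subst degree_mult_eq) (use G1nz in auto)
      then show ?thesis
      proof (intro less.hyps[of G1 "insert t1 B'" F1])
        show "\<forall>t. t \<notin> insert t1 B' \<longrightarrow> r t * poly G1 t = poly F1 t"
        proof (intro allI impI)
          fix t assume t: "t \<notin> insert t1 B'"
          then have "r t * poly G t = poly F t" using less.prems(3) by blast
          then have "(t - t1) * (r t * poly G1 t) = (t - t1) * poly F1 t"
            unfolding F1 G1 poly_mult by (simp add: algebra_simps)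
          then show "r t * poly G1 t = poly F1 t" using t by simp
        qed
      qed (use less.prems(1) G1nz in auto)
    qed
  qed
  moreover obtain F G B' where "finite B'" "poly G 0 \<noteq> 0"
      "\<forall>t. t \<notin> B \<longrightarrow> t \<notin> B' \<longrightarrow> r t * poly G t = poly F t"
    using loc[of 0] by blast
  ultimately obtain P B1 where P: "finite B1" "\<And>t. t \<notin> B1 \<Longrightarrow> r t = poly P t"
    using B by (metis Un_iff finite_Un poly_0)
  have "r t0 = poly P t0" if t0: "t0 \<notin> B" for t0
  proof -
    obtain F G B' where l: "finite B'" "t0 \<notin> B'" "poly G t0 \<noteq> 0"
        "\<forall>t. t \<notin> B \<longrightarrow> t \<notin> B' \<longrightarrow> r t * poly G t = poly F t"
      using loc[of t0] by blast
    have "F = P * G"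
    proof (rule poly_eq_cofinite)
      show "finite (B \<union> B' \<union> B1)" using B l P by blast
      fix t assume "t \<notin> B \<union> B' \<union> B1"
      then show "poly F t = poly (P * G) t"
        using l(4) P(2)[of t] by (metis Un_iff poly_mult)
    qed
    moreover have "r t0 * poly G t0 = poly F t0"
      using l t0 by blast
    ultimately show ?thesis using l(3) by simp
  qed
  then show ?thesis by blast
qed

text \<open>A section of the line bundle of degree \<open>m\<close> on the projective line is a polynomial in each of
  the two affine charts, and these are related by the factor \<open>t^m\<close>.  Writing \<open>t^N Q(1/t)\<close>, where \<open>N\<close>
  is the degree of \<open>Q\<close>, as the reflected polynomial turns the relation into one of polynomials.\<close>

lemma polynomial_at_infinity:
  fixes P Q :: "complex poly"
  assumes B: "finite B" and eq: "\<And>t. t \<notin> B \<Longrightarrow> t \<noteq> 0 \<Longrightarrow> poly P t = c * t ^ m * poly Q (inverse t)"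
  shows "degree P \<le> m" "coeff P m = c * coeff Q 0"
proof -
  let ?N = "degree Q"
  have *: "monom 1 ?N * P = smult c (monom 1 m * reflect_poly Q)"
  proof (rule poly_eq_cofinite)
    show "finite (insert 0 B)" using B by blast
    fix t assume t: "t \<notin> insert 0 B"
    then have "poly (reflect_poly Q) t = t ^ ?N * poly Q (inverse t)"
      by (intro poly_reflect_poly_nz) auto
    then show "poly (monom 1 ?N * P) t = poly (smult c (monom 1 m * reflect_poly Q)) t"
      using eq[of t] t by (simp add: poly_monom algebra_simps)
  qed
  have c: "coeff P n = c * (if m \<le> ?N + n then coeff (reflect_poly Q) (?N + n - m) else 0)" for n
  proof -
    have "coeff P n = coeff (monom 1 ?N * P) (?N + n)"
      by (simp add: coeff_monom_mult)
    also have "\<dots> = coeff (smult c (monom 1 m * reflect_poly Q)) (?N + n)"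
      by (simp only: *)
    finally show ?thesis
      by (simp add: coeff_monom_mult)
  qed
  show "degree P \<le> m"
    by (rule degree_le) (auto simp: c coeff_reflect_poly)
  show "coeff P m = c * coeff Q 0"
    by (simp add: c coeff_reflect_poly)
qed

section \<open>Projective spaces as spaces of lifts\<close>

lemma cspan1_self: "v \<in> cspan1 v"
  unfolding cspan1_def by (rule CollectI, rule exI[of _ 1]) simp

lemma cspan1_iff: "w \<in> cspan1 v \<longleftrightarrow> (\<exists>c. w = (\<lambda>i. c * v i))"
  by (auto simp: cspan1_def)

lemma cspan1_scale: "c \<noteq> 0 \<Longrightarrow> cspan1 (\<lambda>i. c * v i) = cspan1 v"
proof (intro set_eqI iffI)
  fix w assume c: "c \<noteq> 0" and "w \<in> cspan1 v"
  then obtain b where "w = (\<lambda>i. b * v i)" by (auto simp: cspan1_iff)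
  then have "w = (\<lambda>i. (b / c) * (c * v i))" using c by simp
  then show "w \<in> cspan1 (\<lambda>i. c * v i)" unfolding cspan1_iff by blast
next
  fix w assume "w \<in> cspan1 (\<lambda>i. c * v i)"
  then obtain b where "w = (\<lambda>i. (b * c) * v i)" by (auto simp: cspan1_iff mult.assoc)
  then show "w \<in> cspan1 v" unfolding cspan1_iff by blast
qed

lemma proj_iff: "L \<in> proj W \<longleftrightarrow> (\<exists>v\<in>W. v \<noteq> (\<lambda>_. 0) \<and> L = cspan1 v)"
  unfolding proj_def by blast

lemma proj_mono: "W \<subseteq> W' \<Longrightarrow> proj W \<subseteq> proj W'"
  unfolding proj_def by blast

lemma proj_eq_cspan1:
  assumes "L \<in> proj W" "v \<in> L" "v \<noteq> (\<lambda>_. 0)"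
  shows "L = cspan1 v"
proof -
  obtain w c where w: "L = cspan1 w" "v = (\<lambda>i. c * w i)"
    using assms by (auto simp: proj_iff cspan1_iff)
  then have "c \<noteq> 0" using assms(3) by auto
  then show ?thesis using w cspan1_scale[of c w] by simp
qed

lemma proj_nonzero_elem: "L \<in> proj W \<Longrightarrow> \<exists>v. v \<in> L \<and> v \<noteq> (\<lambda>_. 0)"
  using cspan1_self by (auto simp: proj_iff)

definition mlift :: "'j set \<Rightarrow> ('j \<Rightarrow> 'i ppt) \<Rightarrow> ('j \<times> 'i \<Rightarrow> complex) set" where
  "mlift J x = {v. \<forall>j\<in>J. (\<lambda>i. v (j, i)) \<in> x j - {\<lambda>_. 0}}"

lemma multiproj_space_embedded: "multiproj_space J = embedded (mlift J) (multiforms J)"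
  unfolding multiproj_space_def mlift_def ..

lemma graded_forms_proj: "graded_forms (\<lambda>L. L - {\<lambda>_. 0}) forms (+) (proj (UNIV :: ('i \<Rightarrow> complex) set))"
proof
  fix L :: "'i ppt" assume L: "L \<in> proj UNIV"
  show "L - {\<lambda>_. 0} \<noteq> {}" using proj_nonzero_elem[OF L] by blast
  fix v v' e assume v: "v \<in> L - {\<lambda>_. 0}" and v': "v' \<in> L - {\<lambda>_. 0}"
  have "L = cspan1 v" using proj_eq_cspan1[OF L] v by blast
  then obtain c where c: "v' = (\<lambda>i. c * v i)" using v' by (auto simp: cspan1_iff)
  then have "c \<noteq> 0" using v' by auto
  then show "\<exists>c. c \<noteq> 0 \<and> (\<forall>F\<in>forms e. F v' = c * F v)"
    by (intro exI[of _ "c ^ e"]) (auto simp: forms_def c)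
next
  show "\<exists>e. \<forall>c. (\<lambda>_. c) \<in> (forms e :: (('i \<Rightarrow> complex) \<Rightarrow> complex) set)"
    by (intro exI[of _ 0]) (auto simp: forms_def poly_funs.const)
qed (auto simp: forms_def power_add distrib_left algebra_simps intro: poly_funs.add poly_funs.mult)

lemma graded_forms_multi:
  "graded_forms (mlift J) (multiforms J) (\<lambda>e e' j. e j + e' j) {x :: 'j \<Rightarrow> 'i ppt. \<forall>j\<in>J. x j \<in> proj UNIV}"
proof
  fix x :: "'j \<Rightarrow> 'i ppt" assume x: "x \<in> {x. \<forall>j\<in>J. x j \<in> proj UNIV}"
  then have "\<exists>w. \<forall>j\<in>J. w j \<in> x j \<and> w j \<noteq> (\<lambda>_. 0)"
    by (intro bchoice ballI proj_nonzero_elem) auto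
  then obtain w where w: "\<forall>j\<in>J. w j \<in> x j \<and> w j \<noteq> (\<lambda>_. 0)" by blast
  then have "(\<lambda>(j, i). w j i) \<in> mlift J x"
    unfolding mlift_def by simp
  then show "mlift J x \<noteq> {}" by blast
  fix v v' e assume v: "v \<in> mlift J x" and v': "v' \<in> mlift J x"
  have "\<exists>a. a \<noteq> 0 \<and> (\<lambda>i. v' (j, i)) = (\<lambda>i. a * v (j, i))" if j: "j \<in> J" for j
  proof -
    have "x j = cspan1 (\<lambda>i. v (j, i))"
      using x v j by (intro proj_eq_cspan1[of _ UNIV]) (auto simp: mlift_def)
    moreover have "(\<lambda>i. v' (j, i)) \<in> x j"
      using v' j by (auto simp: mlift_def)
    ultimately obtain a where a: "(\<lambda>i. v' (j, i)) = (\<lambda>i. a * v (j, i))"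
      unfolding cspan1_def by auto
    then have "a \<noteq> 0" using v' j by (auto simp: mlift_def)
    with a show ?thesis by blast
  qed
  then have "\<exists>c. \<forall>j\<in>J. c j \<noteq> 0 \<and> (\<lambda>i. v' (j, i)) = (\<lambda>i. c j * v (j, i))"
    by (intro bchoice ballI)
  then obtain c where c: "\<forall>j\<in>J. c j \<noteq> 0 \<and> (\<lambda>i. v' (j, i)) = (\<lambda>i. c j * v (j, i))" by blast
  have "F v' = (\<Prod>j\<in>J. c j ^ e j) * F v" if F: "F \<in> multiforms J e" for F
  proof -
    have h: "\<And>b v. F (\<lambda>(j, i). b j * v (j, i)) = (\<Prod>j\<in>J. b j ^ e j) * F v"
      using F unfolding multiforms_def by blast
    have "F v' = F (\<lambda>(j, i). (if j \<in> J then 1 else 0) * v' (j, i))"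
      by (simp add: h[of "\<lambda>j. if j \<in> J then 1 else 0" v'])
    also have "(\<lambda>(j, i). (if j \<in> J then 1 else 0) * v' (j, i)) =
        (\<lambda>(j, i). (if j \<in> J then c j else 0) * v (j, i))"
      using c by (auto simp: fun_eq_iff)
    also have "F \<dots> = (\<Prod>j\<in>J. c j ^ e j) * F v"
      by (simp add: h[of "\<lambda>j. if j \<in> J then c j else 0" v])
    finally show ?thesis .
  qed
  then show "\<exists>c. c \<noteq> 0 \<and> (\<forall>F\<in>multiforms J e. F v' = c * F v)"
    using c by (cases "finite J") (auto intro!: exI[of _ "\<Prod>j\<in>J. c j ^ e j"])
next
  show "\<exists>e. \<forall>c. (\<lambda>_. c) \<in> (multiforms J e :: (('j \<times> 'i \<Rightarrow> complex) \<Rightarrow> complex) set)"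
    by (intro exI[of _ "\<lambda>_. 0"]) (auto simp: multiforms_def poly_funs.const)
next
  fix F G :: "('j \<times> 'i \<Rightarrow> complex) \<Rightarrow> complex" and e e'
  assume "F \<in> multiforms J e" "G \<in> multiforms J e'"
  then show "(\<lambda>v. F v * G v) \<in> multiforms J (\<lambda>j. e j + e' j)"
    by (simp add: multiforms_def power_add prod.distrib poly_funs.mult mult_ac)
next
  fix F G :: "('j \<times> 'i \<Rightarrow> complex) \<Rightarrow> complex" and e
  assume "F \<in> multiforms J e" "G \<in> multiforms J e"
  then show "(\<lambda>v. F v + G v) \<in> multiforms J e"
    by (simp add: multiforms_def distrib_left poly_funs.add)
qed

section \<open>Linear algebra in dimension three\<close>

lemma vec3_eq_iff: "v = w \<longleftrightarrow> v 1 = w 1 \<and> v 2 = w 2 \<and> v 3 = (w 3 :: complex)" for v w :: "3 \<Rightarrow> complex"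
  by (simp add: fun_eq_iff forall_3)

lemma lin_3: "lin a v = a 1 * v 1 + a 2 * v 2 + a 3 * v 3"
  by (simp add: lin_def sum_3)

lemma lin_add_right: "lin a (\<lambda>i. v i + w i) = lin a v + lin a w"
  by (simp add: lin_3 algebra_simps)

lemma lin_diff_right: "lin a (\<lambda>i. v i - w i) = lin a v - lin a w"
  by (simp add: lin_3 algebra_simps)

lemma lin_scale_right: "lin a (\<lambda>i. c * v i) = c * lin a v"
  by (simp add: lin_3 algebra_simps)

lemma lin_add_left: "lin (\<lambda>i. a i + b i) v = lin a v + lin b v"
  by (simp add: lin_3 algebra_simps)

lemma lin_scale_left: "lin (\<lambda>i. c * a i) v = c * lin a v"
  by (simp add: lin_3 algebra_simps)

lemma lin_zero [simp]: "lin a (\<lambda>_. 0) = 0" "lin (\<lambda>_. 0) v = 0"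
  by (simp_all add: lin_3)

lemmas lin_simps = lin_add_right lin_diff_right lin_scale_right lin_add_left lin_scale_left

definition crossp :: "(3 \<Rightarrow> complex) \<Rightarrow> (3 \<Rightarrow> complex) \<Rightarrow> 3 \<Rightarrow> complex" where
  "crossp a b i = a (i + 1) * b (i + 2) - a (i + 2) * b (i + 1)"

lemma crossp_components [simp]:
  "crossp a b 1 = a 2 * b 3 - a 3 * b 2"
  "crossp a b 2 = a 3 * b 1 - a 1 * b 3"
  "crossp a b 3 = a 1 * b 2 - a 2 * b 1"
proof -
  have "(1 + 1 :: 3) = 2" "(1 + 2 :: 3) = 3" "(2 + 1 :: 3) = 3" "(2 + 2 :: 3) = 1"
    "(3 + 1 :: 3) = 1" "(3 + 2 :: 3) = 2"
    by simp_all
  then show "crossp a b 1 = a 2 * b 3 - a 3 * b 2" "crossp a b 2 = a 3 * b 1 - a 1 * b 3"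
      "crossp a b 3 = a 1 * b 2 - a 2 * b 1"
    unfolding crossp_def by metis+
qed

lemma lin_crossp [simp]: "lin (crossp a b) a = 0" "lin (crossp a b) b = 0"
  by (simp_all add: lin_3 algebra_simps del: zero_neq_numeral)

lemma crossp_scale_right: "crossp a (\<lambda>i. c * b i) = (\<lambda>i. c * crossp a b i)"
  by (simp add: crossp_def fun_eq_iff algebra_simps)

lemma crossp_self: "crossp a (\<lambda>i. c * a i) = (\<lambda>_. 0)"
  by (simp add: crossp_def fun_eq_iff)

lemma crossp_eq_0_imp:
  assumes "a \<noteq> (\<lambda>_. 0)" "crossp a b = (\<lambda>_. 0)"
  shows "\<exists>c. b = (\<lambda>i. c * a i)"
proof -
  have c: "a 2 * b 3 = a 3 * b 2" "a 3 * b 1 = a 1 * b 3" "a 1 * b 2 = a 2 * b 1"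
    using fun_cong[OF assms(2), of 1] fun_cong[OF assms(2), of 2] fun_cong[OF assms(2), of 3] by simp_all
  have "a 1 \<noteq> 0 \<or> a 2 \<noteq> 0 \<or> a 3 \<noteq> 0"
    using assms(1) by (auto simp: vec3_eq_iff)
  then show ?thesis
  proof (elim disjE)
    assume "a 1 \<noteq> 0"
    then show ?thesis using c
      by (intro exI[of _ "b 1 / a 1"]) (auto simp: vec3_eq_iff field_simps)
  next
    assume "a 2 \<noteq> 0"
    then show ?thesis using c
      by (intro exI[of _ "b 2 / a 2"]) (auto simp: vec3_eq_iff field_simps)
  next
    assume "a 3 \<noteq> 0"
    then show ?thesis using c
      by (intro exI[of _ "b 3 / a 3"]) (auto simp: vec3_eq_iff field_simps)
  qed
qed

text \<open>The cross product of \<open>crossp a b\<close> with \<open>l\<close> is \<open>l(a) b - l(b) a\<close>.\<close>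

lemma annihilator_eq_crossp:
  assumes "crossp a b \<noteq> (\<lambda>_. 0)" "lin l a = 0" "lin l b = 0"
  shows "\<exists>c. l = (\<lambda>i. c * crossp a b i)"
proof -
  have "crossp (crossp a b) l = (\<lambda>i. b i * lin l a - a i * lin l b)"
    unfolding vec3_eq_iff lin_3 crossp_components by (intro conjI) (simp_all only: algebra_simps)
  then have "crossp (crossp a b) l = (\<lambda>_. 0)"
    using assms by simp
  then show ?thesis using crossp_eq_0_imp[OF assms(1)] by blast
qed

text \<open>The bases \<open>(e, f, g)\<close> of the dual space and \<open>(e', f', p)\<close> are dual to each other.  Usually \<open>p\<close> is
  a point to be blown up; then the lines through it are the combinations of \<open>e\<close> and \<open>f\<close>.\<close>

definition dual_basis ::
  "(3 \<Rightarrow> complex) \<Rightarrow> (3 \<Rightarrow> complex) \<Rightarrow> (3 \<Rightarrow> complex) \<Rightarrow>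
   (3 \<Rightarrow> complex) \<Rightarrow> (3 \<Rightarrow> complex) \<Rightarrow> (3 \<Rightarrow> complex) \<Rightarrow> bool" where
  "dual_basis e f g e' f' p \<longleftrightarrow>
     lin e e' = 1 \<and> lin e f' = 0 \<and> lin e p = 0 \<and>
     lin f e' = 0 \<and> lin f f' = 1 \<and> lin f p = 0 \<and>
     lin g e' = 0 \<and> lin g f' = 0 \<and> lin g p = 1"

lemma dual_basis_inverse:
  assumes "dual_basis e f g e' f' p"
  shows "e' i * e j + f' i * f j + p i * g j = (if i = j then 1 else 0)"
proof -
  define A :: "complex^3^3" where "A = (\<chi> k j. (if k = 1 then e j else if k = 2 then f j else g j))"
  define B :: "complex^3^3" where "B = (\<chi> i k. (if k = 1 then e' i else if k = 2 then f' i else p i))"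
  have "A ** B = mat 1"
    using assms
    by (simp add: vec_eq_iff matrix_matrix_mult_def mat_def forall_3 A_def B_def dual_basis_def lin_def)
  then have "B ** A = mat 1"
    using matrix_left_right_inverse[of A B] by simp
  then have "(B ** A) $ i $ j = mat 1 $ i $ j" by simp
  then show ?thesis
    by (simp add: matrix_matrix_mult_def mat_def A_def B_def sum_3)
qed

lemma dual_basis_vec:
  assumes "dual_basis e f g e' f' p"
  shows "v = (\<lambda>i. lin e v * e' i + lin f v * f' i + lin g v * p i)"
proof
  fix i
  have "lin e v * e' i + lin f v * f' i + lin g v * p i =
      (\<Sum>j\<in>UNIV. (e' i * e j + f' i * f j + p i * g j) * v j)"
    by (simp add: lin_def sum_distrib_left sum_distrib_right sum.distrib algebra_simps)
  also have "\<dots> = v i"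
    unfolding dual_basis_inverse[OF assms] by (simp add: mult_delta_left mult_delta_right)
  finally show "v i = lin e v * e' i + lin f v * f' i + lin g v * p i" by simp
qed

lemma dual_basis_form:
  assumes "dual_basis e f g e' f' p"
  shows "l = (\<lambda>j. lin l e' * e j + lin l f' * f j + lin l p * g j)"
proof
  fix j
  have "lin l e' * e j + lin l f' * f j + lin l p * g j =
      (\<Sum>i\<in>UNIV. l i * (e' i * e j + f' i * f j + p i * g j))"
    by (simp add: lin_def sum_distrib_left sum_distrib_right sum.distrib algebra_simps)
  also have "\<dots> = l j"
    unfolding dual_basis_inverse[OF assms] by (simp add: mult_delta_left mult_delta_right)
  finally show "l j = lin l e' * e j + lin l f' * f j + lin l p * g j" by simp
qed

lemma lin_cnj_nonzero: "a \<noteq> (\<lambda>_. 0) \<Longrightarrow> lin a (\<lambda>i. cnj (a i)) \<noteq> 0"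
proof
  assume a: "a \<noteq> (\<lambda>_. 0)" and "lin a (\<lambda>i. cnj (a i)) = 0"
  then have "(\<Sum>i\<in>UNIV. complex_of_real ((cmod (a i))\<^sup>2)) = 0"
    by (simp only: lin_def complex_norm_square)
  then have "(\<Sum>i\<in>UNIV. (cmod (a i))\<^sup>2) = 0"
    by (simp only: of_real_sum[symmetric] of_real_eq_0_iff)
  then have "\<forall>i. a i = 0"
    by (simp add: sum_nonneg_eq_0_iff)
  then show False using a by auto
qed

text \<open>For the Hermitian inner product, \<open>p\<close> is orthogonal to the conjugate of \<open>e\<close>.  The third vector
  of an orthogonal basis is the conjugate of their cross product; a dual basis of an orthogonal
  one consists of its conjugates, up to scalars.\<close>

lemma dual_basis_exists:
  assumes e: "e \<noteq> (\<lambda>_. 0)" and p: "p \<noteq> (\<lambda>_. 0)" and ep: "lin e p = 0"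
  shows "\<exists>f g e' f'. dual_basis e f g e' f' p"
proof -
  define eb pb where "eb = (\<lambda>i. cnj (e i))" and "pb = (\<lambda>i. cnj (p i))"
  define f where "f = crossp p eb"
  define fb where "fb = (\<lambda>i. cnj (f i))"
  have ee: "lin e eb \<noteq> 0" unfolding eb_def by (rule lin_cnj_nonzero[OF e])
  have pp: "lin pb p \<noteq> 0" unfolding pb_def using lin_cnj_nonzero[OF p] by (simp add: lin_def mult.commute)
  have "f \<noteq> (\<lambda>_. 0)"
  proof
    assume "f = (\<lambda>_. 0)"
    then obtain c where "eb = (\<lambda>i. c * p i)" using crossp_eq_0_imp[OF p, of eb] f_def by auto
    then show False using ee ep by (simp add: lin_scale_right)
  qed
  then have ff: "lin f fb \<noteq> 0" unfolding fb_def by (rule lin_cnj_nonzero)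
  have cnj_lin: "lin a (\<lambda>i. cnj (b i)) = cnj (lin b (\<lambda>i. cnj (a i)))" for a b
    by (simp add: lin_def mult.commute)
  have fe: "lin f eb = 0" "lin f p = 0" unfolding f_def by simp_all
  have ef: "lin e fb = 0"
    unfolding fb_def cnj_lin[of e f] using fe(1) by (simp add: eb_def)
  have pe: "lin pb eb = 0"
    unfolding eb_def cnj_lin[of pb e] using ep by (simp add: pb_def)
  have pf: "lin pb fb = 0"
    unfolding fb_def cnj_lin[of pb f] using fe(2) by (simp add: pb_def)
  have "dual_basis e f (\<lambda>i. inverse (lin pb p) * pb i) (\<lambda>i. inverse (lin e eb) * eb i)
      (\<lambda>i. inverse (lin f fb) * fb i) p"
    unfolding dual_basis_def lin_simps using ee pp ff fe ef pe pf ep by simp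
  then show ?thesis by blast
qed

section \<open>Charts of the blowup\<close>

lemma lin_commute: "lin a v = lin v a"
  by (simp add: lin_def mult.commute)

lemma P2_iff: "L \<in> P2 \<longleftrightarrow> (\<exists>v. v \<noteq> (\<lambda>_. 0) \<and> L = cspan1 v)"
  by (auto simp: P2_def proj_iff)

lemma P2_eq_cspan1: "L \<in> P2 \<Longrightarrow> v \<in> L \<Longrightarrow> v \<noteq> (\<lambda>_. 0) \<Longrightarrow> L = cspan1 v"
  unfolding P2_def by (rule proj_eq_cspan1)

definition rep :: "3 ppt \<Rightarrow> 3 \<Rightarrow> complex" where
  "rep L = (SOME v. v \<in> L \<and> v \<noteq> (\<lambda>_. 0))"

lemma rep: assumes "L \<in> P2" shows "rep L \<in> L" "rep L \<noteq> (\<lambda>_. 0)" "cspan1 (rep L) = L"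
proof -
  have "\<exists>v. v \<in> L \<and> v \<noteq> (\<lambda>_. 0)"
    using assms proj_nonzero_elem[of L] unfolding P2_def by blast
  from someI_ex[OF this] show "rep L \<in> L" "rep L \<noteq> (\<lambda>_. 0)"
    unfolding rep_def by blast+
  then show "cspan1 (rep L) = L"
    using P2_eq_cspan1[OF assms] by blast
qed

abbreviation cv :: "(3 ppt option \<times> 3 \<Rightarrow> complex) \<Rightarrow> 3 ppt option \<Rightarrow> 3 \<Rightarrow> complex" where
  "cv v j \<equiv> (\<lambda>i. v (j, i))"

locale blowup_plane =
  fixes C :: "3 ppt set"
  assumes C_finite: "finite C" and C_P2: "C \<subseteq> P2"
begin

abbreviation J :: "3 ppt option set" where "J \<equiv> insert None (Some ` C)"
abbreviation X :: "bpt set" where "X \<equiv> blowup_pts C"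
abbreviation op :: "bpt set \<Rightarrow> bool" where "op U \<equiv> openin (zar (blowup C)) U"
abbreviation rg :: "bpt set \<Rightarrow> (bpt \<Rightarrow> complex) set" where "rg \<equiv> rfun (mlift J) (multiforms J)"
abbreviation ambient :: "bpt set" where "ambient \<equiv> {x. \<forall>j\<in>J. x j \<in> proj UNIV}"

lemma J_finite: "finite J" using C_finite by simp

sublocale G: graded_forms "mlift J" "multiforms J" "\<lambda>e e' j. e j + e' j" ambient
  by (rule graded_forms_multi)

lemma blowup_sub_embedded: "blowup_sub C S = embedded (mlift J) (multiforms J) S"
  unfolding blowup_sub_def multiproj_space_embedded ..

lemma blowup_embedded: "blowup C = embedded (mlift J) (multiforms J) X"
  unfolding blowup_def blowup_sub_embedded ..

lemma X_ambient: "X \<subseteq> ambient"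
  by (auto simp: blowup_pts_def P2_def PiE_def Pi_def)

lemma points_blowup [simp]: "points (blowup C) = X"
  unfolding blowup_embedded by (rule G.points_embedded[OF X_ambient])

lemma reg_blowup [simp]: "reg (blowup C) = rg"
  unfolding blowup_embedded reg_embedded ..

lemma op_subset: "op U \<Longrightarrow> U \<subseteq> X"
  unfolding blowup_embedded by (rule G.open_subset[OF X_ambient])

lemma op_X: "op X"
  using openin_topspace[of "zar (blowup C)"] by simp

lemma op_nonzero: "op U \<Longrightarrow> f \<in> rg U \<Longrightarrow> op {y \<in> U. f y \<noteq> 0}"
  unfolding blowup_embedded by (rule G.open_nonzero[OF X_ambient])

lemmas rg_glue = G.rfun_glue[OF X_ambient, folded blowup_embedded]

lemma X_P2: "y \<in> X \<Longrightarrow> j \<in> J \<Longrightarrow> y j \<in> P2"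
  by (auto simp: blowup_pts_def PiE_def Pi_def)

lemma bproj_P2: "y \<in> X \<Longrightarrow> bproj y \<in> P2"
  unfolding bproj_def by (rule X_P2) auto

lemma exceptional_iff: "y \<in> exceptional C p \<longleftrightarrow> y \<in> X \<and> bproj y = p"
  by (simp add: exceptional_def)

lemma lift_exists: "y \<in> X \<Longrightarrow> \<exists>v. v \<in> mlift J y"
  using G.R_ne X_ambient by blast

lemma lift_comp: "v \<in> mlift J y \<Longrightarrow> j \<in> J \<Longrightarrow> cv v j \<in> y j \<and> cv v j \<noteq> (\<lambda>_. 0)"
  unfolding mlift_def by blast

lemma lift_cspan1: "y \<in> X \<Longrightarrow> v \<in> mlift J y \<Longrightarrow> j \<in> J \<Longrightarrow> y j = cspan1 (cv v j)"
  using P2_eq_cspan1[OF X_P2] lift_comp by blast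

lemma lift_bproj: "y \<in> X \<Longrightarrow> v \<in> mlift J y \<Longrightarrow> bproj y = cspan1 (cv v None)"
  unfolding bproj_def by (rule lift_cspan1) auto

text \<open>The equations of the blowup for a tuple of homogeneous coordinate vectors.  A tuple without
  zero vectors that satisfies them represents the point \<open>pt v\<close>.\<close>

definition incident :: "(3 ppt option \<times> 3 \<Rightarrow> complex) \<Rightarrow> bool" where
  "incident v \<longleftrightarrow> (\<forall>p\<in>C. lin (cv v (Some p)) (rep p) = 0 \<and> lin (cv v (Some p)) (cv v None) = 0)"

definition pt :: "(3 ppt option \<times> 3 \<Rightarrow> complex) \<Rightarrow> bpt" where
  "pt v = restrict (\<lambda>j. cspan1 (cv v j)) J"

lemma pt_blowup:
  assumes nz: "\<And>j. j \<in> J \<Longrightarrow> cv v j \<noteq> (\<lambda>_. 0)" and inc: "incident v"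
  shows "pt v \<in> X" "v \<in> mlift J (pt v)"
proof -
  have "cspan1 (cv v j) \<in> P2" if "j \<in> J" for j
    using nz[OF that] unfolding P2_iff by blast
  then have "pt v \<in> PiE J (\<lambda>_. P2)"
    unfolding pt_def by auto
  moreover have "lin a w = 0" if p: "p \<in> C" and a: "a \<in> pt v (Some p)" and w: "w \<in> p \<union> pt v None" for p a w
  proof -
    obtain c where c: "a = (\<lambda>i. c * v (Some p, i))"
      using a p by (auto simp: pt_def cspan1_def)
    have "p = cspan1 (rep p)"
      using rep(3) p C_P2 by blast
    then have "(\<exists>b. w = (\<lambda>i. b * rep p i)) \<or> (\<exists>b. w = (\<lambda>i. b * v (None, i)))"
      using w unfolding pt_def by (auto simp: cspan1_def)
    then show ?thesis
      using inc p unfolding c incident_def by (auto simp: lin_simps)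
  qed
  ultimately show "pt v \<in> X"
    unfolding blowup_pts_def by blast
  show "v \<in> mlift J (pt v)"
    using nz by (auto simp: mlift_def pt_def cspan1_self)
qed

lemma pt_unique: "y \<in> X \<Longrightarrow> v \<in> mlift J y \<Longrightarrow> y = pt v"
proof
  fix j assume y: "y \<in> X" "v \<in> mlift J y"
  then have "y \<in> PiE J (\<lambda>_. P2)" by (simp add: blowup_pts_def)
  then show "y j = pt v j"
    using lift_cspan1[OF y, of j] by (cases "j \<in> J") (auto simp: pt_def)
qed

lemma lift_incident:
  assumes "y \<in> X" "v \<in> mlift J y" shows "incident v"
  unfolding incident_def
proof
  fix p assume p: "p \<in> C"
  then have "\<forall>a\<in>y (Some p). \<forall>w\<in>p \<union> y None. lin a w = 0"
    using assms(1) by (simp add: blowup_pts_def)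
  moreover have "cv v (Some p) \<in> y (Some p)" "cv v None \<in> y None" "rep p \<in> p"
    using lift_comp[OF assms(2)] p rep C_P2 by blast+
  ultimately show "lin (cv v (Some p)) (rep p) = 0 \<and> lin (cv v (Some p)) (cv v None) = 0"
    by blast
qed

lemma coord_form:
  fixes i :: 'i
  shows "j \<in> J \<Longrightarrow> (\<lambda>v. v (j, i)) \<in> multiforms J (\<lambda>j'. if j' = j then 1 else 0)"
  unfolding multiforms_def
proof (intro CollectI conjI allI)
  fix c :: "3 ppt option \<Rightarrow> complex" and v :: "3 ppt option \<times> 'i \<Rightarrow> complex" assume j: "j \<in> J"
  have "(\<Prod>j'\<in>J. c j' ^ (if j' = j then 1 else 0)) = (\<Prod>j'\<in>J. if j' = j then c j' else 1)"
    by (rule prod.cong) auto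
  also have "\<dots> = c j"
    using prod.delta[OF J_finite, of j c] j by simp
  finally show "(\<lambda>(j, i). c j * v (j, i)) (j, i) = (\<Prod>j'\<in>J. c j' ^ (if j' = j then 1 else 0)) * v (j, i)"
    by simp
qed (rule poly_funs.coord)

lemma form_scale: "F \<in> multiforms J e \<Longrightarrow> (\<lambda>v. c * F v) \<in> multiforms J e"
  by (auto simp: multiforms_def intro: poly_funs.mult poly_funs.const)

lemma lin_form: "j \<in> J \<Longrightarrow> (\<lambda>v. lin a (cv v j)) \<in> multiforms J (\<lambda>j'. if j' = j then 1 else 0)"
  unfolding lin_3 by (intro G.H_add form_scale coord_form)

lemma lin_ratio_regular:
  assumes "j \<in> J" "U \<subseteq> X" "\<And>y. y \<in> U \<Longrightarrow> lin b (cv (G.rp y) j) \<noteq> 0"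
  shows "(\<lambda>y. lin a (cv (G.rp y) j) / lin b (cv (G.rp y) j)) \<in> rg U"
  using assms X_ambient by (intro G.rfun_quotient[OF lin_form lin_form]) auto

lemma lin_nonzero_op:
  assumes "j \<in> J" shows "op {y \<in> X. lin a (cv (G.rp y) j) \<noteq> 0}"
proof -
  have "{y \<in> X. lin a (cv (G.rp y) j) \<noteq> 0} = basic_open (mlift J) X (\<lambda>v. lin a (cv v j))"
  proof (intro set_eqI iffI)
    fix y assume y: "y \<in> {y \<in> X. lin a (cv (G.rp y) j) \<noteq> 0}"
    then have "G.rp y \<in> mlift J y" using G.rp_in X_ambient by blast
    then show "y \<in> basic_open (mlift J) X (\<lambda>v. lin a (cv v j))"
      using y unfolding basic_open_def by blast
  next
    fix y assume y: "y \<in> basic_open (mlift J) X (\<lambda>v. lin a (cv v j))"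
    then have "y \<in> X" by (simp add: basic_open_def)
    moreover have "G.rp y \<in> mlift J y" using G.rp_in X_ambient \<open>y \<in> X\<close> by blast
    ultimately show "y \<in> {y \<in> X. lin a (cv (G.rp y) j) \<noteq> 0}"
      using G.basic_openD[OF X_ambient y lin_form[OF assms]] by blast
  qed
  then show ?thesis
    using G.open_basic[OF lin_form[OF assms]] unfolding blowup_embedded by simp
qed

lemma rp_lift: "y \<in> X \<Longrightarrow> G.rp y \<in> mlift J y"
  using G.rp_in X_ambient by blast

lemma off_point_op: assumes p: "p \<in> P2" shows "op {y \<in> X. bproj y \<noteq> p}"
proof -
  have "{y \<in> X. bproj y \<noteq> p} =
      (\<Union>i\<in>UNIV. {y \<in> X. lin (\<lambda>k. crossp (rep p) (\<lambda>l. if l = k then 1 else 0) i) (cv (G.rp y) None) \<noteq> 0})"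
    (is "_ = (\<Union>i\<in>UNIV. {y \<in> X. ?l i y \<noteq> 0})")
  proof -
    have l: "?l i y = crossp (rep p) (cv (G.rp y) None) i" for i y
      unfolding crossp_def lin_def
      by (simp add: algebra_simps sum_subtractf mult_delta_left mult_delta_right flip: sum_distrib_left)
    have "bproj y \<noteq> p \<longleftrightarrow> crossp (rep p) (cv (G.rp y) None) \<noteq> (\<lambda>_. 0)" if y: "y \<in> X" for y
    proof
      assume "bproj y \<noteq> p"
      show "crossp (rep p) (cv (G.rp y) None) \<noteq> (\<lambda>_. 0)"
      proof
        assume "crossp (rep p) (cv (G.rp y) None) = (\<lambda>_. 0)"
        then obtain c where c: "cv (G.rp y) None = (\<lambda>i. c * rep p i)"
          using crossp_eq_0_imp rep[OF p] by blast
        moreover have "cv (G.rp y) None \<noteq> (\<lambda>_. 0)"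
          using lift_comp[OF rp_lift[OF y], of None] by blast
        ultimately have "c \<noteq> 0" by auto
        then have "bproj y = p"
          using lift_bproj[OF y rp_lift[OF y]] c cspan1_scale[of c "rep p"] rep[OF p] by simp
        with \<open>bproj y \<noteq> p\<close> show False by blast
      qed
    next
      assume nz: "crossp (rep p) (cv (G.rp y) None) \<noteq> (\<lambda>_. 0)"
      show "bproj y \<noteq> p"
      proof
        assume "bproj y = p"
        then have "cv (G.rp y) None \<in> cspan1 (rep p)"
          using lift_comp[OF rp_lift[OF y], of None] rep[OF p] by (simp add: bproj_def)
        then show False using nz crossp_self by (auto simp: cspan1_def)
      qed
    qed
    then show ?thesis unfolding l by (auto simp: fun_eq_iff)
  qed
  moreover have "op (\<Union>i\<in>UNIV. {y \<in> X. ?l i y \<noteq> 0})"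
    by (intro openin_Union ballI) (auto intro: lin_nonzero_op)
  ultimately show ?thesis by simp
qed

lemma off_points_op: "A \<subseteq> C \<Longrightarrow> op {y \<in> X. bproj y \<notin> A}"
proof -
  assume "A \<subseteq> C"
  then have "finite A" using C_finite by (rule finite_subset)
  then show ?thesis using \<open>A \<subseteq> C\<close>
  proof (induction A)
    case (insert p A)
    then have "op ({y \<in> X. bproj y \<noteq> p} \<inter> {y \<in> X. bproj y \<notin> A})"
      using off_point_op C_P2 by (intro openin_Int) auto
    moreover have "{y \<in> X. bproj y \<noteq> p} \<inter> {y \<in> X. bproj y \<notin> A} = {y \<in> X. bproj y \<notin> insert p A}"
      by blast
    ultimately show ?case by simp
  qed (use op_X in simp)
qed

subsection \<open>Regular functions along rational curves\<close>

text \<open>A polynomial path of coordinate tuples that satisfies the equations of the blowup; it represents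
  points of the blowup for all parameters at which none of the vectors is zero.\<close>

definition curve :: "(complex \<Rightarrow> 3 ppt option \<times> 3 \<Rightarrow> complex) \<Rightarrow> bool" where
  "curve \<Lambda> \<longleftrightarrow> (\<forall>k. \<exists>q. \<forall>t. \<Lambda> t k = poly q t) \<and> (\<forall>t. incident (\<Lambda> t))"

lemma curve_poly: "curve \<Lambda> \<Longrightarrow> F \<in> poly_funs \<Longrightarrow> \<exists>q. \<forall>t. F (\<Lambda> t) = poly q t"
  unfolding curve_def by (rule poly_funs_path) blast+

lemma multiforms_poly_funs: "F \<in> multiforms I d \<Longrightarrow> F \<in> poly_funs"
  by (simp add: multiforms_def)

text \<open>Leaving a Zariski open set is a polynomial condition on the parameter.\<close>

lemma curve_in_open:
  assumes \<Lambda>: "curve \<Lambda>" and N: "op N" and y0: "y0 \<in> N" "\<Lambda> t0 \<in> mlift J y0"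
  shows "\<exists>B. finite B \<and> t0 \<notin> B \<and> (\<forall>t. t \<notin> B \<longrightarrow> pt (\<Lambda> t) \<in> N \<and> \<Lambda> t \<in> mlift J (pt (\<Lambda> t)))"
proof -
  have cofin: "\<exists>B. finite B \<and> t0 \<notin> B \<and> (\<forall>t. t \<notin> B \<longrightarrow> h t \<noteq> 0)"
    if h: "h t0 \<noteq> 0" "\<exists>q. \<forall>t. h t = poly q t" for h :: "complex \<Rightarrow> complex"
  proof -
    obtain q where q: "\<And>t. h t = poly q t" using h(2) by blast
    then have "q \<noteq> 0" using h(1) by auto
    then show ?thesis
      using poly_roots_finite[of q] q h(1) by (intro exI[of _ "{t. poly q t = 0}"]) auto
  qed
  obtain e K where K: "K \<in> multiforms J e" "y0 \<in> basic_open (mlift J) X K" "basic_open (mlift J) X K \<subseteq> N"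
    using G.basic_nbhd[OF X_ambient N[unfolded blowup_embedded] y0(1)] by blast
  have "K (\<Lambda> t0) \<noteq> 0"
    using G.basic_openD[OF X_ambient K(2,1) y0(2)] .
  moreover have "\<exists>q. \<forall>t. K (\<Lambda> t) = poly q t"
    using curve_poly[OF \<Lambda> multiforms_poly_funs[OF K(1)]] .
  ultimately obtain B0 where B0: "finite B0" "t0 \<notin> B0" "\<And>t. t \<notin> B0 \<Longrightarrow> K (\<Lambda> t) \<noteq> 0"
    using cofin[of "\<lambda>t. K (\<Lambda> t)"] by blast
  have "\<exists>B. finite B \<and> t0 \<notin> B \<and> (\<forall>t. t \<notin> B \<longrightarrow> cv (\<Lambda> t) j \<noteq> (\<lambda>_. 0))" if j: "j \<in> J" for j
  proof -
    obtain i where "\<Lambda> t0 (j, i) \<noteq> 0"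
      using lift_comp[OF y0(2) j] by (auto simp: fun_eq_iff)
    then obtain B where "finite B" "t0 \<notin> B" "\<forall>t. t \<notin> B \<longrightarrow> \<Lambda> t (j, i) \<noteq> 0"
      using cofin[of "\<lambda>t. \<Lambda> t (j, i)"] \<Lambda> unfolding curve_def by blast
    then show ?thesis by (metis (mono_tags))
  qed
  then have "\<forall>j\<in>J. \<exists>B. finite B \<and> t0 \<notin> B \<and> (\<forall>t. t \<notin> B \<longrightarrow> cv (\<Lambda> t) j \<noteq> (\<lambda>_. 0))"
    by blast
  then obtain B where B: "\<forall>j\<in>J. finite (B j) \<and> t0 \<notin> B j \<and> (\<forall>t. t \<notin> B j \<longrightarrow> cv (\<Lambda> t) j \<noteq> (\<lambda>_. 0))"
    using bchoice[of J "\<lambda>j B. finite B \<and> t0 \<notin> B \<and> (\<forall>t. t \<notin> B \<longrightarrow> cv (\<Lambda> t) j \<noteq> (\<lambda>_. 0))"] by blast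
  let ?B = "B0 \<union> (\<Union>j\<in>J. B j)"
  have "pt (\<Lambda> t) \<in> N \<and> \<Lambda> t \<in> mlift J (pt (\<Lambda> t))" if t: "t \<notin> ?B" for t
  proof -
    have 1: "pt (\<Lambda> t) \<in> X" "\<Lambda> t \<in> mlift J (pt (\<Lambda> t))"
      by (intro pt_blowup; use B t \<Lambda> in \<open>auto simp: curve_def\<close>)+
    then have "pt (\<Lambda> t) \<in> basic_open (mlift J) X K"
      using B0(3) t unfolding basic_open_def by blast
    then show ?thesis using 1 K(3) by blast
  qed
  moreover have "finite ?B"
    using B0 B J_finite by (intro finite_UnI finite_UN_I) blast+
  moreover have "t0 \<notin> ?B"
    using B0 B by blast
  ultimately show ?thesis by blast
qed

lemma regular_on_curve:
  assumes \<Lambda>: "curve \<Lambda>" and N: "op N" and y0: "y0 \<in> N" "\<Lambda> t0 \<in> mlift J y0" and f: "f \<in> rg N"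
  shows "\<exists>F G B. finite B \<and> t0 \<notin> B \<and> poly G t0 \<noteq> 0 \<and>
    (\<forall>t. t \<notin> B \<longrightarrow> pt (\<Lambda> t) \<in> N \<and> \<Lambda> t \<in> mlift J (pt (\<Lambda> t)) \<and> poly G t \<noteq> 0 \<and>
       f (pt (\<Lambda> t)) * poly G t = poly F t)"
proof -
  obtain B where B: "finite B" "t0 \<notin> B" "\<And>t. t \<notin> B \<Longrightarrow> pt (\<Lambda> t) \<in> N \<and> \<Lambda> t \<in> mlift J (pt (\<Lambda> t))"
    using curve_in_open[where \<Lambda> = \<Lambda> and N = N, OF \<Lambda> N y0] by blast
  obtain e F G where FG: "F \<in> multiforms J e" "G \<in> multiforms J e" "\<And>v. v \<in> mlift J y0 \<Longrightarrow> G v \<noteq> 0"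
      "\<And>y v. y \<in> N \<Longrightarrow> v \<in> mlift J y \<Longrightarrow> G v \<noteq> 0 \<Longrightarrow> f y = F v / G v"
    by (rule rfunE[OF f y0(1)]) blast
  have "\<exists>q. \<forall>t. F (\<Lambda> t) = poly q t" "\<exists>q. \<forall>t. G (\<Lambda> t) = poly q t"
    using curve_poly[OF \<Lambda> multiforms_poly_funs] FG(1,2) by blast+
  then obtain F' G' where F': "\<And>t. F (\<Lambda> t) = poly F' t" and G': "\<And>t. G (\<Lambda> t) = poly G' t" by blast
  have nz: "poly G' t0 \<noteq> 0" using FG(3)[OF y0(2)] G' by simp
  let ?B = "B \<union> {t. poly G' t = 0}"
  have "finite {t. poly G' t = 0}" using nz by (intro poly_roots_finite) auto
  then have fin: "finite ?B" using B(1) by blast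
  have t0: "t0 \<notin> ?B" using B(2) nz by blast
  have D: "pt (\<Lambda> t) \<in> N \<and> \<Lambda> t \<in> mlift J (pt (\<Lambda> t)) \<and> poly G' t \<noteq> 0 \<and>
       f (pt (\<Lambda> t)) * poly G' t = poly F' t" if t: "t \<notin> ?B" for t
  proof -
    have "pt (\<Lambda> t) \<in> N" "\<Lambda> t \<in> mlift J (pt (\<Lambda> t))" using B(3) t by blast+
    then show ?thesis using FG(4)[of "pt (\<Lambda> t)" "\<Lambda> t"] t F'[of t] G'[of t] by simp
  qed
  show ?thesis
    by (rule exI[of _ F'], rule exI[of _ G'], rule exI[of _ ?B], intro conjI allI impI fin t0 nz)
      (use D in blast)+
qed

lemma regular_zero_on_curve:
  assumes \<Lambda>: "curve \<Lambda>" and N: "op N" and y0: "y0 \<in> N" "\<Lambda> t0 \<in> mlift J y0" and f: "f \<in> rg N"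
    and A: "finite A" and zero: "\<And>t. t \<notin> A \<Longrightarrow> pt (\<Lambda> t) \<in> N \<Longrightarrow> \<Lambda> t \<in> mlift J (pt (\<Lambda> t)) \<Longrightarrow> f (pt (\<Lambda> t)) = 0"
  shows "f y0 = 0"
proof -
  obtain F G B where *: "finite B" "t0 \<notin> B" "poly G t0 \<noteq> 0"
    "\<And>t. t \<notin> B \<Longrightarrow> pt (\<Lambda> t) \<in> N \<and> \<Lambda> t \<in> mlift J (pt (\<Lambda> t)) \<and> poly G t \<noteq> 0 \<and>
       f (pt (\<Lambda> t)) * poly G t = poly F t"
    using regular_on_curve[where \<Lambda> = \<Lambda> and N = N, OF \<Lambda> N y0 f] by blast
  have "F = 0"
  proof (rule poly_eq_cofinite)
    show "finite (A \<union> B)" using A * by blast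
    fix t assume "t \<notin> A \<union> B"
    then show "poly F t = poly 0 t" using *(4)[of t] zero[of t] by simp
  qed
  moreover have "pt (\<Lambda> t0) = y0"
    using pt_unique[OF _ y0(2)] op_subset[OF N] y0(1) by blast
  ultimately show ?thesis using *(2,3) *(4)[of t0] by auto
qed

end

subsection \<open>Charts along the exceptional curves\<close>

text \<open>Near a point of the exceptional curve over \<open>p\<close> the coordinates are \<open>w\<close>, the slope of the line
  \<open>e + w f\<close> through \<open>p\<close>, and \<open>u\<close>, the position on that line of the point \<open>base u w\<close> of the plane.
  The lines through the other centres are determined by this point; \<open>\<Psi> u w\<close> is the tuple of all
  homogeneous coordinates.\<close>

locale blowup_chart = blowup_plane +
  fixes p :: "3 ppt" and e f g e' f' pv :: "3 \<Rightarrow> complex"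
  assumes p_C: "p \<in> C" and p_span: "p = cspan1 pv" and basis: "dual_basis e f g e' f' pv"
begin

definition base :: "complex \<Rightarrow> complex \<Rightarrow> 3 \<Rightarrow> complex" where
  "base u w = (\<lambda>i. pv i + u * (f' i - w * e' i))"

definition \<Psi> :: "complex \<Rightarrow> complex \<Rightarrow> 3 ppt option \<times> 3 \<Rightarrow> complex" where
  "\<Psi> u w = (\<lambda>(j, i). case j of None \<Rightarrow> base u w i
     | Some q \<Rightarrow> if q = p then e i + w * f i else crossp (rep q) (base u w) i)"

definition ucoord :: "bpt \<Rightarrow> complex" where
  "ucoord y = lin f (cv (G.rp y) None) / lin g (cv (G.rp y) None)"

definition wcoord :: "bpt \<Rightarrow> complex" where
  "wcoord y = lin f' (cv (G.rp y) (Some p)) / lin e' (cv (G.rp y) (Some p))"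

definition W :: "bpt set" where
  "W = {y \<in> X. lin g (cv (G.rp y) None) \<noteq> 0} \<inter> {y \<in> X. lin e' (cv (G.rp y) (Some p)) \<noteq> 0} \<inter>
     {y \<in> X. bproj y \<notin> C - {p}}"

lemma W_X: "W \<subseteq> X" by (auto simp: W_def)

lemma op_W: "op W"
proof -
  have 1: "op {y \<in> X. lin g (cv (G.rp y) None) \<noteq> 0}"
    by (rule lin_nonzero_op) simp
  have 2: "op {y \<in> X. lin e' (cv (G.rp y) (Some p)) \<noteq> 0}"
    by (rule lin_nonzero_op) (simp add: p_C)
  have 3: "op {y \<in> X. bproj y \<notin> C - {p}}"
    by (rule off_points_op) blast
  show ?thesis
    unfolding W_def by (rule openin_Int[OF openin_Int[OF 1 2] 3])
qed

lemma ucoord_regular: "ucoord \<in> rg W"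
  unfolding ucoord_def by (rule lin_ratio_regular) (simp_all add: W_X, simp add: W_def)

lemma wcoord_regular: "wcoord \<in> rg W"
  unfolding wcoord_def by (rule lin_ratio_regular) (simp_all add: W_X p_C, simp add: W_def)

lemma lin_base: "lin e (base u w) = - u * w" "lin f (base u w) = u" "lin g (base u w) = 1"
  using basis unfolding base_def dual_basis_def lin_simps by simp_all

lemma cv_\<Psi>: "cv (\<Psi> u w) None = base u w" "cv (\<Psi> u w) (Some p) = (\<lambda>i. e i + w * f i)"
  "q \<noteq> p \<Longrightarrow> cv (\<Psi> u w) (Some q) = crossp (rep q) (base u w)"
  by (simp_all add: \<Psi>_def)

lemma pv_nonzero: "pv \<noteq> (\<lambda>_. 0)"
  using basis by (auto simp: dual_basis_def)

lemma rep_p: "\<exists>c. rep p = (\<lambda>i. c * pv i)"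
  using rep(1)[of p] p_C p_span C_P2 by (auto simp: cspan1_iff)

lemma \<Psi>_incident: "incident (\<Psi> u w)"
  unfolding incident_def
proof
  fix q assume q: "q \<in> C"
  show "lin (cv (\<Psi> u w) (Some q)) (rep q) = 0 \<and> lin (cv (\<Psi> u w) (Some q)) (cv (\<Psi> u w) None) = 0"
  proof (cases "q = p")
    case True
    obtain c where "rep p = (\<lambda>i. c * pv i)" using rep_p by blast
    then show ?thesis
      using True basis unfolding True cv_\<Psi> by (simp add: dual_basis_def lin_simps lin_base)
  next
    case False
    then show ?thesis by (simp add: cv_\<Psi>)
  qed
qed

lemma form_ratio:
  assumes "y \<in> X" "v \<in> mlift J y" "j \<in> J"
  shows "lin a (cv (G.rp y) j) / lin b (cv (G.rp y) j) = lin a (cv v j) / lin b (cv v j)"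
  using G.quotient_eq[OF _ rp_lift[OF assms(1)] assms(2) lin_form[OF assms(3)] lin_form[OF assms(3)]]
    assms(1) X_ambient by blast

lemma \<Psi>_coords:
  assumes "y \<in> X" "\<Psi> u w \<in> mlift J y"
  shows "ucoord y = u" "wcoord y = w"
proof -
  show "ucoord y = u"
    unfolding ucoord_def form_ratio[OF assms, of None, simplified] cv_\<Psi> lin_base by simp
  have "lin f' (\<lambda>i. e i + w * f i) = w" "lin e' (\<lambda>i. e i + w * f i) = 1"
    using basis unfolding lin_simps by (simp_all add: dual_basis_def lin_commute)
  then show "wcoord y = w"
    using form_ratio[OF assms, of "Some p" f' e'] p_C unfolding wcoord_def cv_\<Psi> by simp
qed

text \<open>By duality, the line of a point of the chart is \<open>e + w f\<close> up to a scalar, and since it contains the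
  base point, the \<open>e\<close>-coordinate of the latter is \<open>-w\<close> times its \<open>f\<close>-coordinate.\<close>

lemma \<Psi>_lift:
  assumes y: "y \<in> W"
  shows "\<Psi> (ucoord y) (wcoord y) \<in> mlift J y"
proof -
  define v where "v = G.rp y"
  define x l where "x = cv v None" and "l = cv v (Some p)"
  have yX: "y \<in> X" using y W_X by blast
  have v: "v \<in> mlift J y" unfolding v_def by (rule rp_lift[OF yX])
  have nz: "lin g x \<noteq> 0" "lin l e' \<noteq> 0"
    using y by (auto simp: W_def x_def l_def v_def lin_commute)
  have uw: "ucoord y = lin f x / lin g x" "wcoord y = lin l f' / lin l e'"
    by (simp_all add: ucoord_def wcoord_def x_def l_def v_def lin_commute)
  have inc: "lin l pv = 0" "lin l x = 0"
  proof -
    have i: "lin l (rep p) = 0" "lin l x = 0"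
      using lift_incident[OF yX v] p_C unfolding incident_def l_def x_def by blast+
    obtain c where c: "rep p = (\<lambda>i. c * pv i)" using rep_p by blast
    then have "c \<noteq> 0" using rep(2)[of p] p_C C_P2 by auto
    then show "lin l pv = 0" "lin l x = 0" using i c by (simp_all add: lin_simps)
  qed
  have l: "l = (\<lambda>i. lin l e' * e i + lin l f' * f i)"
    using dual_basis_form[OF basis, of l] inc by simp
  have x: "x = (\<lambda>i. lin e x * e' i + lin f x * f' i + lin g x * pv i)"
    by (rule dual_basis_vec[OF basis])
  have lx: "lin l x = lin l e' * lin e x + lin l f' * lin f x"
    by (subst l) (simp add: lin_simps)
  then have ex: "lin e x = - wcoord y * lin f x"
  proof -
    have "lin e x * lin l e' = - (lin l f' * lin f x)"
      using inc lx by (simp add: add_eq_0_iff mult.commute)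
    then have "lin e x = - (lin l f' * lin f x) / lin l e'"
      by (rule eq_divide_imp[OF nz(2)])
    then show ?thesis by (simp add: uw)
  qed
  have xb: "base (ucoord y) (wcoord y) = (\<lambda>i. inverse (lin g x) * x i)"
  proof
    fix i
    have "x i = lin e x * e' i + lin f x * f' i + lin g x * pv i"
      using x by (rule fun_cong)
    then show "base (ucoord y) (wcoord y) i = inverse (lin g x) * x i"
      unfolding base_def ex uw(1) using nz by (simp add: field_simps)
  qed
  have lb: "(\<lambda>i. e i + wcoord y * f i) = (\<lambda>i. inverse (lin l e') * l i)"
  proof
    fix i
    have "l i = lin l e' * e i + lin l f' * f i"
      using l by (rule fun_cong)
    then show "e i + wcoord y * f i = inverse (lin l e') * l i"
      unfolding uw(2) using nz by (simp add: field_simps)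
  qed
  have sc: "c \<noteq> 0 \<Longrightarrow> j \<in> J \<Longrightarrow> (\<lambda>i. c * v (j, i)) \<in> y j - {\<lambda>_. 0}" for c j
    using lift_cspan1[OF yX v, of j] lift_comp[OF v, of j] by (auto simp: cspan1_def fun_eq_iff)
  have "cv (\<Psi> (ucoord y) (wcoord y)) j \<in> y j - {\<lambda>_. 0}" if j: "j \<in> J" for j
  proof (cases j)
    case None
    then show ?thesis
      using sc[of "inverse (lin g x)" None] nz unfolding None cv_\<Psi> xb by (simp add: x_def)
  next
    case (Some q)
    show ?thesis
    proof (cases "q = p")
      case True
      then show ?thesis
        using sc[of "inverse (lin l e')" "Some p"] nz p_C unfolding Some True cv_\<Psi> lb by (simp add: l_def)
    next
      case False
      have q: "q \<in> C" "q \<in> P2" using j Some C_P2 by auto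
      have "crossp (rep q) x \<noteq> (\<lambda>_. 0)"
      proof
        assume "crossp (rep q) x = (\<lambda>_. 0)"
        then obtain c where c: "x = (\<lambda>i. c * rep q i)"
          using crossp_eq_0_imp rep(2)[OF q(2)] by blast
        then have "c \<noteq> 0" using nz by auto
        then have "bproj y = q"
          using lift_bproj[OF yX v] cspan1_scale[of c "rep q"] rep(3)[OF q(2)] c by (simp add: x_def)
        then show False using y q False by (auto simp: W_def)
      qed
      moreover have "lin (cv v (Some q)) (rep q) = 0" "lin (cv v (Some q)) x = 0"
        using lift_incident[OF yX v] q(1) unfolding incident_def x_def by blast+
      ultimately obtain c where c: "cv v (Some q) = (\<lambda>i. c * crossp (rep q) x i)"
        using annihilator_eq_crossp by blast
      then have "c \<noteq> 0" using lift_comp[OF v, of "Some q"] j Some by auto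
      then have "crossp (rep q) x = (\<lambda>i. inverse c * v (Some q, i))"
        using fun_cong[OF c] by (simp add: fun_eq_iff)
      then have "cv (\<Psi> (ucoord y) (wcoord y)) (Some q) =
          (\<lambda>i. (inverse (lin g x) * inverse c) * v (Some q, i))"
        unfolding cv_\<Psi>(3)[OF False] xb crossp_scale_right by (simp add: mult.assoc)
      then show ?thesis
        using sc[of "inverse (lin g x) * inverse c" "Some q"] \<open>c \<noteq> 0\<close> nz q unfolding Some by simp
    qed
  qed
  then show ?thesis unfolding mlift_def by blast
qed

lemma W_eq_pt: "y \<in> W \<Longrightarrow> y = pt (\<Psi> (ucoord y) (wcoord y))"
  using pt_unique[OF _ \<Psi>_lift] W_X by blast

lemma base_span: "y \<in> W \<Longrightarrow> bproj y = cspan1 (base (ucoord y) (wcoord y))"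
  using lift_bproj[OF _ \<Psi>_lift] W_X unfolding cv_\<Psi> by blast

lemma ucoord_zero_iff: "y \<in> W \<Longrightarrow> ucoord y = 0 \<longleftrightarrow> bproj y = p"
proof
  assume y: "y \<in> W" and "ucoord y = 0"
  then show "bproj y = p" using base_span[OF y] p_span by (simp add: base_def)
next
  assume y: "y \<in> W" and "bproj y = p"
  then have "base (ucoord y) (wcoord y) \<in> cspan1 pv"
    using base_span[OF y] p_span cspan1_self[of "base (ucoord y) (wcoord y)"] by metis
  then have "lin f (base (ucoord y) (wcoord y)) = 0"
    using basis by (auto simp: cspan1_def lin_simps dual_basis_def)
  then show "ucoord y = 0" unfolding lin_base .
qed

lemma \<Psi>_poly_funs: "(\<lambda>z. \<Psi> (z True) (z False) k) \<in> poly_funs"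
proof -
  have b: "(\<lambda>z. base (z True) (z False) i) \<in> poly_funs" for i
    unfolding base_def
    by (intro poly_funs.add poly_funs.mult poly_funs_diff poly_funs.const poly_funs.coord)
  obtain j i where k: "k = (j, i)" by (cases k)
  show ?thesis
  proof (cases j)
    case None
    then show ?thesis using b unfolding k \<Psi>_def by simp
  next
    case (Some q)
    show ?thesis
    proof (cases "q = p")
      case True
      then show ?thesis unfolding k \<Psi>_def Some
        by (simp add: poly_funs.add poly_funs.mult poly_funs.const poly_funs.coord)
    next
      case False
      have "(\<lambda>z. crossp (rep q) (base (z True) (z False)) i) \<in> poly_funs"
        unfolding crossp_def by (intro poly_funs_diff poly_funs.mult poly_funs.const b)
      then show ?thesis using False unfolding k \<Psi>_def Some by simp
    qed
  qed
qed

lemma \<Psi>_curve: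
  assumes "\<And>b. \<exists>q. \<forall>t. \<zeta> t b = poly q t"
  shows "curve (\<lambda>t. \<Psi> (\<zeta> t True) (\<zeta> t False))"
  unfolding curve_def using poly_funs_path[OF \<Psi>_poly_funs, where \<Lambda> = \<zeta>, OF assms] \<Psi>_incident by blast

lemma u_curve: "curve (\<lambda>t. \<Psi> t w)"
proof -
  have "\<exists>q. \<forall>t. (if b then t else w) = poly q t" for b
    by (rule exI[of _ "if b then [:0, 1:] else [:w:]"]) simp
  from \<Psi>_curve[of "\<lambda>t b. if b then t else w", OF this] show ?thesis by simp
qed

lemma w_curve: "curve (\<lambda>t. \<Psi> u t)"
proof -
  have "\<exists>q. \<forall>t. (if b then u else t) = poly q t" for b
    by (rule exI[of _ "if b then [:u:] else [:0, 1:]"]) simp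
  from \<Psi>_curve[of "\<lambda>t b. if b then u else t", OF this] show ?thesis by simp
qed

end

section \<open>Local equations of the exceptional curves\<close>

context blowup_plane
begin

text \<open>The chart can be centred at any given point over \<open>p\<close>, by taking its line as \<open>e\<close>.\<close>

lemma chart_at:
  assumes y: "y \<in> X" and p: "p \<in> C" "bproj y = p"
  shows "\<exists>e f g e' f' pv. blowup_chart C p e f g e' f' pv \<and> y \<in> blowup_chart.W C p g e' \<and>
    blowup_chart.wcoord C p e' f' y = 0 \<and> e \<in> y (Some p) \<and> e \<noteq> (\<lambda>_. 0)"
proof -
  define v where "v = G.rp y"
  define e where "e = cv v (Some p)"
  have v: "v \<in> mlift J y" unfolding v_def by (rule rp_lift[OF y])
  have pP: "p \<in> P2" using p C_P2 by blast
  have e: "e \<in> y (Some p)" "e \<noteq> (\<lambda>_. 0)"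
    using lift_comp[OF v, of "Some p"] p unfolding e_def by auto
  have "lin e (rep p) = 0"
    using lift_incident[OF y v] p unfolding incident_def e_def by blast
  then obtain f g e' f' where db: "dual_basis e f g e' f' (rep p)"
    using dual_basis_exists e(2) rep(2)[OF pP] by blast
  interpret ch: blowup_chart C p e f g e' f' "rep p"
    by unfold_locales (use p rep(3)[OF pP] db in auto)
  have "cv v None \<in> cspan1 (rep p)" "cv v None \<noteq> (\<lambda>_. 0)"
    using lift_comp[OF v, of None] p rep(3)[OF pP] by (simp_all add: bproj_def)
  then obtain c where c: "cv v None = (\<lambda>i. c * rep p i)"
    unfolding cspan1_def by auto
  then have "c \<noteq> 0"
    using \<open>cv v None \<noteq> (\<lambda>_. 0)\<close> by auto
  have "lin g (cv v None) \<noteq> 0"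
    using c \<open>c \<noteq> 0\<close> db by (simp add: lin_scale_right dual_basis_def)
  moreover have "lin e' (cv v (Some p)) \<noteq> 0" "lin f' (cv v (Some p)) = 0"
    using db unfolding e_def[symmetric] by (simp_all add: dual_basis_def lin_commute)
  ultimately have "y \<in> ch.W" "ch.wcoord y = 0"
    using y p unfolding ch.W_def ch.wcoord_def v_def by simp_all
  then show ?thesis
    using ch.blowup_chart_axioms e by blast
qed

text \<open>The complement of the exceptional curves is dense: moving a point over \<open>p\<close> along its line, that
  is, varying \<open>u\<close> with \<open>w\<close> fixed, leaves the exceptional curves at once.\<close>

lemma regular_eq_zero:
  assumes N: "op N" and r: "r \<in> rg N" and zero: "\<And>y. y \<in> N \<Longrightarrow> bproj y \<notin> C \<Longrightarrow> r y = 0" and y: "y \<in> N"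
  shows "r y = 0"
proof (cases "bproj y \<in> C")
  case True
  have yX: "y \<in> X" using op_subset[OF N] y by blast
  obtain e f g e' f' pv where ch: "blowup_chart C (bproj y) e f g e' f' pv"
      "y \<in> blowup_chart.W C (bproj y) g e'"
    using chart_at[OF yX True refl] by blast
  interpret ch: blowup_chart C "bproj y" e f g e' f' pv by (fact ch)
  have u0: "ch.ucoord y = 0" using ch.ucoord_zero_iff[OF ch(2)] by simp
  show ?thesis
  proof (rule regular_zero_on_curve[where \<Lambda> = "\<lambda>t. ch.\<Psi> t (ch.wcoord y)" and N = "N \<inter> ch.W" and A = "{0}" and ?t0.0 = 0])
    show "curve (\<lambda>t. ch.\<Psi> t (ch.wcoord y))" by (rule ch.u_curve)
    show "op (N \<inter> ch.W)" by (rule openin_Int[OF N ch.op_W])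
    show "y \<in> N \<inter> ch.W" using y ch(2) by blast
    show "ch.\<Psi> 0 (ch.wcoord y) \<in> mlift J y" using ch.\<Psi>_lift[OF ch(2)] u0 by simp
    show "r \<in> rg (N \<inter> ch.W)" by (rule rfun_mono[OF r]) blast
  next
    fix t :: complex
    let ?z = "pt (ch.\<Psi> t (ch.wcoord y))"
    assume t: "t \<notin> {0}" and z: "?z \<in> N \<inter> ch.W" "ch.\<Psi> t (ch.wcoord y) \<in> mlift J ?z"
    have "?z \<in> X" using z(1) ch.W_X by blast
    then have "ch.ucoord ?z = t" using ch.\<Psi>_coords(1) z(2) by blast
    then have "bproj ?z \<noteq> bproj y" using ch.ucoord_zero_iff[of ?z] z(1) t by auto
    then have "bproj ?z \<notin> C" using z(1) unfolding ch.W_def by blast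
    then show "r ?z = 0" using zero z(1) by blast
  qed simp
qed (use zero y in blast)

lemma local_equation_disjoint:
  assumes "op U" "E \<inter> U = {}"
  shows "local_equation (blowup C) E U (\<lambda>_. 1)"
  unfolding local_equation_def
proof (intro conjI allI impI ballI)
  show "(\<lambda>_. 1) \<in> reg (blowup C) U" unfolding reg_blowup by (rule G.rfun_const)
  fix V f assume V: "V \<subseteq> U" and f: "f \<in> reg (blowup C) V"
  have "E \<inter> V = {}" using V assms by blast
  then show "(\<forall>y\<in>E \<inter> V. f y = 0) \<longleftrightarrow> (\<exists>g\<in>reg (blowup C) V. \<forall>y\<in>V. f y = 1 * g y)"
    using f by auto
qed

lemma local_equationD:
  assumes "local_equation (blowup C) E U t" "op V" "V \<subseteq> U" "f \<in> rg V"
  shows "(\<forall>y\<in>E \<inter> V. f y = 0) \<longleftrightarrow> (\<exists>g\<in>rg V. \<forall>y\<in>V. f y = t y * g y)"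
  using assms unfolding local_equation_def reg_blowup by blast

lemma local_equation_regular: "local_equation (blowup C) E U t \<Longrightarrow> t \<in> rg U"
  unfolding local_equation_def by simp

text \<open>On the complement of the curve, \<open>t\<close> divides the function \<open>1\<close>.\<close>

lemma local_equation_nonzero:
  assumes t: "local_equation (blowup C) (exceptional C p) U t" and U: "op U" and p: "p \<in> C"
    and y: "y \<in> U" "bproj y \<noteq> p"
  shows "t y \<noteq> 0"
proof -
  let ?V = "U \<inter> {y \<in> X. bproj y \<noteq> p}"
  have "op ?V" using U off_point_op p C_P2 by (intro openin_Int) auto
  moreover have "(\<lambda>_. 1) \<in> rg ?V" by (rule G.rfun_const)
  moreover have "exceptional C p \<inter> ?V = {}" by (auto simp: exceptional_iff)
  ultimately obtain g where "\<forall>y\<in>?V. 1 = t y * g y"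
    using local_equationD[OF t, of ?V "\<lambda>_. 1"] by auto
  moreover have "y \<in> ?V" using y op_subset[OF U] by blast
  ultimately show ?thesis by force
qed

lemma local_equation_vanishes:
  assumes t: "local_equation (blowup C) E U t" and V: "op V" "V \<subseteq> U" and y: "y \<in> E \<inter> V"
  shows "t y = 0"
proof -
  have tV: "t \<in> rg V" by (rule rfun_mono[OF local_equation_regular[OF t] V(2)])
  have "\<exists>g\<in>rg V. \<forall>y\<in>V. t y = t y * g y"
    by (intro bexI[OF _ G.rfun_const[of 1]]) simp
  then show ?thesis using local_equationD[OF t V tV] y by blast
qed

text \<open>Each of the two equations divides the other.  The product of the two quotients is \<open>1\<close> off the
  exceptional curves, hence everywhere.\<close>

lemma local_equation_unit:
  assumes t1: "local_equation (blowup C) (exceptional C p) U1 t1" and t2: "local_equation (blowup C) (exceptional C p) U2 t2"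
    and U: "op U1" "op U2" and p: "p \<in> C"
  shows "\<exists>g\<in>rg (U1 \<inter> U2). \<forall>y\<in>U1 \<inter> U2. t1 y = t2 y * g y \<and> g y \<noteq> 0"
proof -
  let ?N = "U1 \<inter> U2"
  have N: "op ?N" by (rule openin_Int[OF U])
  have t1N: "t1 \<in> rg ?N" by (rule rfun_mono[OF local_equation_regular[OF t1]]) simp
  have t2N: "t2 \<in> rg ?N" by (rule rfun_mono[OF local_equation_regular[OF t2]]) simp
  have "\<forall>y\<in>exceptional C p \<inter> ?N. t1 y = 0"
    using local_equation_vanishes[OF t1 N] by blast
  then obtain g where g: "g \<in> rg ?N" "\<And>y. y \<in> ?N \<Longrightarrow> t1 y = t2 y * g y"
    using local_equationD[OF t2 N _ t1N] by blast
  have "\<forall>y\<in>exceptional C p \<inter> ?N. t2 y = 0"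
    using local_equation_vanishes[OF t2 N] by blast
  then obtain g' where g': "g' \<in> rg ?N" "\<And>y. y \<in> ?N \<Longrightarrow> t2 y = t1 y * g' y"
    using local_equationD[OF t1 N _ t2N] by blast
  have "g' y * g y - 1 = 0" if y: "y \<in> ?N" for y
  proof (rule regular_eq_zero[OF N _ _ y, of "\<lambda>y. g' y * g y - 1"])
    show "(\<lambda>y. g' y * g y - 1) \<in> rg ?N"
      by (rule G.rfun_diff[OF G.rfun_mult[OF g'(1) g(1)] G.rfun_const])
    fix z assume z: "z \<in> ?N" "bproj z \<notin> C"
    then have "bproj z \<noteq> p" using p by blast
    then have "t1 z \<noteq> 0" using local_equation_nonzero[OF t1 U(1) p] z(1) by blast
    moreover have "t1 z = t1 z * (g' z * g z)"
      using g(2)[OF z(1)] g'(2)[OF z(1)] by simp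
    ultimately show "g' z * g z - 1 = 0" by simp
  qed
  then have "\<forall>y\<in>?N. g y \<noteq> 0" by force
  then show ?thesis using g by blast
qed

end

context blowup_chart
begin

text \<open>A regular function is a quotient of polynomials in \<open>u\<close> and \<open>w\<close>; if it vanishes on the
  exceptional curve, then the numerator vanishes for infinitely many \<open>w\<close> at \<open>u = 0\<close>, so \<open>u\<close>
  divides it.\<close>

lemma divide_by_ucoord:
  assumes V: "op V" "V \<subseteq> W" and r: "r \<in> rg V" and zero: "\<And>y. y \<in> V \<Longrightarrow> bproj y = p \<Longrightarrow> r y = 0" and x: "x \<in> V"
  shows "\<exists>N a. op N \<and> x \<in> N \<and> N \<subseteq> V \<and> a \<in> rg N \<and> (\<forall>y\<in>N. r y = ucoord y * a y)"
proof (cases "ucoord x = 0")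
  case False
  let ?N = "{y \<in> V. ucoord y \<noteq> 0}"
  have u: "ucoord \<in> rg V" by (rule rfun_mono[OF ucoord_regular V(2)])
  have NV: "?N \<subseteq> V" by blast
  have N: "op ?N" by (rule op_nonzero[OF V(1) u])
  have "(\<lambda>y. r y / ucoord y) \<in> rg ?N"
    by (rule G.rfun_divide[OF rfun_mono[OF r NV] rfun_mono[OF u NV]]) simp
  then show ?thesis
    using N x False by (intro exI[of _ ?N] exI[of _ "\<lambda>y. r y / ucoord y"] conjI) simp_all
next
  case True
  obtain d F G where FG: "F \<in> multiforms J d" "G \<in> multiforms J d" "\<And>v. v \<in> mlift J x \<Longrightarrow> G v \<noteq> 0"
      "\<And>y v. y \<in> V \<Longrightarrow> v \<in> mlift J y \<Longrightarrow> G v \<noteq> 0 \<Longrightarrow> r y = F v / G v"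
    by (rule rfunE[OF r x]) blast
  \<comment> \<open>A pair of coordinates is a function on \<open>bool\<close>, with \<open>u\<close> at \<open>True\<close> and \<open>w\<close> at \<open>False\<close>.\<close>
  define F' G' where "F' = (\<lambda>z. F (\<Psi> (z True) (z False)))" and "G' = (\<lambda>z. G (\<Psi> (z True) (z False)))"
  have F': "F' \<in> poly_funs" and G': "G' \<in> poly_funs"
    unfolding F'_def G'_def
    by (rule poly_funs_subst[OF multiforms_poly_funs[OF FG(1)] \<Psi>_poly_funs],
        rule poly_funs_subst[OF multiforms_poly_funs[OF FG(2)] \<Psi>_poly_funs])
  obtain Q where Q: "Q \<in> poly_funs" "\<And>z. F' z = F' (z(True := 0)) + z True * Q z"
    using poly_funs_divide[OF F', of True] by blast
  have xW: "x \<in> W" using x V(2) by blast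
  have xX: "x \<in> X" using xW W_X by blast
  have lx: "\<Psi> 0 (wcoord x) \<in> mlift J x" using \<Psi>_lift[OF xW] True by simp
  have F0: "F (\<Psi> 0 w) = 0" for w
  proof -
    obtain q where q: "\<And>t. F (\<Psi> 0 t) = poly q t"
      using curve_poly[OF w_curve multiforms_poly_funs[OF FG(1)]] by blast
    have N: "op (V \<inter> basic_open (mlift J) X G)"
      using openin_Int[OF V(1)] G.open_basic[OF FG(2)] unfolding blowup_embedded by blast
    have xB: "x \<in> V \<inter> basic_open (mlift J) X G"
      using x xX FG(3) by (intro IntI G.basic_openI[OF X_ambient])
    obtain B where B: "finite B" "\<And>t. t \<notin> B \<Longrightarrow> pt (\<Psi> 0 t) \<in> V \<inter> basic_open (mlift J) X G \<and>
        \<Psi> 0 t \<in> mlift J (pt (\<Psi> 0 t))"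
      using curve_in_open[OF w_curve N xB lx] by blast
    have "q = 0"
    proof (rule poly_eq_cofinite[OF B(1)])
      fix t assume "t \<notin> B"
      then have z: "pt (\<Psi> 0 t) \<in> V" "pt (\<Psi> 0 t) \<in> basic_open (mlift J) X G" "\<Psi> 0 t \<in> mlift J (pt (\<Psi> 0 t))"
        using B(2) by blast+
      have "pt (\<Psi> 0 t) \<in> W" using z(1) V(2) by blast
      moreover have "ucoord (pt (\<Psi> 0 t)) = 0"
        using \<Psi>_coords(1)[OF _ z(3)] \<open>pt (\<Psi> 0 t) \<in> W\<close> W_X by blast
      ultimately have "r (pt (\<Psi> 0 t)) = 0"
        using zero[OF z(1)] ucoord_zero_iff by blast
      moreover have "G (\<Psi> 0 t) \<noteq> 0" by (rule G.basic_openD[OF X_ambient z(2) FG(2) z(3)])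
      ultimately show "poly q t = poly 0 t" using FG(4)[OF z(1,3)] q[of t] by simp
    qed
    then show ?thesis using q by simp
  qed
  let ?N = "V \<inter> basic_open (mlift J) X G"
  have N: "op ?N"
    using openin_Int[OF V(1)] G.open_basic[OF FG(2)] unfolding blowup_embedded by blast
  have xB: "x \<in> ?N"
    using x xX FG(3) by (intro IntI G.basic_openI[OF X_ambient])
  define \<xi> where "\<xi> = (\<lambda>y b. if b then ucoord y else wcoord y)"
  have Gnz: "G' (\<xi> y) \<noteq> 0" if y: "y \<in> ?N" for y
  proof -
    have "\<Psi> (ucoord y) (wcoord y) \<in> mlift J y" using \<Psi>_lift y V(2) by blast
    then have "G (\<Psi> (ucoord y) (wcoord y)) \<noteq> 0" using G.basic_openD[OF X_ambient _ FG(2)] y by blast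
    then show ?thesis by (simp add: G'_def \<xi>_def)
  qed
  have NW: "?N \<subseteq> W" using V(2) by blast
  have \<xi>: "(\<lambda>y. \<xi> y b) \<in> rg ?N" for b
    using rfun_mono[OF ucoord_regular NW] rfun_mono[OF wcoord_regular NW] by (cases b) (simp_all add: \<xi>_def)
  have a: "(\<lambda>y. Q (\<xi> y) / G' (\<xi> y)) \<in> rg ?N"
    by (rule G.rfun_divide[OF G.rfun_poly_funs[OF Q(1) \<xi>] G.rfun_poly_funs[OF G' \<xi>] Gnz])
  have "r y = ucoord y * (Q (\<xi> y) / G' (\<xi> y))" if y: "y \<in> ?N" for y
  proof -
    have l: "\<Psi> (ucoord y) (wcoord y) \<in> mlift J y" using \<Psi>_lift y V(2) by blast
    have "r y = F' (\<xi> y) / G' (\<xi> y)"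
      using FG(4)[OF _ l] y Gnz[OF y] by (simp add: F'_def G'_def \<xi>_def)
    also have "F' (\<xi> y) = ucoord y * Q (\<xi> y)"
      using Q(2)[of "\<xi> y"] F0 by (simp add: F'_def \<xi>_def)
    finally show ?thesis by simp
  qed
  then show ?thesis
    using N xB a by (intro exI[of _ ?N] exI[of _ "\<lambda>y. Q (\<xi> y) / G' (\<xi> y)"] conjI ballI) blast+
qed

lemma local_equation_ucoord: "local_equation (blowup C) (exceptional C p) W ucoord"
  unfolding local_equation_def
proof (intro conjI allI impI ballI)
  show "ucoord \<in> reg (blowup C) W" using ucoord_regular by simp
  fix V f assume V: "V \<subseteq> W" "op V" and f': "f \<in> reg (blowup C) V"
  have f: "f \<in> rg V" using f' by simp
  show "(\<forall>y\<in>exceptional C p \<inter> V. f y = 0) \<longleftrightarrow> (\<exists>g\<in>reg (blowup C) V. \<forall>y\<in>V. f y = ucoord y * g y)"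
  proof
    assume "\<forall>y\<in>exceptional C p \<inter> V. f y = 0"
    then have zero: "\<And>y. y \<in> V \<Longrightarrow> bproj y = p \<Longrightarrow> f y = 0"
      using op_subset[OF V(2)] by (auto simp: exceptional_iff)
    have "\<exists>a\<in>rg V. \<forall>y\<in>V. f y = ucoord y * a y"
    proof (rule rg_glue[where Q = "\<lambda>y c. f y = ucoord y * c"])
      show "V \<subseteq> X" by (rule op_subset[OF V(2)])
      show "\<exists>N a. op N \<and> x \<in> N \<and> N \<subseteq> V \<and> a \<in> rg N \<and> (\<forall>y\<in>N. f y = ucoord y * a y)" if "x \<in> V" for x
        by (rule divide_by_ucoord[OF V(2,1) f zero that])
    next
      fix N a b y assume N: "op N" "N \<subseteq> V" and ab: "a \<in> rg N" "b \<in> rg N"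
        "\<And>z. z \<in> N \<Longrightarrow> f z = ucoord z * a z \<and> f z = ucoord z * b z" and y: "y \<in> N"
      have "a y - b y = 0"
      proof (rule regular_eq_zero[OF N(1) _ _ y, of "\<lambda>y. a y - b y"])
        show "(\<lambda>y. a y - b y) \<in> rg N" by (rule G.rfun_diff[OF ab(1,2)])
        fix z assume z: "z \<in> N" "bproj z \<notin> C"
        then have "bproj z \<noteq> p" using p_C by blast
        then have "ucoord z \<noteq> 0" using ucoord_zero_iff[of z] z N(2) V(1) by blast
        then show "a z - b z = 0" using ab(3)[OF z(1)] by auto
      qed
      then show "a y = b y" by simp
    qed
    then show "\<exists>g\<in>reg (blowup C) V. \<forall>y\<in>V. f y = ucoord y * g y" by simp
  next
    assume "\<exists>g\<in>reg (blowup C) V. \<forall>y\<in>V. f y = ucoord y * g y"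
    then obtain g where g: "\<forall>y\<in>V. f y = ucoord y * g y" by blast
    show "\<forall>y\<in>exceptional C p \<inter> V. f y = 0"
    proof
      fix y assume y: "y \<in> exceptional C p \<inter> V"
      then have "ucoord y = 0" using ucoord_zero_iff[of y] V(1) by (auto simp: exceptional_iff)
      then show "f y = 0" using g y by simp
    qed
  qed
qed

end

section \<open>Sections of line bundles and their coefficients\<close>

text \<open>The line bundle of the divisor class \<open>k E\<^sub>0 - (\<Sum>p\<in>C. m p E\<^sub>p)\<close>.\<close>

locale blowup_bundle = blowup_plane +
  fixes k :: nat and m :: "3 ppt \<Rightarrow> nat"
begin

text \<open>A frame is a local generator of the line bundle, and \<open>is_coef U fr s a\<close> says that \<open>a\<close> is the
  coefficient of the section \<open>s\<close> with respect to it.\<close>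

definition frame :: "bpt set \<Rightarrow> sec \<Rightarrow> bool" where
  "frame U fr \<longleftrightarrow> op U \<and> (\<exists>h t. (\<forall>y\<in>U. bproj y \<notin> zero_line h) \<and>
     (\<forall>p\<in>C. local_equation (blowup C) (exceptional C p) U (t p)) \<and>
     (\<forall>y v. fr y v = lin h v ^ k * (\<Prod>p\<in>C. t p y ^ m p)))"

definition is_coef :: "bpt set \<Rightarrow> sec \<Rightarrow> sec \<Rightarrow> (bpt \<Rightarrow> complex) \<Rightarrow> bool" where
  "is_coef U fr s a \<longleftrightarrow> a \<in> rg U \<and> (\<forall>y\<in>U. \<forall>v\<in>bproj y. s y v = a y * fr y v)"

lemma local_value_iff: "local_value C k m U s a \<longleftrightarrow> (\<exists>fr. frame U fr \<and> is_coef U fr s a)"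
proof
  assume "local_value C k m U s a"
  then obtain h t where *: "op U" "a \<in> rg U" "\<forall>y\<in>U. bproj y \<notin> zero_line h"
      "\<forall>p\<in>C. local_equation (blowup C) (exceptional C p) U (t p)"
      "\<forall>y\<in>U. \<forall>v\<in>bproj y. s y v = a y * (lin h v ^ k * (\<Prod>p\<in>C. t p y ^ m p))"
    unfolding local_value_def reg_blowup by blast
  show "\<exists>fr. frame U fr \<and> is_coef U fr s a"
  proof (intro exI conjI)
    show "frame U (\<lambda>y v. lin h v ^ k * (\<Prod>p\<in>C. t p y ^ m p))"
      unfolding frame_def using * by blast
    show "is_coef U (\<lambda>y v. lin h v ^ k * (\<Prod>p\<in>C. t p y ^ m p)) s a"
      unfolding is_coef_def using * by blast
  qed
next
  assume "\<exists>fr. frame U fr \<and> is_coef U fr s a"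
  then obtain fr h t where *: "op U" "a \<in> rg U" "\<forall>y\<in>U. bproj y \<notin> zero_line h"
      "\<forall>p\<in>C. local_equation (blowup C) (exceptional C p) U (t p)"
      "\<forall>y v. fr y v = lin h v ^ k * (\<Prod>p\<in>C. t p y ^ m p)"
      "\<forall>y\<in>U. \<forall>v\<in>bproj y. s y v = a y * fr y v"
    unfolding frame_def is_coef_def by blast
  show "local_value C k m U s a"
    unfolding local_value_def reg_blowup
    by (intro conjI exI[of _ h] exI[of _ t]) (use * in auto)
qed

lemma local_valueI:
  "x \<in> U \<Longrightarrow> frame U fr \<Longrightarrow> is_coef U fr s a \<Longrightarrow> \<exists>U a. x \<in> U \<and> local_value C k m U s a"
  using local_value_iff by blast

lemma frame_op: "frame U fr \<Longrightarrow> op U"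
  by (simp add: frame_def)

lemma lin_nonzero_off_line:
  assumes "L \<in> P2" "L \<notin> zero_line h" "v \<in> L" "v \<noteq> (\<lambda>_. 0)"
  shows "lin h v \<noteq> 0"
proof
  assume "lin h v = 0"
  then have "\<forall>w\<in>L. lin h w = 0"
    using P2_eq_cspan1[OF assms(1,3,4)] by (auto simp: cspan1_def lin_scale_right)
  then show False using assms(1,2) by (simp add: zero_line_def)
qed

lemma frame_nonzero:
  assumes fr: "frame U fr" and y: "y \<in> U" "bproj y \<notin> C" and v: "v \<in> bproj y" "v \<noteq> (\<lambda>_. 0)"
  shows "fr y v \<noteq> 0"
proof -
  obtain h t where *: "\<forall>y\<in>U. bproj y \<notin> zero_line h"
      "\<forall>p\<in>C. local_equation (blowup C) (exceptional C p) U (t p)"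
      "\<forall>y v. fr y v = lin h v ^ k * (\<Prod>p\<in>C. t p y ^ m p)"
    using fr unfolding frame_def by blast
  have yX: "y \<in> X" using op_subset[OF frame_op[OF fr]] y by blast
  have "lin h v \<noteq> 0"
    using lin_nonzero_off_line[OF bproj_P2[OF yX] _ v] * y by blast
  moreover have "t p y \<noteq> 0" if "p \<in> C" for p
    using local_equation_nonzero[OF _ frame_op[OF fr] that y(1), of "t p"] * that y by blast
  ultimately show ?thesis
    using * C_finite by simp
qed

text \<open>The unit is composed of the ratio of the two linear forms and of the units that relate the local
  equations.\<close>

lemma frame_compare:
  assumes fr1: "frame U1 fr1" and fr2: "frame U2 fr2"
  shows "\<exists>c\<in>rg (U1 \<inter> U2). \<forall>y\<in>U1 \<inter> U2. c y \<noteq> 0 \<and> (\<forall>v\<in>bproj y. fr1 y v = c y * fr2 y v)"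
proof -
  obtain h1 t1 where *: "\<forall>y\<in>U1. bproj y \<notin> zero_line h1"
      "\<forall>p\<in>C. local_equation (blowup C) (exceptional C p) U1 (t1 p)"
      "\<forall>y v. fr1 y v = lin h1 v ^ k * (\<Prod>p\<in>C. t1 p y ^ m p)"
    using fr1 unfolding frame_def by blast
  obtain h2 t2 where **: "\<forall>y\<in>U2. bproj y \<notin> zero_line h2"
      "\<forall>p\<in>C. local_equation (blowup C) (exceptional C p) U2 (t2 p)"
      "\<forall>y v. fr2 y v = lin h2 v ^ k * (\<Prod>p\<in>C. t2 p y ^ m p)"
    using fr2 unfolding frame_def by blast
  let ?N = "U1 \<inter> U2"
  have op: "op U1" "op U2" using fr1 fr2 frame_op by blast+
  have NX: "?N \<subseteq> X" using op_subset[OF op(1)] by blast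
  have "\<forall>p\<in>C. \<exists>g. g \<in> rg ?N \<and> (\<forall>y\<in>?N. t1 p y = t2 p y * g y \<and> g y \<noteq> 0)"
    using local_equation_unit[OF _ _ op] *(2) **(2) by blast
  from bchoice[OF this] obtain g where g: "\<And>p. p \<in> C \<Longrightarrow> g p \<in> rg ?N"
      "\<And>p y. p \<in> C \<Longrightarrow> y \<in> ?N \<Longrightarrow> t1 p y = t2 p y * g p y \<and> g p y \<noteq> 0"
    by blast
  define x where "x = (\<lambda>y. cv (G.rp y) None)"
  have x: "x y \<noteq> (\<lambda>_. 0)" "bproj y = cspan1 (x y)" "lin h1 (x y) \<noteq> 0" "lin h2 (x y) \<noteq> 0" if y: "y \<in> ?N" for y
  proof -
    have yX: "y \<in> X" using y NX by blast
    show x0: "x y \<noteq> (\<lambda>_. 0)" unfolding x_def using lift_comp[OF rp_lift[OF yX], of None] by blast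
    show b: "bproj y = cspan1 (x y)" unfolding x_def by (rule lift_bproj[OF yX rp_lift[OF yX]])
    have "x y \<in> bproj y" unfolding b by (rule cspan1_self)
    then show "lin h1 (x y) \<noteq> 0" "lin h2 (x y) \<noteq> 0"
      using lin_nonzero_off_line[OF bproj_P2[OF yX] _ _ x0] *(1) **(1) y by blast+
  qed
  define c where "c = (\<lambda>y. (lin h1 (x y) / lin h2 (x y)) ^ k * (\<Prod>p\<in>C. g p y ^ m p))"
  have "(\<lambda>y. lin h1 (x y) / lin h2 (x y)) \<in> rg ?N"
    unfolding x_def by (rule lin_ratio_regular[OF _ NX]) (use x in \<open>simp_all add: x_def\<close>)
  then have "c \<in> rg ?N"
    unfolding c_def by (intro G.rfun_mult G.rfun_power G.rfun_prod) (auto intro: g)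
  moreover have "c y \<noteq> 0 \<and> (\<forall>v\<in>bproj y. fr1 y v = c y * fr2 y v)" if y: "y \<in> ?N" for y
  proof
    show "c y \<noteq> 0" unfolding c_def using x[OF y] g(2)[OF _ y] C_finite by simp
    show "\<forall>v\<in>bproj y. fr1 y v = c y * fr2 y v"
    proof
      fix v assume "v \<in> bproj y"
      then obtain b where b: "v = (\<lambda>i. b * x y i)" using x(2)[OF y] by (auto simp: cspan1_def)
      have "(\<Prod>p\<in>C. t1 p y ^ m p) = (\<Prod>p\<in>C. t2 p y ^ m p) * (\<Prod>p\<in>C. g p y ^ m p)"
        unfolding prod.distrib[symmetric]
        by (rule prod.cong[OF refl]) (use g(2)[OF _ y] in \<open>simp add: power_mult_distrib\<close>)
      then show "fr1 y v = c y * fr2 y v"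
        using *(3) **(3) x(4)[OF y] unfolding b lin_scale_right c_def
        by (simp add: lin_scale_right power_mult_distrib power_divide)
    qed
  qed
  ultimately show ?thesis by blast
qed

lemma coef_unique:
  assumes fr: "frame U fr" and N: "op N" "N \<subseteq> U" and a: "is_coef N fr s a" and b: "is_coef N fr s b" and y: "y \<in> N"
  shows "a y = b y"
proof -
  have "a y - b y = 0"
  proof (rule regular_eq_zero[OF N(1) _ _ y, of "\<lambda>y. a y - b y"])
    show "(\<lambda>y. a y - b y) \<in> rg N"
      using a b unfolding is_coef_def by (intro G.rfun_diff) blast+
    fix z assume z: "z \<in> N" "bproj z \<notin> C"
    have "z \<in> X" using op_subset[OF N(1)] z by blast
    then obtain v where v: "v \<in> bproj z" "v \<noteq> (\<lambda>_. 0)"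
      using rep(1,2)[OF bproj_P2] by blast
    have "a z * fr z v = b z * fr z v"
      using a b z v unfolding is_coef_def by metis
    moreover have "fr z v \<noteq> 0"
      using frame_nonzero[OF fr _ z(2) v] z(1) N(2) by blast
    ultimately show "a z - b z = 0" by simp
  qed
  then show ?thesis by simp
qed

lemma is_coef_mono: "is_coef U fr s a \<Longrightarrow> N \<subseteq> U \<Longrightarrow> is_coef N fr s a"
  unfolding is_coef_def using rfun_mono by blast

lemma is_coef_change:
  assumes a: "is_coef U1 fr1 s a" and c: "c \<in> rg (U1 \<inter> U2)"
    "\<And>y v. y \<in> U1 \<inter> U2 \<Longrightarrow> v \<in> bproj y \<Longrightarrow> fr1 y v = c y * fr2 y v"
  shows "is_coef (U1 \<inter> U2) fr2 s (\<lambda>y. a y * c y)"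
  unfolding is_coef_def
proof (intro conjI ballI)
  have "a \<in> rg (U1 \<inter> U2)"
    using a unfolding is_coef_def by (meson Int_lower1 rfun_mono)
  then show "(\<lambda>y. a y * c y) \<in> rg (U1 \<inter> U2)" using c(1) by (rule G.rfun_mult)
  show "s y v = a y * c y * fr2 y v" if "y \<in> U1 \<inter> U2" "v \<in> bproj y" for y v
    using a that c(2)[OF that] unfolding is_coef_def by simp
qed

text \<open>The definition of a section provides coefficients for some frame near each point.  They are
  converted to the given frame and glued.\<close>

lemma coef_exists:
  assumes s: "s \<in> H0 C k m" and fr: "frame U fr"
  shows "\<exists>a. is_coef U fr s a"
proof -
  have U: "op U" by (rule frame_op[OF fr])
  have "\<exists>a\<in>rg U. \<forall>y\<in>U. \<forall>v\<in>bproj y. s y v = a y * fr y v"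
  proof (rule rg_glue[where Q = "\<lambda>y c. \<forall>v\<in>bproj y. s y v = c * fr y v"])
    show "U \<subseteq> X" by (rule op_subset[OF U])
    fix x assume x: "x \<in> U"
    then have "x \<in> X" using op_subset[OF U] by blast
    then obtain U' a' fr' where f': "x \<in> U'" "frame U' fr'" "is_coef U' fr' s a'"
      using s unfolding H0_def local_value_iff points_blowup by blast
    obtain c where c: "c \<in> rg (U' \<inter> U)" "\<And>y v. y \<in> U' \<inter> U \<Longrightarrow> v \<in> bproj y \<Longrightarrow> fr' y v = c y * fr y v"
      using frame_compare[OF f'(2) fr] by blast
    have ic: "is_coef (U' \<inter> U) fr s (\<lambda>y. a' y * c y)"
      by (rule is_coef_change[OF f'(3) c])
    have opn: "op (U' \<inter> U)" by (rule openin_Int[OF frame_op[OF f'(2)] U])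
    show "\<exists>N a. op N \<and> x \<in> N \<and> N \<subseteq> U \<and> a \<in> rg N \<and> (\<forall>y\<in>N. \<forall>v\<in>bproj y. s y v = a y * fr y v)"
      by (rule exI[of _ "U' \<inter> U"], rule exI[of _ "\<lambda>y. a' y * c y"])
        (use ic opn x f'(1) in \<open>simp add: is_coef_def\<close>)
  next
    fix N a b y assume N: "op N" "N \<subseteq> U" and ab: "a \<in> rg N" "b \<in> rg N"
      "\<And>z. z \<in> N \<Longrightarrow> (\<forall>v\<in>bproj z. s z v = a z * fr z v) \<and> (\<forall>v\<in>bproj z. s z v = b z * fr z v)" and y: "y \<in> N"
    have "is_coef N fr s a" "is_coef N fr s b"
      unfolding is_coef_def using ab by blast+
    then show "a y = b y" by (rule coef_unique[OF fr N _ _ y])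
  qed
  then show ?thesis unfolding is_coef_def by blast
qed

definition coef :: "bpt set \<Rightarrow> sec \<Rightarrow> sec \<Rightarrow> bpt \<Rightarrow> complex" where
  "coef U fr s = (SOME a. is_coef U fr s a)"

lemma coef: "s \<in> H0 C k m \<Longrightarrow> frame U fr \<Longrightarrow> is_coef U fr s (coef U fr s)"
  unfolding coef_def by (rule someI_ex[OF coef_exists])

lemma coef_eq: "s \<in> H0 C k m \<Longrightarrow> frame U fr \<Longrightarrow> op N \<Longrightarrow> N \<subseteq> U \<Longrightarrow> is_coef N fr s a \<Longrightarrow> y \<in> N \<Longrightarrow> coef U fr s y = a y"
  using coef_unique[of U fr N s "coef U fr s" a y] is_coef_mono[OF coef] by blast

lemma vanishes_iff:
  assumes s: "s \<in> H0 C k m" and fr: "frame U fr" and x: "x \<in> U"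
  shows "vanishes_at C k m s x \<longleftrightarrow> coef U fr s x = 0"
proof
  assume "coef U fr s x = 0"
  then show "vanishes_at C k m s x"
    unfolding vanishes_at_def local_value_iff using coef[OF s fr] fr x by blast
next
  assume "vanishes_at C k m s x"
  then obtain U' a' fr' where f': "x \<in> U'" "frame U' fr'" "is_coef U' fr' s a'" "a' x = 0"
    unfolding vanishes_at_def local_value_iff by blast
  obtain c where c: "c \<in> rg (U' \<inter> U)" "\<And>y v. y \<in> U' \<inter> U \<Longrightarrow> v \<in> bproj y \<Longrightarrow> fr' y v = c y * fr y v"
    using frame_compare[OF f'(2) fr] by blast
  have "is_coef (U' \<inter> U) fr s (\<lambda>y. a' y * c y)"
    by (rule is_coef_change[OF f'(3) c])
  then have "coef U fr s x = a' x * c x"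
    using coef_eq[OF s fr openin_Int[OF frame_op[OF f'(2)] frame_op[OF fr]] Int_lower2] f'(1) x by blast
  then show "coef U fr s x = 0" using f'(4) by simp
qed

lemma is_coef_linear:
  assumes "is_coef U fr s a" "is_coef U fr t b"
  shows "is_coef U fr (\<lambda>x v. c * s x v + t x v) (\<lambda>y. c * a y + b y)"
  unfolding is_coef_def
proof (intro conjI ballI)
  show "(\<lambda>y. c * a y + b y) \<in> rg U"
    using assms unfolding is_coef_def by (intro G.rfun_add G.rfun_mult G.rfun_const) blast+
  show "c * s y v + t y v = (c * a y + b y) * fr y v" if "y \<in> U" "v \<in> bproj y" for y v
    using assms that unfolding is_coef_def by (simp add: algebra_simps)
qed

lemma H0_linear:
  assumes s: "s \<in> H0 C k m" and t: "t \<in> H0 C k m"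
  shows "(\<lambda>x v. c * s x v + t x v) \<in> H0 C k m"
  unfolding H0_def points_blowup
proof (intro CollectI conjI ballI allI impI)
  fix x assume "x \<in> X"
  then obtain U fr where U: "x \<in> U" "frame U fr"
    using s unfolding H0_def local_value_iff points_blowup by blast
  have "is_coef U fr (\<lambda>x v. c * s x v + t x v) (\<lambda>y. c * coef U fr s y + coef U fr t y)"
    by (rule is_coef_linear[OF coef[OF s U(2)] coef[OF t U(2)]])
  then show "\<exists>U f. x \<in> U \<and> local_value C k m U (\<lambda>x v. c * s x v + t x v) f"
    unfolding local_value_iff using U by blast
qed (use s t in \<open>auto simp: H0_def\<close>)

lemma coef_linear:
  assumes s: "s \<in> H0 C k m" and t: "t \<in> H0 C k m" and fr: "frame U fr" and y: "y \<in> U"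
  shows "coef U fr (\<lambda>x v. c * s x v + t x v) y = c * coef U fr s y + coef U fr t y"
  by (rule coef_eq[OF H0_linear[OF s t] fr frame_op[OF fr] subset_refl
        is_coef_linear[OF coef[OF s fr] coef[OF t fr]] y])

text \<open>The functionals that form the image of \<open>x\<close> are the multiples of this one.\<close>

definition ev :: "bpt set \<Rightarrow> sec \<Rightarrow> bpt \<Rightarrow> sec \<Rightarrow> complex" where
  "ev U fr x = (\<lambda>s. if s \<in> H0 C k m then coef U fr s x else 0)"

lemma ev_dual: "frame U fr \<Longrightarrow> x \<in> U \<Longrightarrow> ev U fr x \<in> H0_dual C k m"
  unfolding H0_dual_def ev_def using H0_linear coef_linear by simp

lemma ev_regular:
  assumes "frame U fr"
  shows "(\<lambda>y. ev U fr y s) \<in> rg U"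
proof (cases "s \<in> H0 C k m")
  case True
  then show ?thesis using coef[OF True assms] by (simp add: ev_def is_coef_def)
next
  case False
  then show ?thesis using G.rfun_const[of 0] by (simp add: ev_def)
qed

text \<open>A functional that vanishes on the kernel of the evaluation is a multiple of it.\<close>

lemma linear_system_map_eq:
  assumes fr: "frame U fr" and x: "x \<in> U" and s0: "s0 \<in> H0 C k m" "\<not> vanishes_at C k m s0 x"
  shows "linear_system_map C k m x = cspan1 (ev U fr x)" "ev U fr x \<noteq> (\<lambda>_. 0)"
proof -
  let ?e = "ev U fr x"
  have e0: "?e s0 \<noteq> 0"
    using s0 vanishes_iff[OF s0(1) fr x] by (simp add: ev_def)
  then show "?e \<noteq> (\<lambda>_. 0)" by metis
  have ed: "?e \<in> H0_dual C k m" by (rule ev_dual[OF fr x])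
  have vi: "vanishes_at C k m s x \<longleftrightarrow> ?e s = 0" if "s \<in> H0 C k m" for s
    using vanishes_iff[OF that fr x] that by (simp add: ev_def)
  have "w \<in> linear_system_map C k m x \<longleftrightarrow> w \<in> cspan1 ?e" for w
  proof
    assume "w \<in> linear_system_map C k m x"
    then have w: "w \<in> H0_dual C k m" "\<And>s. s \<in> H0 C k m \<Longrightarrow> ?e s = 0 \<Longrightarrow> w s = 0"
      unfolding linear_system_map_def using vi by auto
    have "w s = w s0 / ?e s0 * ?e s" for s
    proof (cases "s \<in> H0 C k m")
      case True
      \<comment> \<open>The section \<open>s + ?c s0\<close> lies in the kernel.\<close>
      let ?c = "- (?e s / ?e s0)"
      have lin: "w' (\<lambda>x v. ?c * s0 x v + s x v) = ?c * w' s0 + w' s" if "w' \<in> H0_dual C k m" for w'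
        using that s0(1) True unfolding H0_dual_def by blast
      have "?e (\<lambda>x v. ?c * s0 x v + s x v) = 0"
        unfolding lin[OF ed] using e0 by simp
      then have "w (\<lambda>x v. ?c * s0 x v + s x v) = 0"
        by (rule w(2)[OF H0_linear[OF s0(1) True]])
      then have "?c * w s0 + w s = 0"
        using lin[OF w(1)] by simp
      then show ?thesis by (simp add: add_eq_0_iff)
    next
      case False
      then show ?thesis using w(1) by (simp add: H0_dual_def ev_def)
    qed
    then show "w \<in> cspan1 ?e" unfolding cspan1_def by blast
  next
    assume "w \<in> cspan1 ?e"
    then obtain c where c: "w = (\<lambda>s. c * ?e s)" by (auto simp: cspan1_def)
    have "w \<in> H0_dual C k m"
      using ed unfolding H0_dual_def c by (simp add: algebra_simps)
    then show "w \<in> linear_system_map C k m x"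
      unfolding linear_system_map_def using vi c by simp
  qed
  then show "linear_system_map C k m x = cspan1 ?e" by blast
qed

lemma frame_off_exceptional:
  "frame {y \<in> X. bproj y \<notin> C \<and> lin h (cv (G.rp y) None) \<noteq> 0} (\<lambda>y v. lin h v ^ k)" (is "frame ?U _")
proof -
  have "?U = {y \<in> X. bproj y \<notin> C} \<inter> {y \<in> X. lin h (cv (G.rp y) None) \<noteq> 0}" by blast
  then have U: "op ?U"
    using openin_Int[OF off_points_op[OF subset_refl] lin_nonzero_op[of None h]] by simp
  have "bproj y \<notin> zero_line h" if y: "y \<in> ?U" for y
  proof -
    have "cv (G.rp y) None \<in> bproj y"
      using lift_comp[OF rp_lift, of y None] y by (simp add: bproj_def)
    then show ?thesis using y unfolding zero_line_def by blast
  qed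
  moreover have "local_equation (blowup C) (exceptional C p) ?U (\<lambda>_. 1)" if "p \<in> C" for p
    by (rule local_equation_disjoint[OF U]) (use that in \<open>auto simp: exceptional_iff\<close>)
  ultimately show ?thesis
    unfolding frame_def using U by (intro conjI exI[of _ h] exI[of _ "\<lambda>_ _. 1"]) auto
qed

text \<open>Only the exceptional curve over \<open>p\<close> meets the chart, and \<open>u\<close> is its equation.\<close>

lemma frame_chart:
  assumes "blowup_chart C p e f g e' f' pv"
  shows "frame (blowup_chart.W C p g e') (\<lambda>y v. lin g v ^ k * blowup_chart.ucoord C f g y ^ m p)"
proof -
  interpret ch: blowup_chart C p e f g e' f' pv by (fact assms)
  define t where "t = (\<lambda>q. if q = p then ch.ucoord else (\<lambda>_. 1))"
  have "bproj y \<notin> zero_line g" if y: "y \<in> ch.W" for y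
  proof -
    have "cv (G.rp y) None \<in> bproj y"
      using lift_comp[OF rp_lift, of y None] y ch.W_X by (auto simp: bproj_def)
    then show ?thesis using y unfolding zero_line_def ch.W_def by blast
  qed
  moreover have "local_equation (blowup C) (exceptional C q) ch.W (t q)" if q: "q \<in> C" for q
  proof (cases "q = p")
    case True
    then show ?thesis using ch.local_equation_ucoord by (simp add: t_def)
  next
    case False
    have "exceptional C q \<inter> ch.W = {}"
      using q False by (auto simp: exceptional_iff ch.W_def)
    then show ?thesis using False local_equation_disjoint[OF ch.op_W] by (simp add: t_def)
  qed
  moreover have "(\<Prod>q\<in>C. t q y ^ m q) = ch.ucoord y ^ m p" for y
  proof -
    have "(\<Prod>q\<in>C. t q y ^ m q) = (\<Prod>q\<in>C. if q = p then ch.ucoord y ^ m q else 1)"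
      by (rule prod.cong) (auto simp: t_def)
    then show ?thesis using C_finite ch.p_C by simp
  qed
  ultimately show ?thesis
    unfolding frame_def using ch.op_W by (intro conjI exI[of _ g] exI[of _ t]) auto
qed

lemma frame_at: "x \<in> X \<Longrightarrow> \<exists>U fr. frame U fr \<and> x \<in> U"
proof (cases "bproj x \<in> C")
  case True
  assume x: "x \<in> X"
  obtain e f g e' f' pv where "blowup_chart C (bproj x) e f g e' f' pv" "x \<in> blowup_chart.W C (bproj x) g e'"
    using chart_at[OF x True refl] by blast
  then show ?thesis using frame_chart by blast
next
  case False
  assume x: "x \<in> X"
  have "cv (G.rp x) None \<noteq> (\<lambda>_. 0)" using lift_comp[OF rp_lift[OF x], of None] by blast
  then have "lin (\<lambda>i. cnj (cv (G.rp x) None i)) (cv (G.rp x) None) \<noteq> 0"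
    using lin_cnj_nonzero lin_commute by metis
  then show ?thesis using frame_off_exceptional x False by blast
qed

text \<open>A base point free linear system defines a morphism: locally it is lifted by evaluation in a
  frame.\<close>

lemma linear_system_morphism:
  assumes bpf: "\<And>x. x \<in> X \<Longrightarrow> \<exists>s\<in>H0 C k m. \<not> vanishes_at C k m s x"
    and S: "S \<subseteq> X" and T: "T \<subseteq> proj UNIV" and im: "linear_system_map C k m ` S \<subseteq> T"
  shows "morphism (blowup_sub C S) (proj_space T) (linear_system_map C k m)"
  unfolding blowup_sub_embedded proj_space_def
proof (rule morphism_by_local_lift[OF G.graded_forms_axioms graded_forms_proj _ T _ im])
  show "S \<subseteq> ambient" using S X_ambient by blast
  show "forms d \<subseteq> poly_funs" for d by (auto simp: forms_def)
  fix x assume x: "x \<in> S"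
  then obtain U fr where U: "frame U fr" "x \<in> U" using frame_at S by blast
  have UX: "U \<subseteq> X" by (rule op_subset[OF frame_op[OF U(1)]])
  have o: "openin (zar (embedded (mlift J) (multiforms J) S)) (U \<inter> S)"
    by (rule G.open_restrict[OF X_ambient S frame_op[OF U(1), unfolded blowup_embedded]])
  have l: "ev U fr y \<in> linear_system_map C k m y - {\<lambda>_. 0}" if y: "y \<in> U \<inter> S" for y
  proof -
    obtain s0 where s0: "s0 \<in> H0 C k m" "\<not> vanishes_at C k m s0 y" using bpf y S by blast
    have yU: "y \<in> U" using y by blast
    show ?thesis
      using linear_system_map_eq[OF U(1) yU s0] cspan1_self by blast
  qed
  have r: "(\<lambda>y. ev U fr y s) \<in> rg (U \<inter> S)" for s
    by (rule rfun_mono[OF ev_regular[OF U(1)] Int_lower1])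
  show "\<exists>U \<rho>. openin (zar (embedded (mlift J) (multiforms J) S)) U \<and> x \<in> U \<and>
      (\<forall>y\<in>U. \<rho> y \<in> linear_system_map C k m y - {\<lambda>_. 0}) \<and> (\<forall>s. (\<lambda>y. \<rho> y s) \<in> rg U)"
    by (rule exI[of _ "U \<inter> S"], rule exI[of _ "ev U fr"]) (use o l r x U(2) in blast)
qed

end

section \<open>The sections given by the products of all lines but one\<close>

lemma L2_subset_P2: "L2 d \<alpha> \<subseteq> P2"
  by (auto simp: L2_def)

lemma zero_line_iff:
  assumes "L \<in> P2" "v \<in> L" "v \<noteq> (\<lambda>_. 0)"
  shows "L \<in> zero_line a \<longleftrightarrow> lin a v = 0"
  using assms lin_scale_right P2_eq_cspan1[OF assms] by (auto simp: zero_line_def cspan1_def)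

locale arrangement =
  fixes d :: nat and \<alpha> :: "nat \<Rightarrow> 3 \<Rightarrow> complex"
  assumes arr: "line_arrangement d \<alpha>"
begin

lemma d_pos: "d \<ge> 1" and \<alpha>_nonzero: "i \<in> {1..d} \<Longrightarrow> \<alpha> i \<noteq> (\<lambda>_. 0)"
  and \<alpha>_distinct: "i \<in> {1..d} \<Longrightarrow> j \<in> {1..d} \<Longrightarrow> i \<noteq> j \<Longrightarrow> \<alpha> i \<noteq> (\<lambda>l. c * \<alpha> j l)"
  using arr unfolding line_arrangement_def by blast+

lemma crossp_\<alpha>_nonzero:
  assumes "i \<in> {1..d}" "j \<in> {1..d}" "i \<noteq> j"
  shows "crossp (\<alpha> i) (\<alpha> j) \<noteq> (\<lambda>_. 0)"
  using crossp_eq_0_imp[OF \<alpha>_nonzero[OF assms(1)]] \<alpha>_distinct[OF assms(2,1)] assms(3) by metis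

lemma intersection_point:
  assumes ij: "i \<in> {1..d}" "j \<in> {1..d}" "i \<noteq> j" and v: "lin (\<alpha> i) v = 0" "lin (\<alpha> j) v = 0"
  shows "\<exists>c. v = (\<lambda>l. c * crossp (\<alpha> i) (\<alpha> j) l)"
  using annihilator_eq_crossp[OF crossp_\<alpha>_nonzero[OF ij]] v lin_commute by metis

abbreviation I :: "3 ppt \<Rightarrow> nat set" where "I \<equiv> lines_through d \<alpha>"

lemma I_subset: "I p \<subseteq> {1..d}"
  by (auto simp: lines_through_def)

lemma I_finite: "finite (I p)"
  using I_subset finite_subset by blast

lemma L2_finite: "finite (L2 d \<alpha>)"
proof -
  have "L2 d \<alpha> \<subseteq> (\<lambda>(i, j). cspan1 (crossp (\<alpha> i) (\<alpha> j))) ` ({1..d} \<times> {1..d})"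
  proof
    fix p assume p: "p \<in> L2 d \<alpha>"
    then have pP: "p \<in> P2" and "\<not> card (I p) \<le> 1" by (auto simp: L2_def)
    then obtain i j where ij: "i \<in> I p" "j \<in> I p" "i \<noteq> j"
      using card_le_Suc0_iff_eq[OF I_finite] by auto
    then have r: "i \<in> {1..d}" "j \<in> {1..d}" using I_subset by blast+
    have "lin (\<alpha> i) (rep p) = 0" "lin (\<alpha> j) (rep p) = 0"
      using ij rep(1)[OF pP] by (auto simp: lines_through_def zero_line_def)
    then obtain c where c: "rep p = (\<lambda>l. c * crossp (\<alpha> i) (\<alpha> j) l)"
      using intersection_point[OF r ij(3)] by blast
    then have "c \<noteq> 0" using rep(2)[OF pP] by auto
    then have "p = cspan1 (crossp (\<alpha> i) (\<alpha> j))"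
      using rep(3)[OF pP] c cspan1_scale by metis
    then show "p \<in> (\<lambda>(i, j). cspan1 (crossp (\<alpha> i) (\<alpha> j))) ` ({1..d} \<times> {1..d})"
      using r by auto
  qed
  then show ?thesis by (rule finite_subset) simp
qed

sublocale blowup_bundle "L2 d \<alpha>" "d - 1" "mu d \<alpha>"
  by unfold_locales (rule L2_finite, rule L2_subset_P2)

abbreviation sections :: "sec set" where
  "sections \<equiv> H0 (L2 d \<alpha>) (d - 1) (mu d \<alpha>)"

abbreviation vanishes :: "sec \<Rightarrow> bpt \<Rightarrow> bool" where
  "vanishes \<equiv> vanishes_at (L2 d \<alpha>) (d - 1) (mu d \<alpha>)"

lemma I_iff: "p \<in> P2 \<Longrightarrow> v \<in> p \<Longrightarrow> v \<noteq> (\<lambda>_. 0) \<Longrightarrow> i \<in> I p \<longleftrightarrow> i \<in> {1..d} \<and> lin (\<alpha> i) v = 0"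
  unfolding lines_through_def using zero_line_iff by blast

definition lprod :: "nat \<Rightarrow> (3 \<Rightarrow> complex) \<Rightarrow> complex" where
  "lprod i v = (\<Prod>j\<in>{1..d} - {i}. lin (\<alpha> j) v)"

definition lsec :: "nat \<Rightarrow> sec" where
  "lsec i = (\<lambda>x v. if x \<in> X \<and> v \<in> bproj x then lprod i v else 0)"

lemma prod_common_factor:
  assumes "i \<in> {1..d}" "\<And>j. j \<in> {1..d} - {i} \<Longrightarrow> F j = G j * (c :: complex)"
  shows "(\<Prod>j\<in>{1..d} - {i}. F j) = (\<Prod>j\<in>{1..d} - {i}. G j) * c ^ (d - 1)"
proof -
  have "(\<Prod>j\<in>{1..d} - {i}. F j) = (\<Prod>j\<in>{1..d} - {i}. G j * c)"
    by (rule prod.cong) (use assms in auto)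
  also have "\<dots> = (\<Prod>j\<in>{1..d} - {i}. G j) * c ^ (d - 1)"
    unfolding prod.distrib using assms(1) by simp
  finally show ?thesis .
qed

lemma lsec_coef_off:
  assumes i: "i \<in> {1..d}"
  shows "is_coef {y \<in> X. bproj y \<notin> L2 d \<alpha> \<and> lin h (cv (G.rp y) None) \<noteq> 0} (\<lambda>y v. lin h v ^ (d - 1)) (lsec i)
    (\<lambda>y. \<Prod>j\<in>{1..d} - {i}. lin (\<alpha> j) (cv (G.rp y) None) / lin h (cv (G.rp y) None))"
    (is "is_coef ?U _ _ _")
  unfolding is_coef_def
proof (intro conjI ballI)
  have "(\<lambda>y. lin (\<alpha> j) (cv (G.rp y) None) / lin h (cv (G.rp y) None)) \<in> rg ?U" for j
    by (rule lin_ratio_regular) auto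
  then show "(\<lambda>y. \<Prod>j\<in>{1..d} - {i}. lin (\<alpha> j) (cv (G.rp y) None) / lin h (cv (G.rp y) None)) \<in> rg ?U"
    by (rule G.rfun_prod)
  fix y v assume y: "y \<in> ?U" and v: "v \<in> bproj y"
  have yX: "y \<in> X" using y by blast
  obtain b where b: "v = (\<lambda>l. b * cv (G.rp y) None l)"
    using v lift_bproj[OF yX rp_lift[OF yX]] by (auto simp: cspan1_def)
  have "lprod i v = (\<Prod>j\<in>{1..d} - {i}. lin (\<alpha> j) (cv (G.rp y) None) / lin h (cv (G.rp y) None)) * lin h v ^ (d - 1)"
    unfolding lprod_def
    by (rule prod_common_factor[OF i]) (use y in \<open>simp add: b lin_scale_right\<close>)
  then show "lsec i y v = (\<Prod>j\<in>{1..d} - {i}. lin (\<alpha> j) (cv (G.rp y) None) / lin h (cv (G.rp y) None)) * lin h v ^ (d - 1)"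
    using yX v by (simp add: lsec_def)
qed

end

locale arrangement_chart = arrangement +
  fixes p :: "3 ppt" and e f g e' f' pv :: "3 \<Rightarrow> complex"
  assumes chart: "blowup_chart (L2 d \<alpha>) p e f g e' f' pv"
begin

sublocale ch: blowup_chart "L2 d \<alpha>" p e f g e' f' pv by (fact chart)

text \<open>At the base point \<open>pv + u n\<close>, where \<open>n = f' - w e'\<close>, a form through \<open>p\<close> has the value \<open>u \<alpha>\<^sub>j(n)\<close>.
  Besides \<open>i\<close> there are \<open>mu d \<alpha> p\<close> lines through \<open>p\<close> if \<open>i\<close> is one of them, and one more
  otherwise, which accounts for the first factor.\<close>

definition lcoef :: "nat \<Rightarrow> complex \<Rightarrow> complex \<Rightarrow> complex" where
  "lcoef i u w = (if i \<in> I p then 1 else u) * (\<Prod>j\<in>{1..d} - {i}.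
     if j \<in> I p then lin (\<alpha> j) f' - w * lin (\<alpha> j) e'
     else lin (\<alpha> j) pv + u * (lin (\<alpha> j) f' - w * lin (\<alpha> j) e'))"

definition cframe :: sec where
  "cframe = (\<lambda>y v. lin g v ^ (d - 1) * ch.ucoord y ^ mu d \<alpha> p)"

lemma cframe: "frame ch.W cframe"
  unfolding cframe_def by (rule frame_chart[OF chart])

lemma I_p: "i \<in> I p \<longleftrightarrow> i \<in> {1..d} \<and> lin (\<alpha> i) pv = 0"
proof (rule I_iff)
  show "p \<in> P2" using ch.p_C C_P2 by blast
  show "pv \<in> p" using ch.p_span cspan1_self by simp
qed (rule ch.pv_nonzero)

lemma lsec_coef_chart:
  assumes i: "i \<in> {1..d}"
  shows "is_coef ch.W cframe (lsec i) (\<lambda>y. lcoef i (ch.ucoord y) (ch.wcoord y))"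
  unfolding is_coef_def
proof (intro conjI ballI)
  show "(\<lambda>y. lcoef i (ch.ucoord y) (ch.wcoord y)) \<in> rg ch.W"
    unfolding lcoef_def
  proof (intro G.rfun_mult G.rfun_prod)
    show "(\<lambda>y. if i \<in> I p then 1 else ch.ucoord y) \<in> rg ch.W"
      using ch.ucoord_regular G.rfun_const by (cases "i \<in> I p") simp_all
    fix j
    have 1: "(\<lambda>y. lin (\<alpha> j) f' - ch.wcoord y * lin (\<alpha> j) e') \<in> rg ch.W"
      by (intro G.rfun_diff G.rfun_mult G.rfun_const ch.wcoord_regular)
    moreover have "(\<lambda>y. lin (\<alpha> j) pv + ch.ucoord y * (lin (\<alpha> j) f' - ch.wcoord y * lin (\<alpha> j) e')) \<in> rg ch.W"
      by (intro G.rfun_add G.rfun_mult G.rfun_const ch.ucoord_regular 1)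
    ultimately show "(\<lambda>y. if j \<in> I p then lin (\<alpha> j) f' - ch.wcoord y * lin (\<alpha> j) e'
        else lin (\<alpha> j) pv + ch.ucoord y * (lin (\<alpha> j) f' - ch.wcoord y * lin (\<alpha> j) e')) \<in> rg ch.W"
      by (cases "j \<in> I p") simp_all
  qed
  fix y v assume y: "y \<in> ch.W" and v: "v \<in> bproj y"
  define u w where "u = ch.ucoord y" and "w = ch.wcoord y"
  obtain b where b: "v = (\<lambda>l. b * ch.base u w l)"
    using v ch.base_span[OF y] by (auto simp: cspan1_def u_def w_def)
  have gv: "lin g v = b" unfolding b lin_scale_right ch.lin_base by simp
  have av: "lin (\<alpha> j) v = (lin (\<alpha> j) pv + u * (lin (\<alpha> j) f' - w * lin (\<alpha> j) e')) * b" for j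
    unfolding b ch.base_def lin_simps by simp
  let ?G = "\<lambda>j. (if j \<in> I p then lin (\<alpha> j) f' - w * lin (\<alpha> j) e'
      else lin (\<alpha> j) pv + u * (lin (\<alpha> j) f' - w * lin (\<alpha> j) e'))"
  have "lprod i v = (\<Prod>j\<in>{1..d} - {i}. (if j \<in> I p then u else 1) * ?G j) * b ^ (d - 1)"
    unfolding lprod_def
    by (rule prod_common_factor[OF i]) (use I_p in \<open>auto simp: av\<close>)
  also have "(\<Prod>j\<in>{1..d} - {i}. (if j \<in> I p then u else 1) * ?G j) =
      (\<Prod>j\<in>{1..d} - {i}. if j \<in> I p then u else 1) * (\<Prod>j\<in>{1..d} - {i}. ?G j)"
    by (rule prod.distrib)
  also have "(\<Prod>j\<in>{1..d} - {i}. if j \<in> I p then u else 1) = u ^ card (I p - {i})"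
  proof -
    have "(\<Prod>j\<in>{1..d} - {i}. if j \<in> I p then u else 1) = (\<Prod>j\<in>({1..d} - {i}) \<inter> I p. u)"
      by (subst prod.inter_restrict) auto
    also have "({1..d} - {i}) \<inter> I p = I p - {i}"
      using I_subset by blast
    finally show ?thesis by simp
  qed
  also have "u ^ card (I p - {i}) = (if i \<in> I p then 1 else u) * u ^ mu d \<alpha> p"
  proof (cases "i \<in> I p")
    case True
    then show ?thesis by (simp add: mu_def I_finite)
  next
    case False
    have "card (I p) \<ge> 2" using ch.p_C by (simp add: L2_def)
    then have "card (I p) = Suc (mu d \<alpha> p)" by (simp add: mu_def)
    moreover have "I p - {i} = I p" using False by blast
    ultimately show ?thesis using False by simp
  qed
  finally have "lprod i v = lcoef i u w * cframe y v"
    unfolding lcoef_def cframe_def gv u_def[symmetric] by (simp only: mult_ac)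
  moreover have "lsec i y v = lprod i v"
    using y ch.W_X v by (auto simp: lsec_def)
  ultimately show "lsec i y v = lcoef i (ch.ucoord y) (ch.wcoord y) * cframe y v"
    unfolding u_def w_def by simp
qed

end

context arrangement
begin

lemma arrangement_chartI: "blowup_chart (L2 d \<alpha>) p e f g e' f' pv \<Longrightarrow> arrangement_chart d \<alpha> p e f g e' f' pv"
  by (intro arrangement_chart.intro arrangement_axioms arrangement_chart_axioms.intro)

lemma lsec_H0:
  assumes i: "i \<in> {1..d}"
  shows "lsec i \<in> sections"
  unfolding H0_def points_blowup
proof (intro CollectI conjI ballI allI impI)
  fix x assume x: "x \<in> X"
  show "\<exists>U a. x \<in> U \<and> local_value (L2 d \<alpha>) (d - 1) (mu d \<alpha>) U (lsec i) a"
  proof (cases "bproj x \<in> L2 d \<alpha>")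
    case True
    obtain e f g e' f' pv where ch: "blowup_chart (L2 d \<alpha>) (bproj x) e f g e' f' pv"
        "x \<in> blowup_chart.W (L2 d \<alpha>) (bproj x) g e'"
      using chart_at[OF x True refl] by blast
    interpret arrangement_chart d \<alpha> "bproj x" e f g e' f' pv by (rule arrangement_chartI[OF ch(1)])
    show ?thesis by (rule local_valueI[OF ch(2) cframe lsec_coef_chart[OF i]])
  next
    case False
    have "cv (G.rp x) None \<noteq> (\<lambda>_. 0)" using lift_comp[OF rp_lift[OF x], of None] by blast
    then have "lin (\<lambda>l. cnj (cv (G.rp x) None l)) (cv (G.rp x) None) \<noteq> 0"
      using lin_cnj_nonzero[of "cv (G.rp x) None"] by (simp only: lin_commute[of "cv (G.rp x) None"] not_False_eq_True)
    then show ?thesis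
      using x False by (intro local_valueI[OF _ frame_off_exceptional lsec_coef_off[OF i]]) simp
  qed
qed (auto simp: lsec_def)

lemma vanishes_iff_value:
  assumes s: "s \<in> sections" and x: "x \<in> X" "bproj x \<notin> L2 d \<alpha>" and v: "v \<in> bproj x" "v \<noteq> (\<lambda>_. 0)"
  shows "vanishes s x \<longleftrightarrow> s x v = 0"
proof -
  obtain U fr where U: "frame U fr" "x \<in> U" using frame_at[OF x(1)] by blast
  have "s x v = coef U fr s x * fr x v"
    using coef[OF s U(1)] U(2) v(1) unfolding is_coef_def by blast
  then show ?thesis
    using frame_nonzero[OF U x(2) v] vanishes_iff[OF s U] by simp
qed

text \<open>At a point of the exceptional curve over \<open>p\<close>, the value of \<open>l\<^sub>i\<close> is, up to a nonzero
  factor, the product of the slopes of the other lines through \<open>p\<close>, measured from the line that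
  belongs to the point.\<close>

lemma lsec_nonvanishing_exceptional:
  assumes x: "x \<in> X" "bproj x = p" "p \<in> L2 d \<alpha>" and i: "i \<in> I p"
    and other: "\<And>j. j \<in> I p - {i} \<Longrightarrow> \<alpha> j \<notin> x (Some p)"
  shows "\<not> vanishes (lsec i) x"
proof -
  obtain e f g e' f' pv where ch: "blowup_chart (L2 d \<alpha>) p e f g e' f' pv"
      "x \<in> blowup_chart.W (L2 d \<alpha>) p g e'" "blowup_chart.wcoord (L2 d \<alpha>) p e' f' x = 0"
      "e \<in> x (Some p)" "e \<noteq> (\<lambda>_. 0)"
    using chart_at[OF x(1,3,2)] by blast
  interpret arrangement_chart d \<alpha> p e f g e' f' pv by (rule arrangement_chartI[OF ch(1)])
  have id: "i \<in> {1..d}" using i I_subset by blast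
  have u0: "ch.ucoord x = 0" using ch.ucoord_zero_iff[OF ch(2)] x(2) by simp
  have "coef ch.W cframe (lsec i) x = lcoef i 0 0"
    using coef_eq[OF lsec_H0[OF id] cframe ch.op_W subset_refl lsec_coef_chart[OF id] ch(2)] u0 ch(3) by simp
  moreover have "lcoef i 0 0 \<noteq> 0"
  proof -
    have "(if j \<in> I p then lin (\<alpha> j) f' else lin (\<alpha> j) pv) \<noteq> 0" if j: "j \<in> {1..d} - {i}" for j
    proof (cases "j \<in> I p")
      case True
      have "lin (\<alpha> j) f' \<noteq> 0"
      proof
        assume "lin (\<alpha> j) f' = 0"
        then have "\<alpha> j = (\<lambda>l. lin (\<alpha> j) e' * e l)"
          using dual_basis_form[OF ch.basis, of "\<alpha> j"] True I_p[of j] by simp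
        moreover have "x (Some p) = cspan1 e"
          using P2_eq_cspan1[OF X_P2[OF x(1)] ch(4,5)] x(3) by blast
        ultimately have "\<alpha> j \<in> x (Some p)" unfolding cspan1_def by blast
        then show False using other True j by blast
      qed
      then show ?thesis using True by simp
    next
      case False
      then show ?thesis using I_p[of j] j by simp
    qed
    then have "(\<Prod>j\<in>{1..d} - {i}. if j \<in> I p then lin (\<alpha> j) f' else lin (\<alpha> j) pv) \<noteq> 0"
      by (simp only: prod_zero_iff finite_Diff finite_atLeastAtMost) blast
    moreover have "lcoef i 0 0 = (\<Prod>j\<in>{1..d} - {i}. if j \<in> I p then lin (\<alpha> j) f' else lin (\<alpha> j) pv)"
      by (simp only: lcoef_def i if_True mult_1_left mult_zero_left diff_zero add_0_right)
    ultimately show ?thesis by (simp only: not_False_eq_True)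
  qed
  ultimately show ?thesis using vanishes_iff[OF lsec_H0[OF id] cframe ch(2)] by simp
qed

text \<open>On an exceptional curve, take a line \<open>i\<close> through \<open>p\<close> whose strict transform contains the point, if
  there is one; elsewhere, a line that contains the point, if there is one.\<close>

lemma base_point_free:
  assumes x: "x \<in> X"
  shows "\<exists>s\<in>sections. \<not> vanishes s x"
proof (cases "bproj x \<in> L2 d \<alpha>")
  case True
  let ?p = "bproj x"
  have "\<exists>i\<in>I ?p. \<forall>j\<in>I ?p - {i}. \<alpha> j \<notin> x (Some ?p)"
  proof (cases "\<exists>i\<in>I ?p. \<alpha> i \<in> x (Some ?p)")
    case i: True
    then obtain i where i: "i \<in> I ?p" "\<alpha> i \<in> x (Some ?p)" by blast
    have id: "i \<in> {1..d}" using i I_subset by blast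
    have "x (Some ?p) = cspan1 (\<alpha> i)"
      using P2_eq_cspan1[OF X_P2[OF x] i(2) \<alpha>_nonzero[OF id]] True by blast
    then have "\<alpha> j \<notin> x (Some ?p)" if "j \<in> I ?p - {i}" for j
      using \<alpha>_distinct[of j i] that id I_subset unfolding cspan1_def by blast
    then show ?thesis using i(1) by blast
  next
    case False
    have "I ?p \<noteq> {}" using True by (auto simp: L2_def)
    then show ?thesis using False by blast
  qed
  then obtain i where i: "i \<in> I ?p" "\<And>j. j \<in> I ?p - {i} \<Longrightarrow> \<alpha> j \<notin> x (Some ?p)" by blast
  have id: "i \<in> {1..d}" using i I_subset by blast
  show ?thesis
    using lsec_nonvanishing_exceptional[OF x refl True i] lsec_H0[OF id] by blast
next
  case False
  have P: "bproj x \<in> P2" by (rule bproj_P2[OF x])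
  define v where "v = rep (bproj x)"
  have v: "v \<in> bproj x" "v \<noteq> (\<lambda>_. 0)" using rep(1,2)[OF P] by (simp_all add: v_def)
  have c: "card (I (bproj x)) \<le> 1" using False P by (auto simp: L2_def)
  obtain i where i: "i \<in> {1..d}" "I (bproj x) \<subseteq> {i}"
  proof (cases "I (bproj x) = {}")
    case True
    then show ?thesis using that[of 1] d_pos by simp
  next
    case False
    then obtain i where i: "i \<in> I (bproj x)" by blast
    then have "I (bproj x) \<subseteq> {i}" using card_le_Suc0_iff_eq[OF I_finite] c by auto
    then show ?thesis using that[of i] i I_subset by blast
  qed
  have "lin (\<alpha> j) v \<noteq> 0" if "j \<in> {1..d} - {i}" for j
    using that i(2) I_iff[OF P v, of j] by blast
  then have "lprod i v \<noteq> 0"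
    unfolding lprod_def by (simp only: prod_zero_iff finite_Diff finite_atLeastAtMost) blast
  then have "lsec i x v \<noteq> 0"
    using x v by (simp add: lsec_def)
  then show ?thesis
    using vanishes_iff_value[OF lsec_H0[OF i(1)] x False v] lsec_H0[OF i(1)] by blast
qed

lemma arr_map_eq:
  assumes "frame U fr" "x \<in> U"
  shows "arr_map d \<alpha> x = cspan1 (ev U fr x)" "ev U fr x \<noteq> (\<lambda>_. 0)" "ev U fr x \<in> arr_dual d \<alpha>"
proof -
  have "x \<in> X" using op_subset[OF frame_op] assms by blast
  then obtain s where s: "s \<in> sections" "\<not> vanishes s x"
    using base_point_free by blast
  show "arr_map d \<alpha> x = cspan1 (ev U fr x)" "ev U fr x \<noteq> (\<lambda>_. 0)"
    unfolding arr_map_def using linear_system_map_eq[OF assms s] by blast+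
  show "ev U fr x \<in> arr_dual d \<alpha>"
    unfolding arr_dual_def by (rule ev_dual[OF assms])
qed

lemma arr_map_in_proj: assumes "x \<in> X" shows "arr_map d \<alpha> x \<in> proj (arr_dual d \<alpha>)"
proof -
  obtain U fr where "frame U fr" "x \<in> U" using frame_at[OF assms] by blast
  note eq = arr_map_eq[OF this]
  show ?thesis
    unfolding proj_iff by (rule bexI[of _ "ev U fr x"], intro conjI) (fact eq)+
qed

lemma arr_map_restrict_morphism:
  assumes "S \<subseteq> X" "T \<subseteq> proj UNIV" "arr_map d \<alpha> ` S \<subseteq> T"
  shows "morphism (blowup_sub (L2 d \<alpha>) S) (proj_space T) (arr_map d \<alpha>)"
  unfolding arr_map_def
  by (rule linear_system_morphism[OF base_point_free assms(1,2) assms(3)[unfolded arr_map_def]])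

lemma arr_map_morphism:
  "morphism (blowup (L2 d \<alpha>)) (proj_space (proj (arr_dual d \<alpha>))) (arr_map d \<alpha>)"
  unfolding blowup_def
proof (rule arr_map_restrict_morphism)
  show "proj (arr_dual d \<alpha>) \<subseteq> proj UNIV" by (rule proj_mono) simp
  show "arr_map d \<alpha> ` X \<subseteq> proj (arr_dual d \<alpha>)" using arr_map_in_proj by (rule image_subsetI)
qed simp

end

section \<open>Points off the exceptional curves\<close>

context blowup_plane
begin

text \<open>A point off the exceptional curves is determined by its image in the plane.\<close>

definition off_lift :: "(3 \<Rightarrow> complex) \<Rightarrow> 3 ppt option \<times> 3 \<Rightarrow> complex" where
  "off_lift v = (\<lambda>(j, l). case j of None \<Rightarrow> v l | Some q \<Rightarrow> crossp (rep q) v l)"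

lemma off_lift_components: "cv (off_lift v) None = v" "cv (off_lift v) (Some q) = crossp (rep q) v"
  by (simp_all add: off_lift_def)

lemma crossp_rep_nonzero:
  assumes "q \<in> P2" "v \<noteq> (\<lambda>_. 0)" "cspan1 v \<noteq> q"
  shows "crossp (rep q) v \<noteq> (\<lambda>_. 0)"
proof
  assume "crossp (rep q) v = (\<lambda>_. 0)"
  then obtain c where c: "v = (\<lambda>l. c * rep q l)"
    using crossp_eq_0_imp[OF rep(2)[OF assms(1)]] by blast
  then have "c \<noteq> 0" using assms(2) by auto
  then have "cspan1 v = q" using c cspan1_scale[of c "rep q"] rep(3)[OF assms(1)] by simp
  then show False using assms(3) by blast
qed

lemma off_lift_in:
  assumes x: "x \<in> X" "bproj x \<notin> C" and v: "v \<in> bproj x" "v \<noteq> (\<lambda>_. 0)"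
  shows "off_lift v \<in> mlift J x"
proof -
  obtain z where z: "z \<in> mlift J x" using lift_exists[OF x(1)] by blast
  have b: "bproj x = cspan1 v" by (rule P2_eq_cspan1[OF bproj_P2[OF x(1)] v])
  have "cv (off_lift v) j \<in> x j - {\<lambda>_. 0}" if j: "j \<in> J" for j
  proof (cases j)
    case None
    then show ?thesis using v unfolding None off_lift_components by (simp add: bproj_def)
  next
    case (Some q)
    have q: "q \<in> C" "q \<in> P2" using j Some C_P2 by auto
    have nz: "crossp (rep q) v \<noteq> (\<lambda>_. 0)"
      using q x(2) b by (intro crossp_rep_nonzero v) auto
    have inc: "lin (cv z (Some q)) (rep q) = 0" "lin (cv z (Some q)) (cv z None) = 0"
      using lift_incident[OF x(1) z] q unfolding incident_def by blast+
    obtain c where c: "v = (\<lambda>l. c * cv z None l)"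
      using v(1) lift_bproj[OF x(1) z] by (auto simp: cspan1_def)
    have "lin (cv z (Some q)) v = 0" unfolding c lin_scale_right using inc by simp
    then obtain a where a: "cv z (Some q) = (\<lambda>l. a * crossp (rep q) v l)"
      using annihilator_eq_crossp[OF nz inc(1)] by blast
    then have "a \<noteq> 0" using lift_comp[OF z j] Some by auto
    then have "x (Some q) = cspan1 (crossp (rep q) v)"
      using lift_cspan1[OF x(1) z j] a Some cspan1_scale by metis
    then show ?thesis using nz cspan1_self unfolding Some off_lift_components by blast
  qed
  then show ?thesis unfolding mlift_def by blast
qed

lemma off_exists:
  assumes v: "v \<noteq> (\<lambda>_. 0)" "cspan1 v \<notin> C"
  shows "\<exists>x\<in>X. bproj x = cspan1 v"
proof -
  have nz: "cv (off_lift v) j \<noteq> (\<lambda>_. 0)" if j: "j \<in> J" for j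
  proof (cases j)
    case None
    then show ?thesis using v by (simp add: off_lift_def)
  next
    case (Some q)
    then have "q \<in> C" using j by auto
    then show ?thesis using Some C_P2 v off_lift_components crossp_rep_nonzero[of q v] by auto
  qed
  have inc: "incident (off_lift v)"
    unfolding incident_def off_lift_components by simp
  note x = pt_blowup[OF nz inc]
  have "bproj (pt (off_lift v)) = cspan1 v"
    using lift_bproj[OF x] unfolding off_lift_components by blast
  then show ?thesis using x by blast
qed

lemma mlift_scale:
  assumes "x \<in> X" "v \<in> mlift J x" "c \<noteq> 0"
  shows "(\<lambda>k. c * v k) \<in> mlift J x"
  unfolding mlift_def
proof (intro CollectI ballI)
  fix j assume j: "j \<in> J"
  have "(\<lambda>l. c * v (j, l)) \<in> x j"
    unfolding lift_cspan1[OF assms(1,2) j] cspan1_def by blast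
  moreover have "(\<lambda>l. c * v (j, l)) \<noteq> (\<lambda>_. 0)"
    using lift_comp[OF assms(2) j] assms(3) by (auto simp: fun_eq_iff)
  ultimately show "(\<lambda>l. c * v (j, l)) \<in> x j - {\<lambda>_. 0}" by blast
qed

end

context blowup_bundle
begin

text \<open>This holds for frames by definition.\<close>

lemma section_homogeneous:
  assumes s: "s \<in> H0 C k m" and x: "x \<in> X" and v: "v \<in> bproj x"
  shows "s x (\<lambda>l. c * v l) = c ^ k * s x v"
proof -
  obtain U fr where U: "frame U fr" "x \<in> U" using frame_at[OF x] by blast
  obtain h t where fr: "\<forall>y v. fr y v = lin h v ^ k * (\<Prod>p\<in>C. t p y ^ m p)"
    using U(1) unfolding frame_def by blast
  have e: "\<And>v. v \<in> bproj x \<Longrightarrow> s x v = coef U fr s x * fr x v"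
    using coef[OF s U(1)] U(2) unfolding is_coef_def by blast
  have "(\<lambda>l. c * v l) \<in> bproj x"
  proof -
    obtain w a where w: "bproj x = cspan1 w" "v = (\<lambda>l. a * w l)"
      using v bproj_P2[OF x] by (auto simp: P2_iff cspan1_def)
    then have "(\<lambda>l. c * v l) = (\<lambda>l. (c * a) * w l)" by (simp add: mult.assoc)
    then show ?thesis unfolding w(1) cspan1_iff by blast
  qed
  then show ?thesis
    using e[of v] e[of "\<lambda>l. c * v l"] v fr by (simp add: lin_scale_right power_mult_distrib)
qed

end

lemma cspan1_nonproportional:
  assumes w: "w \<noteq> (\<lambda>_. 0)" "w' \<noteq> (\<lambda>_. 0)" and eq: "\<And>s t. w s * w' t = w t * w' s"
  shows "cspan1 w = cspan1 w'"
proof -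
  obtain s where s: "w s \<noteq> 0" using w(1) by auto
  have "w' = (\<lambda>t. (w' s / w s) * w t)"
    using eq[of s] s by (auto simp: fun_eq_iff field_simps)
  moreover from this have "w' s / w s \<noteq> 0" using w(2) by (metis mult_zero_left)
  ultimately show ?thesis using cspan1_scale by metis
qed

lemma kernel_nonzero: "\<exists>v. v \<noteq> (\<lambda>_. 0) \<and> lin a v = 0"
proof (cases "a 1 = 0 \<and> a 2 = 0")
  case True
  then show ?thesis
    by (intro exI[of _ "\<lambda>l. if l = 1 then 1 else 0"]) (auto simp: lin_3 fun_eq_iff)
next
  case False
  then show ?thesis
    by (intro exI[of _ "\<lambda>l. if l = 1 then a 2 else if l = 2 then - a 1 else 0"])
      (auto simp: lin_3 fun_eq_iff forall_3)
qed

section \<open>Contraction of the lines\<close>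

context arrangement
begin

lemma lprod_scale: "i \<in> {1..d} \<Longrightarrow> lprod i (\<lambda>l. c * v l) = c ^ (d - 1) * lprod i v"
  unfolding lprod_def using prod_common_factor[of i "\<lambda>j. lin (\<alpha> j) (\<lambda>l. c * v l)" "\<lambda>j. lin (\<alpha> j) v" c]
  by (simp add: lin_scale_right mult.commute)

lemma lprod_nonzero:
  assumes P: "P \<in> P2" "P \<notin> L2 d \<alpha>" "v \<in> P" "v \<noteq> (\<lambda>_. 0)" and i: "i \<in> {1..d}" "P \<in> zero_line (\<alpha> i)"
  shows "lprod i v \<noteq> 0"
proof -
  have c: "card (I P) \<le> 1" using P by (auto simp: L2_def)
  have "i \<in> I P" using i by (simp add: lines_through_def)
  then have "j = i" if "j \<in> I P" for j
    using c that card_le_Suc0_iff_eq[OF I_finite] by auto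
  then have "lin (\<alpha> j) v \<noteq> 0" if "j \<in> {1..d} - {i}" for j
    using that I_iff[OF P(1,3,4), of j] by blast
  then show ?thesis
    unfolding lprod_def by (simp only: prod_zero_iff finite_Diff finite_atLeastAtMost) blast
qed

text \<open>In a dual basis that starts with \<open>\<alpha> i\<close>, the points \<open>b + t a\<close> run through the line \<open>i\<close> except
  for one point.\<close>

lemma line_parametrisation:
  assumes i: "i \<in> {1..d}" and db: "dual_basis (\<alpha> i) f g e' a b"
  shows line_parameter: "lin f (\<lambda>l. b l + t * a l) = t" "lin g (\<lambda>l. b l + t * a l) = 1"
    and line_lift_nonzero: "(\<lambda>l. b l + t * a l) \<noteq> (\<lambda>_. 0)"
    and line_point: "cspan1 (\<lambda>l. b l + t * a l) \<in> zero_line (\<alpha> i)"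
    and line_multiple_points_finite: "finite {t. cspan1 (\<lambda>l. b l + t * a l) \<in> L2 d \<alpha>}"
proof -
  have lx: "lin (\<alpha> i) (\<lambda>l. b l + t * a l) = 0" "lin f (\<lambda>l. b l + t * a l) = t"
      "lin g (\<lambda>l. b l + t * a l) = 1" for t
    using db unfolding lin_simps by (simp_all add: dual_basis_def)
  then show "lin f (\<lambda>l. b l + t * a l) = t" "lin g (\<lambda>l. b l + t * a l) = 1" by blast+
  show nz: "(\<lambda>l. b l + t * a l) \<noteq> (\<lambda>_. 0)" for t
    using lx(3)[of t] lin_zero(1)[of g] by (metis zero_neq_one)
  have "cspan1 (\<lambda>l. b l + t * a l) \<in> P2" using nz P2_iff by blast
  then show "cspan1 (\<lambda>l. b l + t * a l) \<in> zero_line (\<alpha> i)"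
    using zero_line_iff[OF _ cspan1_self nz] lx(1) by blast
  have "inj (\<lambda>t. cspan1 (\<lambda>l. b l + t * a l))"
  proof
    fix t t' assume "cspan1 (\<lambda>l. b l + t * a l) = cspan1 (\<lambda>l. b l + t' * a l)"
    then have "(\<lambda>l. b l + t * a l) \<in> cspan1 (\<lambda>l. b l + t' * a l)"
      using cspan1_self[of "\<lambda>l. b l + t * a l"] by simp
    then obtain c where c: "(\<lambda>l. b l + t * a l) = (\<lambda>l. c * (b l + t' * a l))" by (auto simp: cspan1_def)
    have "lin g (\<lambda>l. b l + t * a l) = c * lin g (\<lambda>l. b l + t' * a l)"
      "lin f (\<lambda>l. b l + t * a l) = c * lin f (\<lambda>l. b l + t' * a l)"
      unfolding c lin_scale_right by (rule refl)+
    then show "t = t'" unfolding lx by simp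
  qed
  from finite_vimageI[OF L2_finite this] show "finite {t. cspan1 (\<lambda>l. b l + t * a l) \<in> L2 d \<alpha>}"
    by (simp add: vimage_def)
qed

lemma line_dual_basis:
  assumes i: "i \<in> {1..d}"
  shows "\<exists>f g e' a b. dual_basis (\<alpha> i) f g e' a b"
  using kernel_nonzero[of "\<alpha> i"] dual_basis_exists[OF \<alpha>_nonzero[OF i]] by blast

text \<open>On the strict transform of the line \<open>i\<close>, the section \<open>l\<^sub>i\<close> has no zeros, also not on the
  exceptional curves; therefore the quotient of any section by it is regular along the curve.\<close>

lemma section_on_affine_line:
  assumes i: "i \<in> {1..d}" and s: "s \<in> sections" and db: "dual_basis (\<alpha> i) f g e' a b"
  shows "\<exists>P. \<forall>t x. x \<in> X \<longrightarrow> bproj x \<notin> L2 d \<alpha> \<longrightarrow> bproj x = cspan1 (\<lambda>l. b l + t * a l) \<longrightarrow>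
    s x (\<lambda>l. b l + t * a l) = poly P t * lprod i (\<lambda>l. b l + t * a l)"
proof -
  define xx where "xx = (\<lambda>t l. b l + t * a l)"
  have xnz: "xx t \<noteq> (\<lambda>_. 0)" and xL: "cspan1 (xx t) \<in> zero_line (\<alpha> i)" for t
    unfolding xx_def by (rule line_lift_nonzero[OF i db], rule line_point[OF i db])
  have lx: "lin (\<alpha> i) (xx t) = 0" for t
    using xL cspan1_self unfolding zero_line_def by blast
  define \<Lambda> where "\<Lambda> = (\<lambda>t (j, l). case j of None \<Rightarrow> xx t l
      | Some q \<Rightarrow> if q \<in> zero_line (\<alpha> i) then \<alpha> i l else crossp (rep q) (xx t) l)"
  have \<Lambda>: "cv (\<Lambda> t) None = xx t" "q \<in> zero_line (\<alpha> i) \<Longrightarrow> cv (\<Lambda> t) (Some q) = \<alpha> i"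
      "q \<notin> zero_line (\<alpha> i) \<Longrightarrow> cv (\<Lambda> t) (Some q) = crossp (rep q) (xx t)" for t q
    by (simp_all add: \<Lambda>_def)
  have inc: "incident (\<Lambda> t)" for t
    unfolding incident_def
  proof
    fix q assume q: "q \<in> L2 d \<alpha>"
    then have qP: "q \<in> P2" using L2_subset_P2 by blast
    show "lin (cv (\<Lambda> t) (Some q)) (rep q) = 0 \<and> lin (cv (\<Lambda> t) (Some q)) (cv (\<Lambda> t) None) = 0"
    proof (cases "q \<in> zero_line (\<alpha> i)")
      case True
      then show ?thesis
        using zero_line_iff[OF qP rep(1,2)[OF qP]] lx by (simp add: \<Lambda>)
    next
      case False
      then show ?thesis by (simp add: \<Lambda>)
    qed
  qed
  have nz: "cv (\<Lambda> t) j \<noteq> (\<lambda>_. 0)" if j: "j \<in> J" for t j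
  proof (cases j)
    case None
    then show ?thesis using xnz by (simp add: \<Lambda>)
  next
    case (Some q)
    have qP: "q \<in> P2" using j Some L2_subset_P2 by auto
    show ?thesis
    proof (cases "q \<in> zero_line (\<alpha> i)")
      case True
      then show ?thesis using \<alpha>_nonzero[OF i] Some by (simp add: \<Lambda>)
    next
      case False
      then have "cspan1 (xx t) \<noteq> q" using xL by blast
      then show ?thesis using False Some crossp_rep_nonzero[OF qP xnz] by (simp add: \<Lambda>)
    qed
  qed
  have poly_crossp: "\<exists>q. \<forall>t. crossp r (xx t) l = poly q t" for r l
  proof -
    have "crossp r (xx t) l = poly [:crossp r b l, crossp r a l:] t" for t
      by (simp add: crossp_def xx_def algebra_simps)
    then show ?thesis by blast
  qed
  have curve: "curve \<Lambda>"
    unfolding curve_def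
  proof (intro conjI allI inc)
    fix k :: "3 ppt option \<times> 3"
    obtain j l where k: "k = (j, l)" by (cases k)
    show "\<exists>q. \<forall>t. \<Lambda> t k = poly q t"
    proof (cases j)
      case None
      then show ?thesis unfolding k by (intro exI[of _ "[:b l, a l:]"]) (simp add: \<Lambda>_def xx_def)
    next
      case (Some q)
      show ?thesis
      proof (cases "q \<in> zero_line (\<alpha> i)")
        case True
        then show ?thesis unfolding k Some by (intro exI[of _ "[:\<alpha> i l:]"]) (simp add: \<Lambda>_def)
      next
        case False
        then show ?thesis unfolding k Some using poly_crossp by (simp add: \<Lambda>_def)
      qed
    qed
  qed
  define y where "y = (\<lambda>t. pt (\<Lambda> t))"
  have y: "y t \<in> X" "\<Lambda> t \<in> mlift J (y t)" for t
    unfolding y_def by (intro pt_blowup nz inc; assumption)+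
  have yb: "bproj (y t) = cspan1 (xx t)" for t
    using lift_bproj[OF y] \<Lambda>(1) by simp
  define B where "B = {t. cspan1 (xx t) \<in> L2 d \<alpha>}"
  have B: "finite B"
    unfolding B_def xx_def by (rule line_multiple_points_finite[OF i db])
  have nv: "\<not> vanishes (lsec i) (y t)" for t
  proof (cases "bproj (y t) \<in> L2 d \<alpha>")
    case True
    have iI: "i \<in> I (bproj (y t))" using i xL by (simp add: lines_through_def yb)
    have "y t (Some (bproj (y t))) = cspan1 (\<alpha> i)"
      using lift_cspan1[OF y, of "Some (bproj (y t))" t] True xL \<Lambda>(2) by (simp add: yb)
    moreover have "\<alpha> j \<notin> cspan1 (\<alpha> i)" if "j \<in> I (bproj (y t)) - {i}" for j
    proof -
      have "j \<in> {1..d}" "j \<noteq> i" using that I_subset by blast+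
      then show ?thesis using \<alpha>_distinct[of j i] i unfolding cspan1_def by blast
    qed
    ultimately show ?thesis
      by (intro lsec_nonvanishing_exceptional[OF y(1) refl True iI]) simp
  next
    case False
    have v: "xx t \<in> bproj (y t)" using cspan1_self by (simp add: yb)
    have "lprod i (xx t) \<noteq> 0"
      using lprod_nonzero[OF bproj_P2[OF y(1)] False v xnz i] xL by (simp add: yb)
    then have "lsec i (y t) (xx t) \<noteq> 0" using y v by (simp add: lsec_def)
    then show ?thesis using vanishes_iff_value[OF lsec_H0[OF i] y(1) False v xnz] by blast
  qed
  define r where "r = (\<lambda>t. s (y t) (xx t) / lprod i (xx t))"
  have "\<exists>P. \<forall>t. t \<notin> B \<longrightarrow> r t = poly P t"
  proof (rule locally_rational_imp_polynomial[OF B])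
    fix t0
    obtain U fr where U: "frame U fr" "y t0 \<in> U" using frame_at[OF y(1)] by blast
    have opU: "op U" by (rule frame_op[OF U(1)])
    have cs: "coef U fr s \<in> rg U" and cl: "coef U fr (lsec i) \<in> rg U"
      using coef[OF s U(1)] coef[OF lsec_H0[OF i] U(1)] by (simp_all add: is_coef_def)
    obtain F1 G1 B1 where 1: "finite B1" "t0 \<notin> B1" "poly G1 t0 \<noteq> 0"
      "\<And>t. t \<notin> B1 \<Longrightarrow> pt (\<Lambda> t) \<in> U \<and> \<Lambda> t \<in> mlift J (pt (\<Lambda> t)) \<and> poly G1 t \<noteq> 0 \<and>
         coef U fr s (pt (\<Lambda> t)) * poly G1 t = poly F1 t"
      using regular_on_curve[where \<Lambda> = \<Lambda> and N = U and ?t0.0 = t0, OF curve opU U(2) y(2) cs] by blast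
    obtain F2 G2 B2 where 2: "finite B2" "t0 \<notin> B2" "poly G2 t0 \<noteq> 0"
      "\<And>t. t \<notin> B2 \<Longrightarrow> pt (\<Lambda> t) \<in> U \<and> \<Lambda> t \<in> mlift J (pt (\<Lambda> t)) \<and> poly G2 t \<noteq> 0 \<and>
         coef U fr (lsec i) (pt (\<Lambda> t)) * poly G2 t = poly F2 t"
      using regular_on_curve[where \<Lambda> = \<Lambda> and N = U and ?t0.0 = t0, OF curve opU U(2) y(2) cl] by blast
    have "coef U fr (lsec i) (y t0) \<noteq> 0"
      using nv[of t0] vanishes_iff[OF lsec_H0[OF i] U] by blast
    then have F2: "poly F2 t0 \<noteq> 0"
      using 2(4)[OF 2(2)] by (auto simp: y_def)
    show "\<exists>F G B'. finite B' \<and> t0 \<notin> B' \<and> poly G t0 \<noteq> 0 \<and>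
        (\<forall>t. t \<notin> B \<longrightarrow> t \<notin> B' \<longrightarrow> r t * poly G t = poly F t)"
    proof (rule exI[of _ "F1 * G2"], rule exI[of _ "G1 * F2"], rule exI[of _ "B1 \<union> B2"], intro conjI allI impI)
      show "finite (B1 \<union> B2)" "t0 \<notin> B1 \<union> B2" using 1 2 by blast+
      show "poly (G1 * F2) t0 \<noteq> 0" using 1 F2 by simp
      fix t assume t: "t \<notin> B" "t \<notin> B1 \<union> B2"
      have yU: "y t \<in> U" using 1(4)[of t] t by (simp add: y_def)
      have off: "bproj (y t) \<notin> L2 d \<alpha>" using t(1) by (simp add: B_def yb)
      have v: "xx t \<in> bproj (y t)" using cspan1_self by (simp add: yb)
      have frn: "fr (y t) (xx t) \<noteq> 0" by (rule frame_nonzero[OF U(1) yU off v xnz])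
      have ln: "lprod i (xx t) \<noteq> 0"
        using lprod_nonzero[OF bproj_P2[OF y(1)] off v xnz i] xL by (simp add: yb)
      have e1: "s (y t) (xx t) = coef U fr s (y t) * fr (y t) (xx t)"
        using coef[OF s U(1)] yU v unfolding is_coef_def by blast
      have "lsec i (y t) (xx t) = coef U fr (lsec i) (y t) * fr (y t) (xx t)"
        using coef[OF lsec_H0[OF i] U(1)] yU v unfolding is_coef_def by blast
      then have e2: "lprod i (xx t) = coef U fr (lsec i) (y t) * fr (y t) (xx t)"
        using y(1) v by (simp add: lsec_def)
      have cn: "coef U fr (lsec i) (y t) \<noteq> 0" using ln e2 by auto
      have rt: "r t = coef U fr s (y t) / coef U fr (lsec i) (y t)"
        unfolding r_def e1 e2 using frn by simp
      have F: "poly F1 t = coef U fr s (y t) * poly G1 t" "poly F2 t = coef U fr (lsec i) (y t) * poly G2 t"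
        using 1(4)[of t] 2(4)[of t] t by (simp_all add: y_def)
      show "r t * poly (G1 * F2) t = poly (F1 * G2) t"
        unfolding poly_mult rt F using cn by simp
    qed
  qed
  then obtain P where P: "\<And>t. t \<notin> B \<Longrightarrow> r t = poly P t" by blast
  have "s x (xx t) = poly P t * lprod i (xx t)" if x: "x \<in> X" "bproj x \<notin> L2 d \<alpha>" "bproj x = cspan1 (xx t)" for t x
  proof -
    have v: "xx t \<in> bproj x" using x cspan1_self by simp
    have off: "bproj (y t) \<notin> L2 d \<alpha>" "xx t \<in> bproj (y t)" using x cspan1_self by (simp_all add: yb)
    have "x = pt (off_lift (xx t))" by (rule pt_unique[OF x(1) off_lift_in[OF x(1,2) v xnz]])
    moreover have "y t = pt (off_lift (xx t))" by (rule pt_unique[OF y(1) off_lift_in[OF y(1) off xnz]])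
    ultimately have "x = y t" by simp
    moreover have "t \<notin> B" using x by (simp add: B_def)
    moreover have "lprod i (xx t) \<noteq> 0"
      using lprod_nonzero[OF bproj_P2[OF x(1)] x(2) v xnz i] xL x by simp
    ultimately show ?thesis using P[of t] by (simp add: r_def field_simps)
  qed
  then show ?thesis unfolding xx_def by blast
qed

text \<open>The quotient of \<open>s\<close> by \<open>l\<^sub>i\<close> is a polynomial in \<open>t\<close> and, in the other chart of the line, in
  \<open>1/t\<close>; so it is constant.\<close>

lemma section_proportional_on_line:
  assumes i: "i \<in> {1..d}" and s: "s \<in> sections"
  shows "\<exists>c. \<forall>x\<in>X. bproj x \<in> zero_line (\<alpha> i) - L2 d \<alpha> \<longrightarrow> (\<forall>v\<in>bproj x. s x v = c * lprod i v)"
proof -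
  obtain f g e' a b0 where db: "dual_basis (\<alpha> i) f g e' a b0"
    using line_dual_basis[OF i] by blast
  then have db': "dual_basis (\<alpha> i) g f e' b0 a" by (simp add: dual_basis_def)
  obtain P where P: "\<And>t x. x \<in> X \<Longrightarrow> bproj x \<notin> L2 d \<alpha> \<Longrightarrow> bproj x = cspan1 (\<lambda>l. b0 l + t * a l) \<Longrightarrow>
      s x (\<lambda>l. b0 l + t * a l) = poly P t * lprod i (\<lambda>l. b0 l + t * a l)"
    using section_on_affine_line[OF i s db] by blast
  obtain Q where Q: "\<And>t x. x \<in> X \<Longrightarrow> bproj x \<notin> L2 d \<alpha> \<Longrightarrow> bproj x = cspan1 (\<lambda>l. a l + t * b0 l) \<Longrightarrow>
      s x (\<lambda>l. a l + t * b0 l) = poly Q t * lprod i (\<lambda>l. a l + t * b0 l)"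
    using section_on_affine_line[OF i s db'] by blast
  define xx where "xx = (\<lambda>t l. b0 l + t * a l)"
  have xnz: "xx t \<noteq> (\<lambda>_. 0)" and xL: "cspan1 (xx t) \<in> zero_line (\<alpha> i)" for t
    unfolding xx_def by (rule line_lift_nonzero[OF i db], rule line_point[OF i db])
  define B where "B = {t. cspan1 (xx t) \<in> L2 d \<alpha>}"
  have B: "finite B"
    unfolding B_def xx_def by (rule line_multiple_points_finite[OF i db])
  have rel: "poly P t = poly Q (inverse t)" if t: "t \<notin> B" "t \<noteq> 0" for t
  proof -
    obtain x where x: "x \<in> X" "bproj x = cspan1 (xx t)"
      using off_exists[OF xnz] t by (auto simp: B_def)
    have off: "bproj x \<notin> L2 d \<alpha>" using x t by (simp add: B_def)
    have xt: "xx t = (\<lambda>l. t * (a l + inverse t * b0 l))" using t by (simp add: xx_def fun_eq_iff field_simps)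
    have bx: "bproj x = cspan1 (\<lambda>l. a l + inverse t * b0 l)"
      unfolding x(2) xt by (rule cspan1_scale[OF t(2)])
    then have v: "(\<lambda>l. a l + inverse t * b0 l) \<in> bproj x" using cspan1_self by simp
    have "poly P t * lprod i (xx t) = s x (xx t)"
      using P[OF x(1) off] x(2) by (simp add: xx_def)
    also have "\<dots> = t ^ (d - 1) * s x (\<lambda>l. a l + inverse t * b0 l)"
      unfolding xt by (rule section_homogeneous[OF s x(1) v])
    also have "\<dots> = t ^ (d - 1) * (poly Q (inverse t) * lprod i (\<lambda>l. a l + inverse t * b0 l))"
      using Q[OF x(1) off bx] by simp
    also have "\<dots> = poly Q (inverse t) * lprod i (xx t)"
      unfolding xt lprod_scale[OF i] by simp
    finally have "poly P t * lprod i (xx t) = poly Q (inverse t) * lprod i (xx t)" .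
    moreover have "lprod i (xx t) \<noteq> 0"
    proof (rule lprod_nonzero[OF bproj_P2[OF x(1)] off _ xnz i])
      show v': "xx t \<in> bproj x" using x cspan1_self by simp
      show "bproj x \<in> zero_line (\<alpha> i)" using x(2) xL by simp
    qed
    ultimately show ?thesis by simp
  qed
  define c where "c = coeff Q 0"
  have P0: "degree P \<le> 0" "coeff P 0 = c"
    using polynomial_at_infinity[OF B, of P 1 0 Q] rel unfolding c_def by auto
  then have Pc: "poly P t = c" for t
    by (metis degree_eq_zeroE le_zero_eq coeff_pCons_0 poly_pCons mult_zero_right poly_0 add_0_right)
  have Qc: "poly Q 0 = c" by (simp add: c_def poly_0_coeff_0)
  have "s x v = c * lprod i v" if x: "x \<in> X" "bproj x \<in> zero_line (\<alpha> i) - L2 d \<alpha>" and v: "v \<in> bproj x" for x v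
  proof -
    have nzcase: "s x v = c * lprod i v" if vn: "v \<noteq> (\<lambda>_. 0)" and v: "v \<in> bproj x" for v
    proof -
      have bx: "bproj x = cspan1 v" by (rule P2_eq_cspan1[OF bproj_P2[OF x(1)] v vn])
      have off: "bproj x \<notin> L2 d \<alpha>" using x by blast
      have "lin (\<alpha> i) v = 0" using zero_line_iff[OF bproj_P2[OF x(1)] v vn] x by blast
      then have dec: "v = (\<lambda>l. lin f v * a l + lin g v * b0 l)"
        using dual_basis_vec[OF db, of v] by simp
      show ?thesis
      proof (cases "lin g v = 0")
        case False
        define t where "t = lin f v / lin g v"
        have vt: "v = (\<lambda>l. lin g v * xx t l)"
          using fun_cong[OF dec] False by (auto simp: fun_eq_iff xx_def t_def field_simps)
        have bx': "bproj x = cspan1 (xx t)" unfolding bx by (subst vt) (rule cspan1_scale[OF False])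
        then have v': "xx t \<in> bproj x" using cspan1_self by simp
        have "s x v = lin g v ^ (d - 1) * s x (xx t)"
          by (subst vt) (rule section_homogeneous[OF s x(1) v'])
        also have "s x (xx t) = c * lprod i (xx t)"
          using P[OF x(1) off, of t] bx' Pc by (simp add: xx_def)
        also have "lin g v ^ (d - 1) * (c * lprod i (xx t)) = c * lprod i v"
          by (subst (2) vt) (simp add: lprod_scale[OF i])
        finally show ?thesis .
      next
        case True
        then have vt: "v = (\<lambda>l. lin f v * a l)" using dec by simp
        then have fn: "lin f v \<noteq> 0" using vn by (metis mult_zero_left)
        have bx': "bproj x = cspan1 a" unfolding bx by (subst vt) (rule cspan1_scale[OF fn])
        then have v': "a \<in> bproj x" using cspan1_self by simp
        have "s x v = lin f v ^ (d - 1) * s x a"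
          by (subst vt) (rule section_homogeneous[OF s x(1) v'])
        also have "s x a = c * lprod i a"
          using Q[OF x(1) off, of 0] bx' Qc by simp
        also have "lin f v ^ (d - 1) * (c * lprod i a) = c * lprod i v"
          by (subst (2) vt) (simp add: lprod_scale[OF i])
        finally show ?thesis .
      qed
    qed
    show ?thesis
    proof (cases "v = (\<lambda>_. 0)")
      case True
      define w where "w = rep (bproj x)"
      have w: "w \<in> bproj x" "w \<noteq> (\<lambda>_. 0)" using rep(1,2)[OF bproj_P2[OF x(1)]] by (simp_all add: w_def)
      have v0: "v = (\<lambda>l. 0 * w l)" using True by simp
      have "s x v = 0 ^ (d - 1) * s x w" unfolding v0 by (rule section_homogeneous[OF s x(1) w(1)])
      also have "\<dots> = c * lprod i v" unfolding v0 lprod_scale[OF i] nzcase[OF w(2,1)] by simp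
      finally show ?thesis .
    qed (use nzcase v in blast)
  qed
  then show ?thesis by blast
qed

text \<open>A point of a projective space is the common zero set of the minors \<open>w(s) w'(t) - w(t) w'(s)\<close>.\<close>

lemma closed_fibre:
  assumes q: "q \<in> proj (arr_dual d \<alpha>)"
  shows "closedin (zar (blowup (L2 d \<alpha>))) {x \<in> X. arr_map d \<alpha> x = q}"
proof -
  obtain w where w: "w \<noteq> (\<lambda>_. 0)" "q = cspan1 w" using q by (auto simp: proj_iff)
  have "op {x \<in> X. arr_map d \<alpha> x \<noteq> q}"
  proof (subst openin_subopen, intro ballI)
    fix x assume x: "x \<in> {x \<in> X. arr_map d \<alpha> x \<noteq> q}"
    obtain U fr where U: "frame U fr" "x \<in> U" using frame_at x by blast
    have "\<exists>s t. w s * ev U fr x t \<noteq> w t * ev U fr x s"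
    proof (rule ccontr)
      assume "\<not> (\<exists>s t. w s * ev U fr x t \<noteq> w t * ev U fr x s)"
      then have "cspan1 w = cspan1 (ev U fr x)"
        by (intro cspan1_nonproportional w arr_map_eq(2)[OF U]) blast
      then show False using x w arr_map_eq(1)[OF U] by simp
    qed
    then obtain s t where st: "w s * ev U fr x t \<noteq> w t * ev U fr x s" by blast
    define N where "N = {y \<in> U. w s * ev U fr y t - w t * ev U fr y s \<noteq> 0}"
    have "(\<lambda>y. w s * ev U fr y t - w t * ev U fr y s) \<in> rg U"
      by (intro G.rfun_diff G.rfun_mult G.rfun_const ev_regular U)
    then have opN: "op N" unfolding N_def by (rule op_nonzero[OF frame_op[OF U(1)]])
    have "arr_map d \<alpha> y \<noteq> q" if y: "y \<in> N" for y
    proof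
      assume "arr_map d \<alpha> y = q"
      moreover have yU: "y \<in> U" using y by (simp add: N_def)
      ultimately have "ev U fr y \<in> cspan1 w"
        using arr_map_eq(1)[OF U(1) yU] w cspan1_self[of "ev U fr y"] by simp
      then show False using y by (auto simp: N_def cspan1_def)
    qed
    then have "N \<subseteq> {x \<in> X. arr_map d \<alpha> x \<noteq> q}"
      using op_subset[OF opN] by blast
    moreover have "x \<in> N" using U(2) st by (simp add: N_def)
    ultimately show "\<exists>T. op T \<and> x \<in> T \<and> T \<subseteq> {x \<in> X. arr_map d \<alpha> x \<noteq> q}"
      using opN by (intro exI[of _ N] conjI)
  qed
  moreover have "X - {x \<in> X. arr_map d \<alpha> x = q} = {x \<in> X. arr_map d \<alpha> x \<noteq> q}" by blast
  ultimately show ?thesis unfolding closedin_def by simp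
qed

theorem line_contracted:
  assumes i: "i \<in> {1..d}"
  shows "\<exists>q\<in>proj (arr_dual d \<alpha>). arr_map d \<alpha> ` strict_transform (L2 d \<alpha>) (zero_line (\<alpha> i)) = {q}"
proof -
  define A where "A = {x \<in> X. bproj x \<in> zero_line (\<alpha> i) - L2 d \<alpha>}"
  \<comment> \<open>The right-hand side is the same for all \<open>x \<in> A\<close>: \<open>s\<close> vanishes at \<open>x\<close> iff its constant is \<open>0\<close>.\<close>
  have const: "arr_map d \<alpha> x = {w \<in> H0_dual (L2 d \<alpha>) (d - 1) (mu d \<alpha>). \<forall>s\<in>sections.
      (\<forall>c. (\<forall>x\<in>X. bproj x \<in> zero_line (\<alpha> i) - L2 d \<alpha> \<longrightarrow> (\<forall>v\<in>bproj x. s x v = c * lprod i v)) \<longrightarrow> c = 0)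
      \<longrightarrow> w s = 0}" if x: "x \<in> A" for x
  proof -
    have xX: "x \<in> X" and off: "bproj x \<notin> L2 d \<alpha>" and L: "bproj x \<in> zero_line (\<alpha> i)"
      using x by (auto simp: A_def)
    define v where "v = rep (bproj x)"
    have v: "v \<in> bproj x" "v \<noteq> (\<lambda>_. 0)" using rep(1,2)[OF bproj_P2[OF xX]] by (simp_all add: v_def)
    have ln: "lprod i v \<noteq> 0" by (rule lprod_nonzero[OF bproj_P2[OF xX] off v i L])
    have "vanishes s x \<longleftrightarrow>
      (\<forall>c. (\<forall>x\<in>X. bproj x \<in> zero_line (\<alpha> i) - L2 d \<alpha> \<longrightarrow> (\<forall>v\<in>bproj x. s x v = c * lprod i v)) \<longrightarrow> c = 0)"
      if s: "s \<in> sections" for s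
    proof -
      obtain c where c: "\<forall>x\<in>X. bproj x \<in> zero_line (\<alpha> i) - L2 d \<alpha> \<longrightarrow> (\<forall>v\<in>bproj x. s x v = c * lprod i v)"
        using section_proportional_on_line[OF i s] by blast
      have val: "s x v = c' * lprod i v"
        if "\<forall>x\<in>X. bproj x \<in> zero_line (\<alpha> i) - L2 d \<alpha> \<longrightarrow> (\<forall>v\<in>bproj x. s x v = c' * lprod i v)" for c'
        using that xX off L v by blast
      show ?thesis
        unfolding vanishes_iff_value[OF s xX off v] using val c ln by fastforce
    qed
    then show ?thesis unfolding arr_map_def linear_system_map_def by blast
  qed
  have "\<exists>x. x \<in> A"
  proof -
    obtain f g e' a b where db: "dual_basis (\<alpha> i) f g e' a b"
      using line_dual_basis[OF i] by blast
    obtain t where "cspan1 (\<lambda>l. b l + t * a l) \<notin> L2 d \<alpha>"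
      using line_multiple_points_finite[OF i db] infinite_UNIV_char_0 ex_new_if_finite by blast
    then obtain x where "x \<in> X" "bproj x = cspan1 (\<lambda>l. b l + t * a l)" "bproj x \<notin> L2 d \<alpha>"
      using off_exists[OF line_lift_nonzero[OF i db]] by metis
    then show ?thesis using line_point[OF i db, of t] by (auto simp: A_def)
  qed
  then obtain x0 where x0: "x0 \<in> A" by blast
  define q where "q = arr_map d \<alpha> x0"
  have qp: "q \<in> proj (arr_dual d \<alpha>)" unfolding q_def using x0 by (intro arr_map_in_proj) (simp add: A_def)
  have st: "strict_transform (L2 d \<alpha>) (zero_line (\<alpha> i)) = zar (blowup (L2 d \<alpha>)) closure_of A"
    by (simp add: strict_transform_def A_def)
  have "A \<subseteq> {x \<in> X. arr_map d \<alpha> x = q}"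
    using const const[OF x0] unfolding q_def by (auto simp: A_def)
  then have "zar (blowup (L2 d \<alpha>)) closure_of A \<subseteq> {x \<in> X. arr_map d \<alpha> x = q}"
    by (rule closure_of_minimal[OF _ closed_fibre[OF qp]])
  moreover have "A \<subseteq> zar (blowup (L2 d \<alpha>)) closure_of A"
    by (rule closure_of_subset) (auto simp: A_def)
  ultimately have "arr_map d \<alpha> ` strict_transform (L2 d \<alpha>) (zero_line (\<alpha> i)) = {q}"
    unfolding st using x0 by blast
  then show ?thesis using qp by blast
qed

end

section \<open>The complement of the lines\<close>

lemma cramer:
  "(\<lambda>l. lin a v * crossp b c l + lin b v * crossp c a l + lin c v * crossp a b l) =
   (\<lambda>l. lin c (crossp a b) * v l)"
  unfolding vec3_eq_iff lin_3 crossp_components by (intro conjI) (simp_all only: algebra_simps)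

lemma forms_add: "F \<in> forms e \<Longrightarrow> G \<in> forms e \<Longrightarrow> (\<lambda>w. F w + G w) \<in> forms e"
  by (simp add: forms_def poly_funs.add distrib_left)

lemma forms_scale: "F \<in> forms e \<Longrightarrow> (\<lambda>w. c * F w) \<in> forms e"
  by (simp add: forms_def poly_funs.mult poly_funs.const)

lemma forms_diff: "F \<in> forms e \<Longrightarrow> G \<in> forms e \<Longrightarrow> (\<lambda>w. F w - G w) \<in> forms e"
  using forms_add[of F e "\<lambda>w. -1 * G w"] forms_scale[of G e "-1"] by simp

lemma forms_quadratic: "(\<lambda>w. w s * w t) \<in> forms 2"
  by (simp add: forms_def poly_funs.mult poly_funs.coord power2_eq_square)

context arrangement
begin

lemma L2_subset_arr_union: "L2 d \<alpha> \<subseteq> arr_union d \<alpha>"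
proof
  fix p assume "p \<in> L2 d \<alpha>"
  then have "I p \<noteq> {}" by (auto simp: L2_def)
  then show "p \<in> arr_union d \<alpha>" by (auto simp: lines_through_def arr_union_def)
qed

lemma compl_preimage_iff: "x \<in> compl_preimage d \<alpha> \<longleftrightarrow> x \<in> X \<and> bproj x \<in> P2 - arr_union d \<alpha>"
  by (simp add: compl_preimage_def)

text \<open>Take a point on the first line, a second line that avoids it, and a third line that avoids the
  intersection of the first two.\<close>

lemma independent_lines:
  assumes "\<not> concurrent d \<alpha>"
  shows "\<exists>i j k. i \<in> {1..d} \<and> j \<in> {1..d} \<and> k \<in> {1..d} \<and> lin (\<alpha> k) (crossp (\<alpha> i) (\<alpha> j)) \<noteq> 0"
proof -
  have off: "\<exists>k\<in>{1..d}. lin (\<alpha> k) v \<noteq> 0" if v: "v \<noteq> (\<lambda>_. 0)" for v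
  proof -
    have P: "cspan1 v \<in> P2" using v by (auto simp: P2_iff)
    then obtain k where "k \<in> {1..d}" "cspan1 v \<notin> zero_line (\<alpha> k)"
      using assms unfolding concurrent_def by blast
    then show ?thesis using zero_line_iff[OF P cspan1_self v] by blast
  qed
  have 1: "1 \<in> {1..d}" using d_pos by simp
  obtain v where v: "v \<noteq> (\<lambda>_. 0)" "lin (\<alpha> 1) v = 0" using kernel_nonzero by blast
  obtain j where j: "j \<in> {1..d}" "lin (\<alpha> j) v \<noteq> 0" using off[OF v(1)] by blast
  then have "1 \<noteq> j" using v(2) by auto
  then have "crossp (\<alpha> 1) (\<alpha> j) \<noteq> (\<lambda>_. 0)" by (rule crossp_\<alpha>_nonzero[OF 1 j(1)])
  then obtain k where "k \<in> {1..d}" "lin (\<alpha> k) (crossp (\<alpha> 1) (\<alpha> j)) \<noteq> 0" using off by blast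
  then show ?thesis using 1 j(1) by blast
qed

lemma arr_map_value:
  assumes x: "x \<in> X" "bproj x \<notin> L2 d \<alpha>" and v: "v \<in> bproj x" "v \<noteq> (\<lambda>_. 0)"
    and w: "w \<in> arr_map d \<alpha> x" "w \<noteq> (\<lambda>_. 0)"
  shows "\<exists>\<kappa>. \<kappa> \<noteq> 0 \<and> (\<forall>i\<in>{1..d}. w (lsec i) = \<kappa> * lprod i v)"
proof -
  obtain U fr where U: "frame U fr" "x \<in> U" using frame_at[OF x(1)] by blast
  have fn: "fr x v \<noteq> 0" by (rule frame_nonzero[OF U x(2) v])
  obtain c where c: "w = (\<lambda>s. c * ev U fr x s)"
    using w(1) arr_map_eq(1)[OF U] by (auto simp: cspan1_def)
  then have c0: "c \<noteq> 0" using w(2) by auto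
  have "w (lsec i) = c / fr x v * lprod i v" if i: "i \<in> {1..d}" for i
  proof -
    have "lsec i x v = coef U fr (lsec i) x * fr x v"
      using coef[OF lsec_H0[OF i] U(1)] U(2) v(1) unfolding is_coef_def by blast
    then have "lprod i v = coef U fr (lsec i) x * fr x v"
      using x v by (simp add: lsec_def)
    moreover have "ev U fr x (lsec i) = coef U fr (lsec i) x"
      unfolding ev_def by (rule if_P) (rule lsec_H0[OF i])
    ultimately show ?thesis using fn unfolding c by simp
  qed
  then show ?thesis using c0 fn by (intro exI[of _ "c / fr x v"]) simp
qed

text \<open>The map is \<open>v \<mapsto> [1/\<alpha>\<^sub>1(v) : \<dots> : 1/\<alpha>\<^sub>d(v)]\<close> off the lines; from three of the values one recovers
  \<open>\<alpha>\<^sub>i(v), \<alpha>\<^sub>j(v), \<alpha>\<^sub>k(v)\<close> up to a common factor as products of two of them, and from these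
  \<open>v\<close>.\<close>

definition inverse_vec :: "nat \<Rightarrow> nat \<Rightarrow> nat \<Rightarrow> (sec \<Rightarrow> complex) \<Rightarrow> 3 \<Rightarrow> complex" where
  "inverse_vec i j k w = (\<lambda>l.
     w (lsec j) * w (lsec k) * crossp (\<alpha> j) (\<alpha> k) l +
     w (lsec k) * w (lsec i) * crossp (\<alpha> k) (\<alpha> i) l +
     w (lsec i) * w (lsec j) * crossp (\<alpha> i) (\<alpha> j) l)"

lemma inverse_vec:
  assumes ijk: "i \<in> {1..d}" "j \<in> {1..d}" "k \<in> {1..d}" and D: "lin (\<alpha> k) (crossp (\<alpha> i) (\<alpha> j)) \<noteq> 0"
    and x: "x \<in> compl_preimage d \<alpha>" and w: "w \<in> arr_map d \<alpha> x" "w \<noteq> (\<lambda>_. 0)"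
  shows "inverse_vec i j k w \<in> bproj x" "inverse_vec i j k w \<noteq> (\<lambda>_. 0)" "w (lsec i) \<noteq> 0"
proof -
  have xX: "x \<in> X" and off: "bproj x \<notin> L2 d \<alpha>"
    using x L2_subset_arr_union by (auto simp: compl_preimage_iff)
  define v where "v = rep (bproj x)"
  have v: "v \<in> bproj x" "v \<noteq> (\<lambda>_. 0)" "bproj x = cspan1 v"
    using rep[OF bproj_P2[OF xX]] by (simp_all add: v_def)
  have a: "lin (\<alpha> n) v \<noteq> 0" if n: "n \<in> {1..d}" for n
    using zero_line_iff[OF bproj_P2[OF xX] v(1,2)] n x by (auto simp: compl_preimage_iff arr_union_def)
  obtain \<kappa> where \<kappa>: "\<kappa> \<noteq> 0" "\<And>n. n \<in> {1..d} \<Longrightarrow> w (lsec n) = \<kappa> * lprod n v"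
    using arr_map_value[OF xX off v(1,2) w] by blast
  define A where "A = (\<Prod>n\<in>{1..d}. lin (\<alpha> n) v)"
  have A0: "A \<noteq> 0" unfolding A_def by (simp only: prod_zero_iff finite_atLeastAtMost) (use a in blast)
  have "A = lin (\<alpha> n) v * lprod n v" if n: "n \<in> {1..d}" for n
    unfolding A_def lprod_def by (rule prod.remove[OF _ n]) simp
  then have wn: "w (lsec n) = \<kappa> * A / lin (\<alpha> n) v" if n: "n \<in> {1..d}" for n
    using a[OF n] \<kappa>(2)[OF n] n by simp
  show "w (lsec i) \<noteq> 0" using wn[OF ijk(1)] \<kappa>(1) A0 a[OF ijk(1)] by simp
  define \<mu> where "\<mu> = (\<kappa> * A)\<^sup>2 / (lin (\<alpha> i) v * lin (\<alpha> j) v * lin (\<alpha> k) v)"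
  have \<mu>: "\<mu> \<noteq> 0" unfolding \<mu>_def using a[OF ijk(1)] a[OF ijk(2)] a[OF ijk(3)] \<kappa>(1) A0 by simp
  have p: "w (lsec j) * w (lsec k) = \<mu> * lin (\<alpha> i) v" "w (lsec k) * w (lsec i) = \<mu> * lin (\<alpha> j) v"
    "w (lsec i) * w (lsec j) = \<mu> * lin (\<alpha> k) v"
    unfolding \<mu>_def using wn[OF ijk(1)] wn[OF ijk(2)] wn[OF ijk(3)] a[OF ijk(1)] a[OF ijk(2)] a[OF ijk(3)]
    by (simp_all add: power2_eq_square mult_ac)
  have "inverse_vec i j k w l = \<mu> * (lin (\<alpha> i) v * crossp (\<alpha> j) (\<alpha> k) l +
      lin (\<alpha> j) v * crossp (\<alpha> k) (\<alpha> i) l + lin (\<alpha> k) v * crossp (\<alpha> i) (\<alpha> j) l)" for l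
    unfolding inverse_vec_def p by (simp add: distrib_left mult.assoc)
  also have "\<dots> l = \<mu> * (lin (\<alpha> k) (crossp (\<alpha> i) (\<alpha> j)) * v l)" for l
    using fun_cong[OF cramer[of "\<alpha> i" v "\<alpha> j" "\<alpha> k"]] by simp
  finally have iv: "inverse_vec i j k w = (\<lambda>l. (\<mu> * lin (\<alpha> k) (crossp (\<alpha> i) (\<alpha> j))) * v l)"
    by (simp add: fun_eq_iff mult.assoc)
  show "inverse_vec i j k w \<in> bproj x" unfolding iv v(3) cspan1_def by blast
  show "inverse_vec i j k w \<noteq> (\<lambda>_. 0)" unfolding iv using \<mu> D v(2) by (auto simp: fun_eq_iff)
qed

theorem complement_isomorphism:
  assumes nc: "\<not> concurrent d \<alpha>"
  shows "isomorphism (blowup_sub (L2 d \<alpha>) (compl_preimage d \<alpha>))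
    (proj_space (arr_map d \<alpha> ` compl_preimage d \<alpha>)) (arr_map d \<alpha>)"
proof -
  let ?Z = "compl_preimage d \<alpha>" and ?f = "arr_map d \<alpha>"
  let ?T = "?f ` ?Z"
  interpret P: graded_forms "\<lambda>L. L - {\<lambda>_. 0}" forms "(+)" "proj (UNIV :: (sec \<Rightarrow> complex) set)"
    by (rule graded_forms_proj)
  have ZX: "?Z \<subseteq> X" by (auto simp: compl_preimage_iff)
  have Z_ambient: "?Z \<subseteq> ambient" using ZX X_ambient by blast
  have TP: "?T \<subseteq> proj UNIV"
    using arr_map_in_proj ZX proj_mono[of "arr_dual d \<alpha>" UNIV] by blast
  obtain i j k where ijk: "i \<in> {1..d}" "j \<in> {1..d}" "k \<in> {1..d}" and D: "lin (\<alpha> k) (crossp (\<alpha> i) (\<alpha> j)) \<noteq> 0"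
    using independent_lines[OF nc] by blast
  define \<rho> where "\<rho> = (\<lambda>w. off_lift (inverse_vec i j k w))"
  have \<rho>: "\<rho> w \<in> mlift J x" if "x \<in> ?Z" "w \<in> ?f x" "w \<noteq> (\<lambda>_. 0)" for x w
  proof -
    have "x \<in> X" "bproj x \<notin> L2 d \<alpha>" using that(1) L2_subset_arr_union by (auto simp: compl_preimage_iff)
    then show ?thesis
      unfolding \<rho>_def by (rule off_lift_in) (rule inverse_vec[OF ijk D that])+
  qed
  have inj: "inj_on ?f ?Z"
  proof (rule inj_onI)
    fix x y assume xy: "x \<in> ?Z" "y \<in> ?Z" "?f x = ?f y"
    obtain w where w: "w \<in> ?f x" "w \<noteq> (\<lambda>_. 0)"
      using proj_nonzero_elem[of "?f x" UNIV] TP xy(1) by blast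
    have "\<rho> w \<in> mlift J x" "\<rho> w \<in> mlift J y" using \<rho> xy w by simp_all
    moreover have "x \<in> X" "y \<in> X" using ZX xy by blast+
    ultimately show "x = y" using pt_unique by metis
  qed
  have "morphism (proj_space ?T) (blowup_sub (L2 d \<alpha>) ?Z) (inv_into ?Z ?f)"
    unfolding proj_space_def blowup_sub_embedded
  proof (rule morphism_by_local_lift[OF P.graded_forms_axioms G.graded_forms_axioms TP Z_ambient])
    show "multiforms J e \<subseteq> poly_funs" for e by (auto simp: multiforms_def)
    show "inv_into ?Z ?f ` ?T \<subseteq> ?Z" by (auto intro: inv_into_into)
    fix L assume L: "L \<in> ?T"
    \<comment> \<open>The inverse is given by quadratic forms; dividing by a quadratic form makes the entries regular.\<close>
    define \<sigma> where "\<sigma> = (\<lambda>L l. \<rho> (P.rp L) l / (P.rp L (lsec i) * P.rp L (lsec i)))"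
    have w: "P.rp M \<in> ?f (inv_into ?Z ?f M)" "P.rp M \<noteq> (\<lambda>_. 0)" "inv_into ?Z ?f M \<in> ?Z" if M: "M \<in> ?T" for M
    proof -
      have "P.rp M \<in> M - {\<lambda>_. 0}" using P.rp_in TP M by blast
      then show "P.rp M \<in> ?f (inv_into ?Z ?f M)" "P.rp M \<noteq> (\<lambda>_. 0)"
        using f_inv_into_f[OF M] by auto
      show "inv_into ?Z ?f M \<in> ?Z" by (rule inv_into_into[OF M])
    qed
    have wi: "P.rp M (lsec i) \<noteq> 0" if M: "M \<in> ?T" for M
      by (rule inverse_vec(3)[OF ijk D w(3,1,2)[OF M]])
    have \<sigma>1: "\<sigma> M \<in> mlift J (inv_into ?Z ?f M)" if M: "M \<in> ?T" for M
    proof -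
      have "(\<lambda>l. inverse (P.rp M (lsec i) * P.rp M (lsec i)) * \<rho> (P.rp M) l) \<in> mlift J (inv_into ?Z ?f M)"
        by (rule mlift_scale[OF _ \<rho>[OF w(3,1,2)[OF M]]]) (use w(3)[OF M] ZX wi[OF M] in auto)
      then show ?thesis by (simp add: \<sigma>_def divide_inverse mult.commute)
    qed
    have q: "(\<lambda>w. inverse_vec i j k w l) \<in> forms 2" for l
    proof -
      have "(\<lambda>w. w (lsec a) * w (lsec b) * c) \<in> forms 2" for a b c
        using forms_scale[OF forms_quadratic, of c] by (simp add: mult.commute mult.left_commute)
      then show ?thesis unfolding inverse_vec_def by (intro forms_add)
    qed
    have "(\<lambda>w. \<rho> w l) \<in> forms 2" for l
    proof -
      obtain jj n where l: "l = (jj, n)" by (cases l)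
      show ?thesis
        unfolding l \<rho>_def off_lift_def crossp_def
        by (cases jj) (simp_all add: q forms_diff forms_scale)
    qed
    then have \<sigma>2: "(\<lambda>M. \<sigma> M l) \<in> rfun (\<lambda>L. L - {\<lambda>_. 0}) forms ?T" for l
      unfolding \<sigma>_def by (rule P.rfun_quotient[OF _ forms_quadratic TP]) (simp add: wi)
    have "openin (zar (embedded (\<lambda>L. L - {\<lambda>_. 0}) forms ?T)) ?T"
      using openin_topspace[of "zar (embedded (\<lambda>L. L - {\<lambda>_. 0}) forms ?T)"] P.points_embedded[OF TP] by simp
    then show "\<exists>U \<rho>. openin (zar (embedded (\<lambda>L. L - {\<lambda>_. 0}) forms ?T)) U \<and> L \<in> U \<and>
        (\<forall>y\<in>U. \<rho> y \<in> mlift J (inv_into ?Z ?f y)) \<and>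
        (\<forall>k. (\<lambda>y. \<rho> y k) \<in> rfun (\<lambda>L. L - {\<lambda>_. 0}) forms U)"
      using L \<sigma>1 \<sigma>2 by (intro exI[of _ ?T] exI[of _ \<sigma>] conjI ballI allI)
  qed
  moreover have "morphism (blowup_sub (L2 d \<alpha>) ?Z) (proj_space ?T) ?f"
    by (rule arr_map_restrict_morphism[OF ZX TP subset_refl])
  moreover have "points (blowup_sub (L2 d \<alpha>) ?Z) = ?Z"
    unfolding blowup_sub_embedded by (rule G.points_embedded[OF Z_ambient])
  moreover have "points (proj_space ?T) = ?T"
    unfolding proj_space_def by (rule P.points_embedded[OF TP])
  ultimately show ?thesis
    unfolding isomorphism_def using inj_on_imp_bij_betw[OF inj] by simp
qed

end

section \<open>The exceptional curves\<close>

lemma poly_as_sum_upto: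
  fixes x :: complex
  assumes "degree p \<le> n"
  shows "poly p x = (\<Sum>j\<le>n. coeff p j * x ^ j)"
proof -
  have "poly p x = poly (\<Sum>j\<le>n. monom (coeff p j) j) x"
    using poly_as_sum_of_monoms'[OF assms] by simp
  then show ?thesis by (simp add: poly_sum poly_monom)
qed

text \<open>Lagrange interpolation in degree at most \<open>card S\<close>, where one of the nodes is at infinity.\<close>

lemma interpolation_with_infinity:
  fixes Q0 :: "complex poly"
  assumes S: "finite S" "inj_on \<rho> S"
    and Q0: "degree Q0 = card S" "Q0 \<noteq> 0" "\<And>j. j \<in> S \<Longrightarrow> poly Q0 (\<rho> j) = 0"
    and Q: "\<And>i. i \<in> S \<Longrightarrow> degree (Q i) < card S" "\<And>i. i \<in> S \<Longrightarrow> poly (Q i) (\<rho> i) \<noteq> 0"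
      "\<And>i j. i \<in> S \<Longrightarrow> j \<in> S \<Longrightarrow> i \<noteq> j \<Longrightarrow> poly (Q i) (\<rho> j) = 0"
    and q: "degree q \<le> card S"
  shows "\<exists>c0 c. q = smult c0 Q0 + (\<Sum>i\<in>S. smult (c i) (Q i))"
proof -
  define c0 where "c0 = coeff q (card S) / coeff Q0 (card S)"
  define c where "c = (\<lambda>i. poly q (\<rho> i) / poly (Q i) (\<rho> i))"
  define D where "D = q - (smult c0 Q0 + (\<Sum>i\<in>S. smult (c i) (Q i)))"
  have lead: "coeff Q0 (card S) \<noteq> 0" using Q0(1,2) leading_coeff_neq_0 by metis
  have root: "poly D (\<rho> j) = 0" if j: "j \<in> S" for j
  proof -
    have "(\<Sum>i\<in>S. c i * poly (Q i) (\<rho> j)) = (\<Sum>i\<in>S. if i = j then poly q (\<rho> j) else 0)"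
      by (rule sum.cong[OF refl]) (use Q(2,3) j in \<open>auto simp: c_def\<close>)
    also have "\<dots> = poly q (\<rho> j)" using S(1) j by simp
    finally show ?thesis using Q0(3)[OF j] by (simp add: D_def poly_sum)
  qed
  have coeff: "coeff D n = 0" if n: "n \<ge> card S" for n
  proof -
    have "coeff (Q i) n = 0" if "i \<in> S" for i
      using Q(1)[OF that] n by (intro coeff_eq_0) simp
    then have 1: "coeff (\<Sum>i\<in>S. smult (c i) (Q i)) n = 0" by (simp add: coeff_sum)
    show ?thesis
    proof (cases "n = card S")
      case True
      then show ?thesis using 1 lead by (simp add: D_def c0_def)
    next
      case False
      then have "coeff q n = 0" "coeff Q0 n = 0" using n q Q0(1) by (auto intro: coeff_eq_0)
      then show ?thesis using 1 by (simp add: D_def)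
    qed
  qed
  have "D = 0"
  proof (rule ccontr)
    assume D: "D \<noteq> 0"
    have "coeff D (degree D) \<noteq> 0" using D leading_coeff_neq_0 by blast
    then have "degree D < card S" using coeff not_le by blast
    moreover have "card S = card (\<rho> ` S)" using card_image[OF S(2)] by simp
    moreover have "card (\<rho> ` S) \<le> card {x. poly D x = 0}"
      using poly_roots_finite[OF D] root by (intro card_mono) auto
    moreover have "card {x. poly D x = 0} \<le> degree D" by (rule card_poly_roots_bound[OF D])
    ultimately show False by linarith
  qed
  then have "q = smult c0 Q0 + (\<Sum>i\<in>S. smult (c i) (Q i))" by (simp add: D_def)
  then show ?thesis by blast
qed

context arrangement_chart
begin

text \<open>The chart contains the exceptional curve over \<open>p\<close> except for one point, with \<open>w\<close> as its
  parameter.\<close>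

definition exc :: "complex \<Rightarrow> bpt" where
  "exc t = pt (ch.\<Psi> 0 t)"

lemma exc:
  shows exc_X: "exc t \<in> X" and exc_lift: "ch.\<Psi> 0 t \<in> mlift J (exc t)"
    and exc_bproj: "bproj (exc t) = p" and exc_W: "exc t \<in> ch.W"
    and exc_coords: "ch.ucoord (exc t) = 0" "ch.wcoord (exc t) = t"
proof -
  have b0: "ch.base 0 t = pv" by (simp add: ch.base_def)
  have nz: "cv (ch.\<Psi> 0 t) j \<noteq> (\<lambda>_. 0)" if j: "j \<in> J" for j
  proof (cases j)
    case None
    then show ?thesis using ch.pv_nonzero by (simp add: ch.cv_\<Psi> b0)
  next
    case (Some q)
    show ?thesis
    proof (cases "q = p")
      case True
      have "lin (\<lambda>i. e i + t * f i) e' = 1"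
        using ch.basis unfolding lin_simps by (simp add: dual_basis_def)
      then have "(\<lambda>i. e i + t * f i) \<noteq> (\<lambda>_. 0)" using lin_zero(2)[of e'] by auto
      then show ?thesis using Some True by (simp only: ch.cv_\<Psi>) blast
    next
      case False
      have "q \<in> P2" using j Some L2_subset_P2 by auto
      moreover have "cspan1 pv \<noteq> q" using False ch.p_span by simp
      ultimately show ?thesis
        unfolding Some ch.cv_\<Psi>(3)[OF False] b0 by (intro crossp_rep_nonzero ch.pv_nonzero)
    qed
  qed
  show X: "exc t \<in> X"
    unfolding exc_def by (rule pt_blowup(1)[OF _ ch.\<Psi>_incident]) (rule nz)
  show l: "ch.\<Psi> 0 t \<in> mlift J (exc t)"
    unfolding exc_def by (rule pt_blowup(2)[OF _ ch.\<Psi>_incident]) (rule nz)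
  show bp: "bproj (exc t) = p"
    unfolding lift_bproj[OF X l] ch.cv_\<Psi> b0 by (rule ch.p_span[symmetric])
  have "lin g (cv (ch.\<Psi> 0 t) None) \<noteq> 0" "lin e' (cv (ch.\<Psi> 0 t) (Some p)) \<noteq> 0"
    using ch.basis by (simp_all add: ch.cv_\<Psi> ch.lin_base lin_simps) (simp add: dual_basis_def lin_commute)
  then have "lin g (cv (G.rp (exc t)) None) \<noteq> 0" "lin e' (cv (G.rp (exc t)) (Some p)) \<noteq> 0"
    using G.nonzero_iff[OF _ rp_lift[OF X] l lin_form[of None g]]
      G.nonzero_iff[OF _ rp_lift[OF X] l lin_form[of "Some p" e']] X X_ambient ch.p_C by blast+
  then show "exc t \<in> ch.W" using X bp unfolding ch.W_def by blast
  show "ch.ucoord (exc t) = 0" "ch.wcoord (exc t) = t" by (rule ch.\<Psi>_coords[OF X l])+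
qed

lemma exceptional_in_chart: "y \<in> ch.W \<Longrightarrow> bproj y = p \<Longrightarrow> y = exc (ch.wcoord y)"
  using ch.W_eq_pt[of y] ch.ucoord_zero_iff[of y] by (simp add: exc_def)

text \<open>The restriction of a section to the exceptional curve, as a polynomial in \<open>w\<close>.\<close>

definition epoly :: "sec \<Rightarrow> complex poly" where
  "epoly s = (SOME P. \<forall>t. coef ch.W cframe s (exc t) = poly P t)"

lemma epoly:
  assumes s: "s \<in> sections"
  shows "poly (epoly s) t = coef ch.W cframe s (exc t)"
proof -
  have c: "coef ch.W cframe s \<in> rg ch.W" using coef[OF s cframe] by (simp add: is_coef_def)
  have "\<exists>P. \<forall>t. t \<notin> {} \<longrightarrow> coef ch.W cframe s (exc t) = poly P t"
  proof (rule locally_rational_imp_polynomial[of "{}" "\<lambda>t. coef ch.W cframe s (exc t)"])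
    fix t0
    obtain F G B where *: "finite B" "t0 \<notin> B" "poly G t0 \<noteq> 0"
      "\<forall>t. t \<notin> B \<longrightarrow> pt (ch.\<Psi> 0 t) \<in> ch.W \<and> ch.\<Psi> 0 t \<in> mlift J (pt (ch.\<Psi> 0 t)) \<and> poly G t \<noteq> 0 \<and>
       coef ch.W cframe s (pt (ch.\<Psi> 0 t)) * poly G t = poly F t"
      using regular_on_curve[where \<Lambda> = "ch.\<Psi> 0" and N = ch.W and ?t0.0 = t0, OF ch.w_curve ch.op_W exc_W exc_lift c]
      by blast
    show "\<exists>F G B'. finite B' \<and> t0 \<notin> B' \<and> poly G t0 \<noteq> 0 \<and>
        (\<forall>t. t \<notin> {} \<longrightarrow> t \<notin> B' \<longrightarrow> coef ch.W cframe s (exc t) * poly G t = poly F t)"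
      by (rule exI[of _ F], rule exI[of _ G], rule exI[of _ B]) (use * in \<open>simp add: exc_def\<close>)
  qed simp
  then have "\<exists>P. \<forall>t. coef ch.W cframe s (exc t) = poly P t" by simp
  then have "\<forall>t. coef ch.W cframe s (exc t) = poly (epoly s) t"
    unfolding epoly_def by (rule someI_ex)
  then show ?thesis by (simp only:)
qed

lemma epoly_linear:
  assumes s: "s \<in> sections" and t: "t \<in> sections"
  shows "epoly (\<lambda>x v. c * s x v + t x v) = smult c (epoly s) + epoly t"
proof -
  have "poly (epoly (\<lambda>x v. c * s x v + t x v)) z = poly (smult c (epoly s) + epoly t) z" for z
    unfolding poly_add poly_smult epoly[OF s] epoly[OF t] epoly[OF H0_linear[OF s t]]
    by (rule coef_linear[OF s t cframe exc_W])
  then show ?thesis by (intro poly_eq_poly_eq_iff[THEN iffD1] ext)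
qed

lemma epoly_lsec:
  assumes i: "i \<in> I p"
  shows "epoly (lsec i) = smult (\<Prod>j\<in>{1..d} - I p. lin (\<alpha> j) pv)
    (\<Prod>j\<in>I p - {i}. [:lin (\<alpha> j) f', - lin (\<alpha> j) e':])"
proof -
  have id: "i \<in> {1..d}" using i I_subset by blast
  have "poly (epoly (lsec i)) t = poly (smult (\<Prod>j\<in>{1..d} - I p. lin (\<alpha> j) pv)
    (\<Prod>j\<in>I p - {i}. [:lin (\<alpha> j) f', - lin (\<alpha> j) e':])) t" for t
  proof -
    have "poly (epoly (lsec i)) t = lcoef i 0 t"
      unfolding epoly[OF lsec_H0[OF id]]
      using coef_eq[OF lsec_H0[OF id] cframe ch.op_W subset_refl lsec_coef_chart[OF id] exc_W]
      by (simp only: exc_coords)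
    also have "\<dots> = (\<Prod>j\<in>{1..d} - {i}. if j \<in> I p then lin (\<alpha> j) f' - t * lin (\<alpha> j) e' else lin (\<alpha> j) pv)"
      by (simp only: lcoef_def i if_True mult_1_left mult_zero_left add_0_right)
    also have "\<dots> = (\<Prod>j\<in>({1..d} - {i}) \<inter> {j. j \<in> I p}. lin (\<alpha> j) f' - t * lin (\<alpha> j) e') *
        (\<Prod>j\<in>({1..d} - {i}) \<inter> - {j. j \<in> I p}. lin (\<alpha> j) pv)"
      by (rule prod.If_cases) simp
    also have "({1..d} - {i}) \<inter> {j. j \<in> I p} = I p - {i}" using I_subset by blast
    also have "({1..d} - {i}) \<inter> - {j. j \<in> I p} = {1..d} - I p" using i by blast
    finally show ?thesis by (simp add: poly_prod mult.commute)
  qed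
  then show ?thesis by (intro poly_eq_poly_eq_iff[THEN iffD1] ext)
qed

lemma arr_map_exc:
  "arr_map d \<alpha> (exc t) = cspan1 (\<lambda>s. if s \<in> sections then poly (epoly s) t else 0)"
proof -
  have "ev ch.W cframe (exc t) = (\<lambda>s. if s \<in> sections then poly (epoly s) t else 0)"
    unfolding ev_def using epoly by (auto simp: fun_eq_iff)
  then show ?thesis using arr_map_eq(1)[OF cframe exc_W] by simp
qed

text \<open>The other affine chart of the exceptional curve: \<open>e\<close> and \<open>f\<close> are exchanged.\<close>

lemma swapped_chart: "arrangement_chart d \<alpha> p f e g f' e' pv"
proof (rule arrangement_chartI)
  have "dual_basis f e g f' e' pv" using ch.basis by (simp add: dual_basis_def)
  then show "blowup_chart (L2 d \<alpha>) p f e g f' e' pv"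
    by (intro blowup_chart.intro blowup_plane_axioms blowup_chart_axioms.intro ch.p_C ch.p_span)
qed

text \<open>Exchanging \<open>e\<close> and \<open>f\<close> replaces \<open>w\<close> by \<open>1/w\<close> and \<open>u\<close> by \<open>-w u\<close>, so that the frame is multiplied by
  \<open>(-w)^\<mu>\<close>.\<close>

lemma epoly_transition:
  assumes s: "s \<in> sections"
  shows "degree (epoly s) \<le> mu d \<alpha> p"
    "coeff (epoly s) (mu d \<alpha> p) =
      (-1) ^ mu d \<alpha> p * coeff (arrangement_chart.epoly d \<alpha> p f e g f' e' pv s) 0"
proof -
  interpret c2: arrangement_chart d \<alpha> p f e g f' e' pv by (rule swapped_chart)
  let ?m = "mu d \<alpha> p"
  have exc2: "exc t = c2.exc (inverse t)" if t: "t \<noteq> 0" for t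
  proof -
    have "cv (c2.ch.\<Psi> 0 (inverse t)) j \<in> exc t j - {\<lambda>_. 0}" if j: "j \<in> J" for j
    proof (cases "j = Some p")
      case True
      have "cv (c2.ch.\<Psi> 0 (inverse t)) (Some p) = (\<lambda>i. inverse t * cv (ch.\<Psi> 0 t) (Some p) i)"
        using t by (simp add: c2.ch.\<Psi>_def ch.\<Psi>_def fun_eq_iff field_simps)
      moreover have "exc t (Some p) = cspan1 (cv (ch.\<Psi> 0 t) (Some p))"
        using lift_cspan1[OF exc_X exc_lift] j True by blast
      moreover have "cv (ch.\<Psi> 0 t) (Some p) \<noteq> (\<lambda>_. 0)"
        using lift_comp[OF exc_lift] j True by blast
      ultimately show ?thesis using t unfolding True by (auto simp: cspan1_def fun_eq_iff)
    next
      case False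
      have "cv (c2.ch.\<Psi> 0 (inverse t)) j = cv (ch.\<Psi> 0 t) j"
        using False by (cases j) (auto simp: c2.ch.\<Psi>_def ch.\<Psi>_def c2.ch.base_def ch.base_def)
      then show ?thesis using lift_comp[OF exc_lift j] by simp
    qed
    then have "c2.ch.\<Psi> 0 (inverse t) \<in> mlift J (exc t)" unfolding mlift_def by blast
    then show ?thesis unfolding c2.exc_def by (rule pt_unique[OF exc_X])
  qed
  have u2: "c2.ch.ucoord y = - ch.wcoord y * ch.ucoord y" if y: "y \<in> ch.W" for y
  proof -
    have yX: "y \<in> X" using y ch.W_X by blast
    show ?thesis
      using ch.form_ratio[OF yX ch.\<Psi>_lift[OF y], of None e g]
      unfolding c2.ch.ucoord_def ch.cv_\<Psi> ch.lin_base by simp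
  qed
  let ?N = "c2.ch.W \<inter> ch.W"
  have N: "op ?N" by (rule openin_Int[OF c2.ch.op_W ch.op_W])
  have "(\<lambda>y. (- ch.wcoord y) ^ ?m) \<in> rg ?N"
    using rfun_mono[OF ch.wcoord_regular Int_lower2] G.rfun_diff[OF G.rfun_const[of 0]]
    by (intro G.rfun_power) force
  then have ic: "is_coef ?N cframe s (\<lambda>y. coef c2.ch.W c2.cframe s y * (- ch.wcoord y) ^ ?m)"
  proof (rule is_coef_change[OF coef[OF s c2.cframe]])
    fix y v assume y: "y \<in> ?N"
    then have "c2.ch.ucoord y ^ ?m = (- ch.wcoord y) ^ ?m * ch.ucoord y ^ ?m"
      using u2[of y] by (simp only: Int_iff power_mult_distrib)
    then show "c2.cframe y v = (- ch.wcoord y) ^ ?m * cframe y v"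
      unfolding c2.cframe_def cframe_def by simp
  qed
  have rel: "poly (epoly s) t = (-1) ^ ?m * t ^ ?m * poly (c2.epoly s) (inverse t)" if t: "t \<noteq> 0" for t
  proof -
    have "exc t \<in> ?N" by (rule IntI[OF _ exc_W]) (simp only: exc2[OF t] c2.exc_W)
    then have "coef ch.W cframe s (exc t) = coef c2.ch.W c2.cframe s (exc t) * (- t) ^ ?m"
      using coef_eq[OF s cframe N Int_lower2 ic] by (simp only: exc_coords)
    then show ?thesis
      unfolding epoly[OF s] c2.epoly[OF s] exc2[OF t, symmetric] power_minus[of t] by (simp only: mult_ac)
  qed
  show "degree (epoly s) \<le> ?m" "coeff (epoly s) ?m = (-1) ^ ?m * coeff (c2.epoly s) 0"
    using polynomial_at_infinity[of "{}" "epoly s" "(-1) ^ ?m" ?m "c2.epoly s"] rel by blast+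
qed

lemma exceptional_cover:
  assumes y: "y \<in> exceptional (L2 d \<alpha>) p"
  shows "(\<exists>t. y = exc t) \<or> y = arrangement_chart.exc d \<alpha> p f e f' e' pv 0"
proof -
  interpret c2: arrangement_chart d \<alpha> p f e g f' e' pv by (rule swapped_chart)
  have yX: "y \<in> X" and bp: "bproj y = p" using y by (simp_all add: exceptional_iff)
  define v where "v = G.rp y"
  have v: "v \<in> mlift J y" unfolding v_def by (rule rp_lift[OF yX])
  define l where "l = cv v (Some p)"
  have lnz: "l \<noteq> (\<lambda>_. 0)" using lift_comp[OF v, of "Some p"] ch.p_C by (simp add: l_def)
  obtain c where c: "cv v None = (\<lambda>i. c * pv i)" "c \<noteq> 0"
  proof -
    have "cv v None \<in> cspan1 pv" "cv v None \<noteq> (\<lambda>_. 0)"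
      using lift_comp[OF v, of None] bp ch.p_span by (simp_all add: bproj_def)
    then obtain c where c: "cv v None = (\<lambda>i. c * pv i)" unfolding cspan1_def by blast
    have "c \<noteq> 0"
    proof
      assume "c = 0"
      then have "cv v None = (\<lambda>_. 0)" using c by simp
      with \<open>cv v None \<noteq> _\<close> show False by blast
    qed
    with c show ?thesis by (rule that)
  qed
  have "lin l (cv v None) = 0"
    using lift_incident[OF yX v] ch.p_C unfolding incident_def l_def by blast
  then have lp: "lin l pv = 0" using c by (simp add: lin_scale_right)
  have gn: "lin g (cv v None) \<noteq> 0"
    using c ch.basis by (simp add: lin_scale_right dual_basis_def)
  show ?thesis
  proof (cases "lin l e' = 0")
    case False
    then have "y \<in> ch.W"
      using yX bp gn by (simp add: ch.W_def l_def v_def lin_commute)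
    then show ?thesis using exceptional_in_chart bp by blast
  next
    case True
    then have l: "l = (\<lambda>i. lin l f' * f i)"
      using dual_basis_form[OF ch.basis, of l] lp by simp
    have "lin l f' \<noteq> 0"
    proof
      assume "lin l f' = 0"
      then have "l = (\<lambda>_. 0)" by (subst l) simp
      then show False using lnz by blast
    qed
    then have "y \<in> c2.ch.W"
      using yX bp gn by (simp add: c2.ch.W_def l_def v_def lin_commute)
    moreover have "c2.ch.wcoord y = 0"
      using True unfolding c2.ch.wcoord_def by (simp add: l_def v_def lin_commute)
    ultimately show ?thesis using c2.exceptional_in_chart bp by metis
  qed
qed

text \<open>The polynomial of \<open>l\<^sub>i\<close> vanishes at the slopes of all the lines through \<open>p\<close> except \<open>i\<close>, so that
  these polynomials form an interpolation basis.  The choice of \<open>f\<close> puts one of the slopes at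
  infinity.\<close>

lemma epoly_lsec_spans:
  assumes i0: "i0 \<in> I p" and f: "f = \<alpha> i0" and q: "degree q \<le> mu d \<alpha> p"
  shows "\<exists>c. q = (\<Sum>i\<in>I p. smult (c i) (epoly (lsec i)))"
proof -
  define S where "S = I p - {i0}"
  have S: "finite S" using I_finite by (simp add: S_def)
  have cS: "card S = mu d \<alpha> p" using i0 I_finite by (simp add: S_def mu_def)
  have Id: "j \<in> I p \<Longrightarrow> j \<in> {1..d}" for j using I_subset by blast
  have ab0: "lin (\<alpha> i0) f' = 1" "lin (\<alpha> i0) e' = 0"
    using ch.basis unfolding f[symmetric] by (simp_all add: dual_basis_def)
  have dec: "\<alpha> j = (\<lambda>l. lin (\<alpha> j) e' * e l + lin (\<alpha> j) f' * f l)" if "j \<in> I p" for j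
    using dual_basis_form[OF ch.basis, of "\<alpha> j"] I_p[of j] that by simp
  have b: "lin (\<alpha> j) e' \<noteq> 0" if j: "j \<in> S" for j
  proof
    assume "lin (\<alpha> j) e' = 0"
    then have "\<alpha> j = (\<lambda>l. lin (\<alpha> j) f' * \<alpha> i0 l)" using dec[of j] j f by (simp add: S_def)
    then show False using \<alpha>_distinct[of j i0] Id[of j] Id[OF i0] j by (simp add: S_def) 
  qed
  define \<rho> where "\<rho> = (\<lambda>j. lin (\<alpha> j) f' / lin (\<alpha> j) e')"
  have inj: "inj_on \<rho> S"
  proof (rule inj_onI, rule ccontr)
    fix j n assume jn: "j \<in> S" "n \<in> S" "\<rho> j = \<rho> n" "j \<noteq> n"
    have jI: "j \<in> I p" "n \<in> I p" using jn by (simp_all add: S_def)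
    have r: "lin (\<alpha> j) f' = lin (\<alpha> j) e' / lin (\<alpha> n) e' * lin (\<alpha> n) f'"
      using jn(3) b[OF jn(1)] b[OF jn(2)] by (simp add: \<rho>_def field_simps)
    have "\<alpha> j = (\<lambda>l. (lin (\<alpha> j) e' / lin (\<alpha> n) e') * \<alpha> n l)"
    proof
      fix l
      have "\<alpha> j l = lin (\<alpha> j) e' * e l + lin (\<alpha> j) f' * f l" by (rule fun_cong[OF dec[OF jI(1)]])
      also have "\<dots> = (lin (\<alpha> j) e' / lin (\<alpha> n) e') * (lin (\<alpha> n) e' * e l + lin (\<alpha> n) f' * f l)"
        unfolding r using b[OF jn(2)] by (simp add: field_simps)
      also have "lin (\<alpha> n) e' * e l + lin (\<alpha> n) f' * f l = \<alpha> n l" by (rule fun_cong[OF dec[OF jI(2)], symmetric])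
      finally show "\<alpha> j l = (lin (\<alpha> j) e' / lin (\<alpha> n) e') * \<alpha> n l" .
    qed
    then show False using \<alpha>_distinct[OF Id[OF jI(1)] Id[OF jI(2)] jn(4)] by blast
  qed
  define K where "K = (\<Prod>j\<in>{1..d} - I p. lin (\<alpha> j) pv)"
  have K: "K \<noteq> 0"
    unfolding K_def by (simp only: prod_zero_iff finite_Diff finite_atLeastAtMost) (use I_p in blast)
  define N where "N = (\<lambda>j. [:lin (\<alpha> j) f', - lin (\<alpha> j) e':])"
  have N: "N j \<noteq> 0" "degree (N j) = 1" "poly (N j) z = 0 \<longleftrightarrow> z = \<rho> j" if "j \<in> S" for j z
    using b[OF that] by (auto simp: N_def \<rho>_def field_simps)
  have E0: "epoly (lsec i0) = smult K (\<Prod>j\<in>S. N j)"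
    using epoly_lsec[OF i0] by (simp add: K_def N_def S_def)
  have E: "epoly (lsec i) = smult K (\<Prod>j\<in>S - {i}. N j)" if i: "i \<in> S" for i
  proof -
    have "I p - {i} = insert i0 (S - {i})" using i i0 by (auto simp: S_def)
    moreover have "N i0 = 1" by (simp add: N_def ab0)
    moreover have "i0 \<notin> S - {i}" by (simp add: S_def)
    ultimately have "(\<Prod>j\<in>I p - {i}. N j) = (\<Prod>j\<in>S - {i}. N j)" using S by simp
    then show ?thesis using epoly_lsec[of i] i by (simp add: K_def N_def S_def)
  qed
  have "\<exists>c0 c. q = smult c0 (epoly (lsec i0)) + (\<Sum>i\<in>S. smult (c i) (epoly (lsec i)))"
  proof (rule interpolation_with_infinity[OF S inj])
    have "degree (\<Prod>j\<in>S. N j) = (\<Sum>j\<in>S. degree (N j))" by (rule degree_prod_sum_eq) (use N in blast)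
    then show "degree (epoly (lsec i0)) = card S" using K N by (simp add: E0)
    show "epoly (lsec i0) \<noteq> 0" unfolding E0 using K N S by simp
    show "poly (epoly (lsec i0)) (\<rho> j) = 0" if "j \<in> S" for j
      unfolding E0 using N(3)[OF that] that S by (auto simp: poly_prod)
    show "degree q \<le> card S" using q cS by simp
  next
    fix i assume i: "i \<in> S"
    have "degree (\<Prod>j\<in>S - {i}. N j) = (\<Sum>j\<in>S - {i}. degree (N j))" by (rule degree_prod_sum_eq) (use N in blast)
    also have "\<dots> = card (S - {i})" using N by simp
    also have "\<dots> < card S" using S i by (rule card_Diff1_less)
    finally show "degree (epoly (lsec i)) < card S" using K by (simp add: E[OF i])
    have "poly (N j) (\<rho> i) \<noteq> 0" if "j \<in> S - {i}" for j
      using N(3)[of j "\<rho> i"] that i inj by (auto dest: inj_onD)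
    then show "poly (epoly (lsec i)) (\<rho> i) \<noteq> 0"
      unfolding E[OF i] using K S by (simp add: poly_prod)
    show "poly (epoly (lsec i)) (\<rho> j) = 0" if "j \<in> S" "i \<noteq> j" for j
      unfolding E[OF i] using N(3)[OF that(1)] that S by (auto simp: poly_prod)
  qed
  then obtain c0 c where c: "q = smult c0 (epoly (lsec i0)) + (\<Sum>i\<in>S. smult (c i) (epoly (lsec i)))" by blast
  have "(\<Sum>i\<in>S. smult ((c(i0 := c0)) i) (epoly (lsec i))) = (\<Sum>i\<in>S. smult (c i) (epoly (lsec i)))"
    by (rule sum.cong) (auto simp: S_def)
  then have "q = (\<Sum>i\<in>I p. smult ((c(i0 := c0)) i) (epoly (lsec i)))"
    using sum.remove[OF I_finite i0, of "\<lambda>i. smult ((c(i0 := c0)) i) (epoly (lsec i))"] c by (simp add: S_def)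
  then show ?thesis by blast
qed

text \<open>The coefficients of \<open>epoly s\<close>, as functionals of \<open>s\<close>, are the coordinates of the rational normal
  curve.  A linear relation between them would hold for all polynomials of degree at most \<open>\<mu>(p)\<close>,
  which are spanned by those of the \<open>l\<^sub>i\<close>; but each coefficient is \<open>1\<close> on one of the monomials and the
  others vanish there.\<close>

lemma exceptional_image:
  assumes i0: "i0 \<in> I p" and f: "f = \<alpha> i0"
  shows "rational_normal_curve (arr_dual d \<alpha>) (mu d \<alpha> p) (arr_map d \<alpha> ` exceptional (L2 d \<alpha>) p)"
proof -
  interpret c2: arrangement_chart d \<alpha> p f e g f' e' pv by (rule swapped_chart)
  let ?m = "mu d \<alpha> p"
  define w where "w = (\<lambda>j s. if s \<in> sections then coeff (epoly s) j else 0)"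
  have w_dual: "w j \<in> arr_dual d \<alpha>" for j
    unfolding arr_dual_def H0_dual_def w_def using H0_linear epoly_linear by simp
  have indep: "c j = 0" if c: "\<forall>s. (\<Sum>j\<le>?m. c j * w j s) = 0" and j: "j \<le> ?m" for c j
  proof -
    have ci: "(\<Sum>n\<le>?m. c n * coeff (epoly (lsec i)) n) = 0" if i: "i \<in> I p" for i
    proof -
      have "lsec i \<in> sections" using i I_subset by (intro lsec_H0) blast
      then have "w n (lsec i) = coeff (epoly (lsec i)) n" for n unfolding w_def by (rule if_P)
      then show ?thesis using spec[OF c, of "lsec i"] by simp
    qed
    have "degree (monom 1 j :: complex poly) \<le> ?m" using j by (simp add: degree_monom_eq)
    then obtain a where a: "monom 1 j = (\<Sum>i\<in>I p. smult (a i) (epoly (lsec i)))"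
      using epoly_lsec_spans[OF i0 f] by blast
    have "c j = (\<Sum>n\<le>?m. c n * coeff (monom 1 j) n)"
      using j by (simp add: mult_delta_right)
    also have "\<dots> = (\<Sum>n\<le>?m. \<Sum>i\<in>I p. a i * (c n * coeff (epoly (lsec i)) n))"
      unfolding a by (simp add: coeff_sum sum_distrib_left mult_ac)
    also have "\<dots> = (\<Sum>i\<in>I p. a i * (\<Sum>n\<le>?m. c n * coeff (epoly (lsec i)) n))"
      by (subst sum.swap) (simp add: sum_distrib_left)
    also have "\<dots> = 0" by (rule sum.neutral) (simp add: ci)
    finally show ?thesis .
  qed
  let ?v = "\<lambda>a b i. \<Sum>j\<le>?m. a ^ (?m - j) * b ^ j * w j i"
  have exc1: "arr_map d \<alpha> (exc t) = cspan1 (?v 1 t)" for t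
  proof -
    have "(if s \<in> sections then poly (epoly s) t else 0) = ?v 1 t s" for s
      using poly_as_sum_upto[OF epoly_transition(1), of s t] by (simp add: w_def mult.commute)
    then show ?thesis unfolding arr_map_exc by simp
  qed
  have exc2: "arr_map d \<alpha> (c2.exc 0) = cspan1 (?v 0 1)"
  proof -
    have "?v 0 1 s = w ?m s" for s
    proof -
      have "?v 0 1 s = (\<Sum>j\<le>?m. if j = ?m then w j s else 0)"
        by (rule sum.cong) auto
      then show ?thesis by simp
    qed
    moreover have "w ?m s = (-1) ^ ?m * (if s \<in> sections then poly (c2.epoly s) 0 else 0)" for s
      using epoly_transition(2)[of s] by (simp add: w_def poly_0_coeff_0)
    ultimately have v01: "?v 0 1 = (\<lambda>s. (-1) ^ ?m * (if s \<in> sections then poly (c2.epoly s) 0 else 0))"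
      by (intro ext) simp
    show ?thesis
      unfolding c2.arr_map_exc v01 by (rule cspan1_scale[symmetric]) simp
  qed
  have scale1: "cspan1 (?v a b) = cspan1 (?v 1 (b / a))" if a: "a \<noteq> 0" for a b
  proof -
    have "?v a b = (\<lambda>s. a ^ ?m * ?v 1 (b / a) s)"
    proof
      fix s
      show "?v a b s = a ^ ?m * ?v 1 (b / a) s"
        unfolding sum_distrib_left
      proof (rule sum.cong[OF refl])
        fix j assume "j \<in> {..?m}"
        then have "a ^ ?m = a ^ (?m - j) * a ^ j" by (simp flip: power_add)
        then show "a ^ (?m - j) * b ^ j * w j s = a ^ ?m * (1 ^ (?m - j) * (b / a) ^ j * w j s)"
          using a by (simp add: power_divide)
      qed
    qed
    then show ?thesis using cspan1_scale[of "a ^ ?m" "?v 1 (b / a)"] a by simp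
  qed
  have scale2: "cspan1 (?v 0 b) = cspan1 (?v 0 1)" if b: "b \<noteq> 0" for b
  proof -
    have "?v 0 b = (\<lambda>s. b ^ ?m * ?v 0 1 s)"
    proof
      fix s
      show "?v 0 b s = b ^ ?m * ?v 0 1 s"
        unfolding sum_distrib_left by (rule sum.cong[OF refl]) (auto simp: power_0_left)
    qed
    then show ?thesis using cspan1_scale[of "b ^ ?m" "?v 0 1"] b by simp
  qed
  have image: "arr_map d \<alpha> ` exceptional (L2 d \<alpha>) p = {cspan1 (?v a b) | a b. (a, b) \<noteq> (0, 0)}"
  proof (intro equalityI subsetI)
    fix L assume "L \<in> arr_map d \<alpha> ` exceptional (L2 d \<alpha>) p"
    then obtain y where y: "y \<in> exceptional (L2 d \<alpha>) p" "L = arr_map d \<alpha> y" by blast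
    then consider t where "L = cspan1 (?v 1 t)" | "L = cspan1 (?v 0 1)"
      using exceptional_cover[OF y(1)] exc1 exc2 by metis
    then show "L \<in> {cspan1 (?v a b) | a b. (a, b) \<noteq> (0, 0)}"
    proof cases
      case (1 t)
      then show ?thesis by (intro CollectI) (rule exI[of _ 1], rule exI[of _ t], simp)
    next
      case 2
      then show ?thesis by (intro CollectI) (rule exI[of _ 0], rule exI[of _ 1], simp)
    qed
  next
    fix L assume "L \<in> {cspan1 (?v a b) | a b. (a, b) \<noteq> (0, 0)}"
    then obtain a b where ab: "L = cspan1 (?v a b)" "(a, b) \<noteq> (0, 0)" by blast
    show "L \<in> arr_map d \<alpha> ` exceptional (L2 d \<alpha>) p"
    proof (cases "a = 0")
      case False
      then have "L = arr_map d \<alpha> (exc (b / a))" using ab scale1 exc1 by simp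
      then show ?thesis using exc_X exc_bproj by (simp add: exceptional_iff)
    next
      case True
      then have "b \<noteq> 0" using ab by simp
      then have "L = arr_map d \<alpha> (c2.exc 0)" using ab True scale2[of b] exc2 by simp
      then show ?thesis using c2.exc_X c2.exc_bproj by (simp add: exceptional_iff)
    qed
  qed
  show ?thesis
    unfolding rational_normal_curve_def
    by (rule exI[of _ w], intro conjI allI impI w_dual image) (rule indep)
qed

end

theorem (in arrangement) exceptional_rational_normal_curve:
  assumes p: "p \<in> L2 d \<alpha>"
  shows "rational_normal_curve (arr_dual d \<alpha>) (mu d \<alpha> p) (arr_map d \<alpha> ` exceptional (L2 d \<alpha>) p)"
proof -
  have pP: "p \<in> P2" using p L2_subset_P2 by blast
  have "I p \<noteq> {}" using p by (auto simp: L2_def)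
  then obtain i0 where i0: "i0 \<in> I p" by blast
  then have i0d: "i0 \<in> {1..d}" using I_subset by blast
  have "lin (\<alpha> i0) (rep p) = 0"
    using I_iff[OF pP rep(1,2)[OF pP]] i0 by blast
  then obtain e g e' f' where "dual_basis (\<alpha> i0) e g f' e' (rep p)"
    using dual_basis_exists[OF \<alpha>_nonzero[OF i0d] rep(2)[OF pP]] by blast
  then have "dual_basis e (\<alpha> i0) g e' f' (rep p)" by (simp add: dual_basis_def)
  then have "blowup_chart (L2 d \<alpha>) p e (\<alpha> i0) g e' f' (rep p)"
    by (intro blowup_chart.intro blowup_plane_axioms blowup_chart_axioms.intro p rep(3)[OF pP, symmetric])
  then interpret arrangement_chart d \<alpha> p e "\<alpha> i0" g e' f' "rep p" by (rule arrangement_chartI)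
  show ?thesis by (rule exceptional_image[OF i0 refl])
qed

section \<open>The map of a line arrangement\<close>

theorem theorem3p4:
  fixes d :: nat and \<alpha> :: "nat \<Rightarrow> 3 \<Rightarrow> complex"
  assumes "line_arrangement d \<alpha>"
  shows "morphism (blowup (L2 d \<alpha>)) (proj_space (proj (arr_dual d \<alpha>))) (arr_map d \<alpha>) \<and>
         (\<not> concurrent d \<alpha> \<longrightarrow>
           isomorphism (blowup_sub (L2 d \<alpha>) (compl_preimage d \<alpha>))
             (proj_space (arr_map d \<alpha> ` compl_preimage d \<alpha>)) (arr_map d \<alpha>)) \<and>
         (\<forall>i\<in>{1..d}. \<exists>q\<in>proj (arr_dual d \<alpha>).
           arr_map d \<alpha> ` strict_transform (L2 d \<alpha>) (zero_line (\<alpha> i)) = {q}) \<and>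
         (\<forall>p\<in>L2 d \<alpha>.
           rational_normal_curve (arr_dual d \<alpha>) (mu d \<alpha> p)
             (arr_map d \<alpha> ` exceptional (L2 d \<alpha>) p))"
proof -
  interpret arrangement d \<alpha> by unfold_locales (fact assms)
  show ?thesis
    using arr_map_morphism complement_isomorphism line_contracted exceptional_rational_normal_curve
    by (intro conjI impI ballI)
qed

end
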